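(* Let $G=(V,E)$ be a decomposable graph, and consider the multinomial model with $N\ge1$ trials and strictly positive cell-probability vector $p$, Markov with respect to $G$. Let $A\subseteq V$ be a cut. Let $C_1',\dots,C_q'$ be a perfect ordering of the cliques of $G_A$, with separators $S_l'$ and residuals $R_l'$ ($l=2,\dots,q$). Let $B_1,\dots,B_p$ be the connected components of $G_{V\setminus A}$ and, for each $l=1,\dots,p$, let $C^{(l)}_1,\dots,C^{(l)}_{m_l}$ be a perfect ordering of the cliques of $G_{B_l\cup\partial B_l}$ with $\partial B_l\subseteq C_1^{(l)}$, with separators $S^{(l)}_j$ and residuals $R_j^{(l)}$ ($j=2,\dots,m_l$). Consider the parametrization $p_A^{cut}=(p_A^{\prime,cond},\,p^{\prime,cond}_{V\setminus A|A})$, where $$p_A^{\prime,cond}=\big(p^{C_1'};\ p^{R_l'|i_{S_l'}},\ l=2,\dots,q,\ i_{S_l'}\in\mathcal I_{S_l'}\big),$$ $$p^{\prime,cond}_{V\setminus A|A}=\big(p^{C_1^{(l)}\setminus\partial B_l|i_{\partial B_l}},\ i_{\partial B_l}\in\mathcal I_{\partial B_l};\ \ p^{R_j^{(l)}|i_{S_j^{(l)}}},\ j=2,\dots,m_l,\ i_{S_j^{(l)}}\in\mathcal I_{S_j^{(l)}};\ \ l=1,\dots,p\big).$$ Then the reference prior for $p_A^{cut}$, relative to the grouping in which each of the probability vectors listed above is one group (groups in any order), is $$\pi^R_{p_A^{cut}}(p_A^{cut})\ \propto\ \prod_{i_{C_1'}\in\mathcal I_{C_1'}}p^{C_1'}(i_{C_1'})^{-1/2}\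 \prod_{l=2}^q\prod_{i_{S_l'}\in\mathcal I_{S_l'}}\prod_{i_{R_l'}\in\mathcal I_{R_l'}}\big(p^{R_l'|i_{S_l'}}(i_{R_l'})\big)^{-1/2}$$ $$\times\prod_{l=1}^p\left(\prod_{i_{\partial B_l}}\prod_{i_{C_1^{(l)}\setminus\partial B_l}}\big(p^{C_1^{(l)}\setminus\partial B_l|i_{\partial B_l}}(i_{C_1^{(l)}\setminus\partial B_l})\big)^{-1/2}\ \prod_{j=2}^{m_l}\prod_{i_{S_j^{(l)}}}\prod_{i_{R_j^{(l)}}}\big(p^{R_j^{(l)}|i_{S_j^{(l)}}}(i_{R_j^{(l)}})\big)^{-1/2}\right),$$ where each marginal cell $i_D$ ranges over $\mathcal I_D$.
   Context: $V$ is a finite nonempty set. For each $\gamma\in V$, $\mathcal I_\gamma$ is a finite set of levels; $\mathcal I=\prod_{\gamma\in V}\mathcal I_\gamma$, $\mathcal I_D=\prod_{\gamma\in D}\mathcal I_\gamma$, $i_D$ denotes restriction to $D$. The data are counts $n=(n(i))_{i\in\mathcal I}$ with $\sum_i n(i)=N$, with likelihood $\prod_ip(i)^{n(i)}$ (up to the multinomial coefficient). $p^D(i_D)=\sum_{j\in\mathcal I:j_D=i_D}p(j)$, $p^{A|i_B}(i_A)=p^{A\cup B}(i_A,i_B)/p^B(i_B)$, and $p^D$, $p^{A|i_B}$ without arguments are the corresponding vectors over $\mathcal I_D$, $\mathcal I_A$. $p$ is Markov with respect to $G$ if $X_\gamma, X_\delta$ are conditionally independent given the remaining variables whenever $\gamma\neq\delta$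 and $\{\gamma,\delta\}\notin E$. $G_A$ is the subgraph induced by $A$. For $B\subseteq V$, $\partial B$ is the set of vertices outside $B$ adjacent to a vertex of $B$. $A$ is a cut if the model is collapsible onto $A$, i.e. the family of $A$-marginals of the distributions Markov with respect to $G$ equals the family of distributions Markov with respect to $G_A$; by known theorems (Asmussen–Edwards, Frydenberg) this is equivalent to: the boundary $\partial B$ of every connected component $B$ of $G_{V\setminus A}$ is complete in $G$. This characterization may be taken as the definition. For a decomposable graph with cliques (maximal complete subsets) ordered $C_1,\dots,C_k$, let $H_l=\bigcup_{j\le l}C_j$, and for $l\ge2$ the separators and residuals are $S_l=H_{l-1}\cap C_l$, $R_l=C_l\setminus S_l$; the order is perfect if for each $l>1$ there is $i<l$ with $S_l\subseteq C_i$. The vectors in $p_A^{cut}$ parametrize the strictly positive Markov distributions, varying freely and independently, each in an open probability simplex (coordinatized by all but one of its entries; densities are with respect to Lebesgue measure in these coordinates). Reference prior (Berger–Bernardo) relative to ordered groups: for a parameter $\lambda=(\lambda_1,\dots,\lambda_m)$ divided into ordered groups, let $I(\lambda)$ be the Fisher information matrix (of one observation of the data $n$), $\Sigma=I^{-1}$, $\Sigma_j$ the upper-left block of $\Sigma$ for $(\lambda_1,\dots,\lambda_j)$, and $h_j(\lambda)$ the lower-right block of $\Sigma_j^{-1}$ corresponding to $\lambda_j$. Define conditional densities recursively for $j=m,m-1,\dots,1$: $$\pi(\lambda_j\mid\lambda_1,\dots,\lambda_{j-1})\propto\exp\Big\{\tfrac12\,E\big[\log\det h_j(\lambda)\mid\lambda_1,\dots,\lambda_j\big]\Big\},$$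 normalized in $\lambda_j$, where the expectation is over $(\lambda_{j+1},\dots,\lambda_m)$ under the already constructed $\prod_{r>j}\pi(\lambda_r|\lambda_1,\dots,\lambda_{r-1})$. The reference prior is $\pi^R(\lambda)=\prod_j\pi(\lambda_j|\lambda_1,\dots,\lambda_{j-1})$. (All the normalizing constants and expectations needed are finite here, so no limiting sequence of compact sets is required.) *)

theory Defs
  imports "HOL-Analysis.Analysis"
    "Jordan_Normal_Form.Determinant"
    "Jordan_Normal_Form.Gauss_Jordan_Elimination"
begin

section \<open>Graphs\<close>

definition simple_graph :: "'v set \<Rightarrow> 'v set set \<Rightarrow> bool" where
  "simple_graph V E \<longleftrightarrow> finite V \<and> V \<noteq> {} \<and> E \<subseteq> {{u, v} | u v. u \<in> V \<and> v \<in> V \<and> u \<noteq> v}"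

definition complete_in :: "'v set set \<Rightarrow> 'v set \<Rightarrow> bool" where
  "complete_in E K \<longleftrightarrow> (\<forall>u\<in>K. \<forall>v\<in>K. u \<noteq> v \<longrightarrow> {u, v} \<in> E)"

text \<open>Below, a vertex set \<open>W\<close> stands for the induced subgraph on \<open>W\<close>. The empty set is
  complete, so the only clique of the empty graph is the empty set.\<close>

definition cliques :: "'v set set \<Rightarrow> 'v set \<Rightarrow> 'v set set" where
  "cliques E W = {K. K \<subseteq> W \<and> complete_in E K \<and>
     (\<forall>K'. K \<subseteq> K' \<and> K' \<subseteq> W \<and> complete_in E K' \<longrightarrow> K' = K)}"

definition graph_components :: "'v set set \<Rightarrow> 'v set \<Rightarrow> 'v set set" where
  "graph_components E W = W // {(u, v). u \<in> W \<and> v \<in> W \<and> {u, v} \<in> E}\<^sup>*"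

definition boundary :: "'v set \<Rightarrow> 'v set set \<Rightarrow> 'v set \<Rightarrow> 'v set" where
  "boundary V E B = {v \<in> V - B. \<exists>u\<in>B. {u, v} \<in> E}"

definition is_cut :: "'v set \<Rightarrow> 'v set set \<Rightarrow> 'v set \<Rightarrow> bool" where
  "is_cut V E A \<longleftrightarrow> A \<subseteq> V \<and> (\<forall>B\<in>graph_components E (V - A). complete_in E (boundary V E B))"

text \<open>Recursive decomposability: \<open>C\<close> is complete and separates \<open>A\<close> from \<open>B\<close>. Since the
  three sets partition the vertices, separation means that no edge joins \<open>A\<close> to \<open>B\<close>.\<close>

inductive decomposable :: "'v set set \<Rightarrow> 'v set \<Rightarrow> bool" for E where
  complete: "complete_in E W \<Longrightarrow> decomposable E W"
| decompose: "\<lbrakk>A \<noteq> {}; B \<noteq> {}; A \<inter> B = {}; A \<inter> C = {}; B \<inter> C = {};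
     complete_in E C; \<forall>a\<in>A. \<forall>b\<in>B. {a, b} \<notin> E;
     decomposable E (A \<union> C); decomposable E (B \<union> C)\<rbrakk> \<Longrightarrow> decomposable E (A \<union> B \<union> C)"

text \<open>Positions in the lists of cliques count from 0, so \<open>separator Cs 0 = {}\<close> and
  \<open>residual Cs 0\<close> is the first clique.\<close>

definition separator :: "'v set list \<Rightarrow> nat \<Rightarrow> 'v set" where
  "separator Cs l = \<Union>(set (take l Cs)) \<inter> Cs ! l"

definition residual :: "'v set list \<Rightarrow> nat \<Rightarrow> 'v set" where
  "residual Cs l = Cs ! l - separator Cs l"

definition perfect_clique_order :: "'v set set \<Rightarrow> 'v set \<Rightarrow> 'v set list \<Rightarrow> bool" where
  "perfect_clique_order E W Cs \<longleftrightarrow> distinct Cs \<and> set Cs = cliques E W \<and>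
     (\<forall>l. 0 < l \<and> l < length Cs \<longrightarrow> (\<exists>i<l. separator Cs l \<subseteq> Cs ! i))"

section \<open>Cell probabilities and the graphical model\<close>

abbreviation cells :: "('v \<Rightarrow> 'a set) \<Rightarrow> 'v set \<Rightarrow> ('v \<Rightarrow> 'a) set" where
  "cells L D \<equiv> PiE D L"

definition marginal ::
  "'v set \<Rightarrow> ('v \<Rightarrow> 'a set) \<Rightarrow> (('v \<Rightarrow> 'a) \<Rightarrow> real) \<Rightarrow> 'v set \<Rightarrow> ('v \<Rightarrow> 'a) \<Rightarrow> real" where
  "marginal V L p D x = (\<Sum>j\<in>{j \<in> cells L V. restrict j D = x}. p j)"

text \<open>\<open>conditional V L p R S s r\<close> is the probability of the cell \<open>r\<close> on \<open>R\<close> given the cell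
  \<open>s\<close> on \<open>S\<close>, for disjoint \<open>R\<close> and \<open>S\<close>.\<close>

definition conditional ::
  "'v set \<Rightarrow> ('v \<Rightarrow> 'a set) \<Rightarrow> (('v \<Rightarrow> 'a) \<Rightarrow> real) \<Rightarrow> 'v set \<Rightarrow> 'v set \<Rightarrow>
    ('v \<Rightarrow> 'a) \<Rightarrow> ('v \<Rightarrow> 'a) \<Rightarrow> real" where
  "conditional V L p R S s r = marginal V L p (R \<union> S) (merge R S (r, s)) / marginal V L p S s"

definition markov ::
  "'v set \<Rightarrow> 'v set set \<Rightarrow> ('v \<Rightarrow> 'a set) \<Rightarrow> (('v \<Rightarrow> 'a) \<Rightarrow> real) \<Rightarrow> bool" where
  "markov V E L p \<longleftrightarrow> (\<forall>\<gamma>\<in>V. \<forall>\<delta>\<in>V. \<gamma> \<noteq> \<delta> \<and> {\<gamma>, \<delta>} \<notin> E \<longrightarrow>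
     (\<forall>i\<in>cells L V. let W = V - {\<gamma>, \<delta>}; s = restrict i W in
        conditional V L p {\<gamma>, \<delta>} W s (restrict i {\<gamma>, \<delta>}) =
        conditional V L p {\<gamma>} W s (restrict i {\<gamma>}) *
        conditional V L p {\<delta>} W s (restrict i {\<delta>})))"

definition positive_markov_family ::
  "'v set \<Rightarrow> 'v set set \<Rightarrow> ('v \<Rightarrow> 'a set) \<Rightarrow> (('v \<Rightarrow> 'a) \<Rightarrow> real) set" where
  "positive_markov_family V E L = {p \<in> extensional (cells L V).
     (\<forall>i\<in>cells L V. 0 < p i) \<and> (\<Sum>i\<in>cells L V. p i) = 1 \<and> markov V E L p}"

definition count_tables :: "'v set \<Rightarrow> ('v \<Rightarrow> 'a set) \<Rightarrow> nat \<Rightarrow> (('v \<Rightarrow> 'a) \<Rightarrow> nat) set" where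
  "count_tables V L N = {n \<in> cells L V \<rightarrow>\<^sub>E UNIV. (\<Sum>i\<in>cells L V. n i) = N}"

definition multinomial_prob ::
  "'v set \<Rightarrow> ('v \<Rightarrow> 'a set) \<Rightarrow> nat \<Rightarrow> (('v \<Rightarrow> 'a) \<Rightarrow> real) \<Rightarrow> (('v \<Rightarrow> 'a) \<Rightarrow> nat) \<Rightarrow> real" where
  "multinomial_prob V L N p n =
     fact N / (\<Prod>i\<in>cells L V. fact (n i)) * (\<Prod>i\<in>cells L V. p i ^ n i)"

section \<open>The cut parametrization\<close>

text \<open>A pair \<open>(R, S)\<close> stands for the family of conditional probability vectors on \<open>R\<close> given
  the cells on \<open>S\<close>. The pair for the first clique \<open>C\<close> of \<open>A\<close> is \<open>(C, {})\<close>: conditioning on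
  the unique cell on \<open>{}\<close> gives the marginal on \<open>C\<close>. Different positions give different pairs,
  since residuals of cliques are nonempty and pairwise disjoint.\<close>

definition marginal_factors :: "'v set list \<Rightarrow> ('v set \<times> 'v set) set" where
  "marginal_factors Cs = {(residual Cs l, separator Cs l) | l. l < length Cs}"

definition component_factors ::
  "'v set \<Rightarrow> 'v set set \<Rightarrow> 'v set \<Rightarrow> 'v set list \<Rightarrow> ('v set \<times> 'v set) set" where
  "component_factors V E B Cs =
     insert (Cs ! 0 - boundary V E B, boundary V E B)
       {(residual Cs j, separator Cs j) | j. 0 < j \<and> j < length Cs}"

text \<open>A group \<open>(R, S, s)\<close> is the single vector of conditional probabilities on \<open>R\<close> given the
  cell \<open>s\<close> on \<open>S\<close>.\<close>

type_synonym ('v, 'a) group = "'v set \<times> 'v set \<times> ('v \<Rightarrow> 'a)"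

definition cut_groups ::
  "'v set \<Rightarrow> 'v set set \<Rightarrow> ('v \<Rightarrow> 'a set) \<Rightarrow> 'v set \<Rightarrow> 'v set list \<Rightarrow>
    ('v set \<Rightarrow> 'v set list) \<Rightarrow> ('v, 'a) group set" where
  "cut_groups V E L A CA CB = {(R, S, s).
     (R, S) \<in> marginal_factors CA \<union>
        (\<Union>B\<in>graph_components E (V - A). component_factors V E B (CB B)) \<and>
     s \<in> cells L S}"

text \<open>\<open>fc g\<close> lists the cells whose probabilities serve as the coordinates of the group \<open>g\<close>,
  that is, all cells but one. A coordinate is a pair of a group and one of these cells, and
  \<open>gl\<close> is the ordered list of groups.\<close>

definition all_but_one ::
  "('v \<Rightarrow> 'a set) \<Rightarrow> ('v, 'a) group \<Rightarrow> ('v \<Rightarrow> 'a) list \<Rightarrow> bool" where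
  "all_but_one L g rs \<longleftrightarrow>
     (case g of (R, S, s) \<Rightarrow> distinct rs \<and> (\<exists>r\<^sub>0\<in>cells L R. set rs = cells L R - {r\<^sub>0}))"

definition ordered_groups ::
  "('v, 'a) group list \<Rightarrow> (('v, 'a) group \<Rightarrow> ('v \<Rightarrow> 'a) list) \<Rightarrow>
    (('v, 'a) group \<times> ('v \<Rightarrow> 'a)) list list" where
  "ordered_groups gl fc = map (\<lambda>g. map (Pair g) (fc g)) gl"

definition cut_param ::
  "'v set \<Rightarrow> ('v \<Rightarrow> 'a set) \<Rightarrow> ('v, 'a) group list \<Rightarrow> (('v, 'a) group \<Rightarrow> ('v \<Rightarrow> 'a) list) \<Rightarrow>
    (('v \<Rightarrow> 'a) \<Rightarrow> real) \<Rightarrow> (('v, 'a) group \<times> ('v \<Rightarrow> 'a)) \<Rightarrow> real" where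
  "cut_param V L gl fc p = restrict (\<lambda>((R, S, s), r). conditional V L p R S s r)
     (set (concat (ordered_groups gl fc)))"

definition cut_space ::
  "('v, 'a) group list \<Rightarrow> (('v, 'a) group \<Rightarrow> ('v \<Rightarrow> 'a) list) \<Rightarrow>
    ((('v, 'a) group \<times> ('v \<Rightarrow> 'a)) \<Rightarrow> real) set" where
  "cut_space gl fc = {\<theta> \<in> extensional (set (concat (ordered_groups gl fc))).
     \<forall>g\<in>set gl. (\<forall>r\<in>set (fc g). 0 < \<theta> (g, r)) \<and> (\<Sum>r\<in>set (fc g). \<theta> (g, r)) < 1}"

text \<open>The strictly positive Markov distribution with given cut parameter.\<close>

definition cut_dist ::
  "'v set \<Rightarrow> 'v set set \<Rightarrow> ('v \<Rightarrow> 'a set) \<Rightarrow> ('v, 'a) group list \<Rightarrow>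
    (('v, 'a) group \<Rightarrow> ('v \<Rightarrow> 'a) list) \<Rightarrow> ((('v, 'a) group \<times> ('v \<Rightarrow> 'a)) \<Rightarrow> real) \<Rightarrow>
    ('v \<Rightarrow> 'a) \<Rightarrow> real" where
  "cut_dist V E L gl fc = inv_into (positive_markov_family V E L) (cut_param V L gl fc)"

section \<open>Reference priors relative to ordered groups\<close>

text \<open>Throughout, \<open>f \<theta> x\<close> is the probability of the outcome \<open>x\<close> in the finite sample space
  \<open>X\<close> under the parameter \<open>\<theta>\<close>, a function on coordinates. The coordinates are given as the list
  \<open>gs\<close> of ordered groups, each group being a list of coordinates, and \<open>\<Theta>\<close> is the parameter
  space. Groups are numbered from 0.\<close>

definition score :: "(('c \<Rightarrow> real) \<Rightarrow> 'x \<Rightarrow> real) \<Rightarrow> 'c \<Rightarrow> ('c \<Rightarrow> real) \<Rightarrow> 'x \<Rightarrow> real" where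
  "score f c \<theta> x = deriv (\<lambda>t. ln (f (\<theta>(c := t)) x)) (\<theta> c)"

definition fisher_info ::
  "(('c \<Rightarrow> real) \<Rightarrow> 'x \<Rightarrow> real) \<Rightarrow> 'x set \<Rightarrow> 'c list \<Rightarrow> ('c \<Rightarrow> real) \<Rightarrow> real mat" where
  "fisher_info f X cs \<theta> = Matrix.mat (length cs) (length cs)
     (\<lambda>(a, b). \<Sum>x\<in>X. f \<theta> x * score f (cs ! a) \<theta> x * score f (cs ! b) \<theta> x)"

definition inverse_mat :: "real mat \<Rightarrow> real mat" where
  "inverse_mat M = the (mat_inverse M)"

definition leading_block :: "nat \<Rightarrow> real mat \<Rightarrow> real mat" where
  "leading_block n M = Matrix.mat n n (\<lambda>(a, b). M $$ (a, b))"

definition dims_upto :: "'c list list \<Rightarrow> nat \<Rightarrow> nat" where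
  "dims_upto gs j = length (concat (take j gs))"

definition Sigma_block ::
  "(('c \<Rightarrow> real) \<Rightarrow> 'x \<Rightarrow> real) \<Rightarrow> 'x set \<Rightarrow> 'c list list \<Rightarrow> nat \<Rightarrow> ('c \<Rightarrow> real) \<Rightarrow> real mat" where
  "Sigma_block f X gs j \<theta> =
     leading_block (dims_upto gs (Suc j)) (inverse_mat (fisher_info f X (concat gs) \<theta>))"

definition h_block ::
  "(('c \<Rightarrow> real) \<Rightarrow> 'x \<Rightarrow> real) \<Rightarrow> 'x set \<Rightarrow> 'c list list \<Rightarrow> nat \<Rightarrow> ('c \<Rightarrow> real) \<Rightarrow> real mat" where
  "h_block f X gs j \<theta> = (let d = length (gs ! j); k = dims_upto gs j in
     Matrix.mat d d (\<lambda>(a, b). inverse_mat (Sigma_block f X gs j \<theta>) $$ (k + a, k + b)))"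

abbreviation coords_before :: "'c list list \<Rightarrow> nat \<Rightarrow> 'c set" where
  "coords_before gs j \<equiv> set (concat (take j gs))"

abbreviation coords_upto :: "'c list list \<Rightarrow> nat \<Rightarrow> 'c set" where
  "coords_upto gs j \<equiv> set (concat (take (Suc j) gs))"

abbreviation coords_after :: "'c list list \<Rightarrow> nat \<Rightarrow> 'c set" where
  "coords_after gs j \<equiv> set (concat (drop (Suc j) gs))"

abbreviation lborel_on :: "'c set \<Rightarrow> ('c \<Rightarrow> real) measure" where
  "lborel_on K \<equiv> PiM K (\<lambda>_. lborel)"

text \<open>The parameter with the values of \<open>\<theta>\<close> on groups \<open>0, \<dots>, j\<close> and those of \<open>y\<close> on
  the later groups.\<close>

abbreviation with_after :: "'c list list \<Rightarrow> nat \<Rightarrow> ('c \<Rightarrow> real) \<Rightarrow> ('c \<Rightarrow> real) \<Rightarrow> 'c \<Rightarrow> real" where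
  "with_after gs j \<theta> y \<equiv> merge (coords_upto gs j) (coords_after gs j) (\<theta>, y)"

text \<open>The vector of the first \<open>j + 1\<close> groups with the values of \<open>\<theta>\<close> on groups
  \<open>0, \<dots>, j - 1\<close> and those of \<open>y\<close> on group \<open>j\<close>.\<close>

abbreviation with_group :: "'c list list \<Rightarrow> nat \<Rightarrow> ('c \<Rightarrow> real) \<Rightarrow> ('c \<Rightarrow> real) \<Rightarrow> 'c \<Rightarrow> real" where
  "with_group gs j \<theta> y \<equiv> merge (coords_before gs j) (set (gs ! j)) (\<theta>, y)"

abbreviation after_range ::
  "'c list list \<Rightarrow> ('c \<Rightarrow> real) set \<Rightarrow> nat \<Rightarrow> ('c \<Rightarrow> real) \<Rightarrow> ('c \<Rightarrow> real) set" where
  "after_range gs \<Theta> j \<theta> \<equiv> {y. with_after gs j \<theta> y \<in> \<Theta>}"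

abbreviation group_range ::
  "'c list list \<Rightarrow> ('c \<Rightarrow> real) set \<Rightarrow> nat \<Rightarrow> ('c \<Rightarrow> real) \<Rightarrow> ('c \<Rightarrow> real) set" where
  "group_range gs \<Theta> j \<theta> \<equiv>
     {y. with_group gs j \<theta> y \<in> (\<lambda>\<eta>. restrict \<eta> (coords_upto gs j)) ` \<Theta>}"

text \<open>Here \<open>w\<close> is the product of the conditional densities of the groups after \<open>j\<close>;
  \<open>ref_kernel\<close> is the unnormalized conditional density of group \<open>j\<close> given the earlier ones.
  Both depend on \<open>\<theta>\<close> only through the groups \<open>0, \<dots>, j\<close>.\<close>

definition log_det_integrand ::
  "(('c \<Rightarrow> real) \<Rightarrow> 'x \<Rightarrow> real) \<Rightarrow> 'x set \<Rightarrow> 'c list list \<Rightarrow> nat \<Rightarrow>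
    (('c \<Rightarrow> real) \<Rightarrow> real) \<Rightarrow> ('c \<Rightarrow> real) \<Rightarrow> real" where
  "log_det_integrand f X gs j w \<theta> = ln (Determinant.det (h_block f X gs j \<theta>)) * w \<theta>"

definition ref_kernel ::
  "(('c \<Rightarrow> real) \<Rightarrow> 'x \<Rightarrow> real) \<Rightarrow> 'x set \<Rightarrow> 'c list list \<Rightarrow> ('c \<Rightarrow> real) set \<Rightarrow> nat \<Rightarrow>
    (('c \<Rightarrow> real) \<Rightarrow> real) \<Rightarrow> ('c \<Rightarrow> real) \<Rightarrow> real" where
  "ref_kernel f X gs \<Theta> j w \<theta> = exp (1/2 *
     (LINT y:after_range gs \<Theta> j \<theta>|lborel_on (coords_after gs j).
        log_det_integrand f X gs j w (with_after gs j \<theta> y)))"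

definition ref_normalizer ::
  "(('c \<Rightarrow> real) \<Rightarrow> 'x \<Rightarrow> real) \<Rightarrow> 'x set \<Rightarrow> 'c list list \<Rightarrow> ('c \<Rightarrow> real) set \<Rightarrow> nat \<Rightarrow>
    (('c \<Rightarrow> real) \<Rightarrow> real) \<Rightarrow> ('c \<Rightarrow> real) \<Rightarrow> real" where
  "ref_normalizer f X gs \<Theta> j w \<theta> =
     (LINT y:group_range gs \<Theta> j \<theta>|lborel_on (set (gs ! j)).
        ref_kernel f X gs \<Theta> j w (with_group gs j \<theta> y))"

definition ref_conditional ::
  "(('c \<Rightarrow> real) \<Rightarrow> 'x \<Rightarrow> real) \<Rightarrow> 'x set \<Rightarrow> 'c list list \<Rightarrow> ('c \<Rightarrow> real) set \<Rightarrow> nat \<Rightarrow>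
    (('c \<Rightarrow> real) \<Rightarrow> real) \<Rightarrow> ('c \<Rightarrow> real) \<Rightarrow> real" where
  "ref_conditional f X gs \<Theta> j w \<theta> =
     ref_kernel f X gs \<Theta> j w \<theta> / ref_normalizer f X gs \<Theta> j w \<theta>"

text \<open>\<open>ref_tail f X gs \<Theta> k\<close> is the product of the conditional densities of the last \<open>k\<close> groups.\<close>

primrec ref_tail ::
  "(('c \<Rightarrow> real) \<Rightarrow> 'x \<Rightarrow> real) \<Rightarrow> 'x set \<Rightarrow> 'c list list \<Rightarrow> ('c \<Rightarrow> real) set \<Rightarrow> nat \<Rightarrow>
    ('c \<Rightarrow> real) \<Rightarrow> real" where
  "ref_tail f X gs \<Theta> 0 = (\<lambda>\<theta>. 1)"
| "ref_tail f X gs \<Theta> (Suc k) = (\<lambda>\<theta>.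
     ref_conditional f X gs \<Theta> (length gs - Suc k) (ref_tail f X gs \<Theta> k) \<theta> *
     ref_tail f X gs \<Theta> k \<theta>)"

definition reference_prior ::
  "(('c \<Rightarrow> real) \<Rightarrow> 'x \<Rightarrow> real) \<Rightarrow> 'x set \<Rightarrow> 'c list list \<Rightarrow> ('c \<Rightarrow> real) set \<Rightarrow>
    ('c \<Rightarrow> real) \<Rightarrow> real" where
  "reference_prior f X gs \<Theta> = ref_tail f X gs \<Theta> (length gs)"

text \<open>All derivatives, inverses, logarithms, expectations and normalizing constants occurring in
  \<open>reference_prior\<close> exist, so that none of the total functions above takes a default value.\<close>

definition reference_prior_exists ::
  "(('c \<Rightarrow> real) \<Rightarrow> 'x \<Rightarrow> real) \<Rightarrow> 'x set \<Rightarrow> 'c list list \<Rightarrow> ('c \<Rightarrow> real) set \<Rightarrow> bool" where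
  "reference_prior_exists f X gs \<Theta> \<longleftrightarrow> (\<forall>\<theta>\<in>\<Theta>.
     (\<forall>x\<in>X. 0 < f \<theta> x \<and>
        (\<forall>c\<in>set (concat gs). (\<lambda>t. ln (f (\<theta>(c := t)) x)) differentiable (at (\<theta> c)))) \<and>
     invertible_mat (fisher_info f X (concat gs) \<theta>) \<and>
     (\<forall>j<length gs. let w = ref_tail f X gs \<Theta> (length gs - Suc j) in
        invertible_mat (Sigma_block f X gs j \<theta>) \<and>
        0 < Determinant.det (h_block f X gs j \<theta>) \<and>
        set_integrable (lborel_on (coords_after gs j)) (after_range gs \<Theta> j \<theta>)
          (\<lambda>y. log_det_integrand f X gs j w (with_after gs j \<theta> y)) \<and>
        set_integrable (lborel_on (set (gs ! j))) (group_range gs \<Theta> j \<theta>)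
          (\<lambda>y. ref_kernel f X gs \<Theta> j w (with_group gs j \<theta> y)) \<and>
        0 < ref_normalizer f X gs \<Theta> j w \<theta>))"

end

theory Submission
  imports Defs
begin

text \<open>Along a perfect sequence of pairs \<open>(R, S)\<close> a positive Markov distribution is the product of
  its conditional distributions of \<open>R\<close> given \<open>S\<close>, and every choice of such conditional
  distributions arises. Scores of different groups are orthogonal, because the later one has
  conditional mean zero given everything before it. Hence the Fisher information is block diagonal,
  and the block of a group is the information matrix of a multinomial vector times \<open>N\<close> times the
  probability of the conditioning cell. That probability does not depend on the group itself, so it
  only contributes a factor that the normalization cancels: whatever the order of the groups, each
  conditional prior is the Dirichlet density with all exponents \<open>-1/2\<close>.\<close>

section \<open>Products of conditional probabilities along a perfect sequence\<close>

text \<open>Conditional independence is handled through two-by-two cross-product ratios of a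
  positive function. These are cancellation identities that survive products and, along a perfect
  sequence, the summing out of the last residual, so the factorization of a Markov distribution
  comes from a single induction. The analytic obstacle is the probability of a conditioning cell. It
  may involve groups on both sides of its own group in the chosen order; the earlier ones are held
  fixed, but over the later ones its logarithm is averaged, and the average must be finite. That
  probability is at least the probability of one full cell, a product of single conditional
  probabilities, so its logarithm is controlled by the sum of all \<open>- ln\<close> of cell
  probabilities. The bound \<open>- ln x \<le> 4 * x powr (-1/4)\<close> then worsens the Dirichlet
  exponent from \<open>-1/2\<close> to \<open>-3/4\<close>, still above the limit \<open>-1\<close>
  of integrability. Since \<open>cut_dist\<close> is given as an inverse function, it is meaningful
  only on the parameter space; derivatives use that a small change of one coordinate stays
  inside.\<close>

abbreviation verts :: "('v set \<times> 'v set) set \<Rightarrow> 'v set" where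
  "verts F \<equiv> \<Union>(fst ` F)"

text \<open>The running intersection property in a form shared by the cliques of the cut and those
  of the components: every earlier neighbour of the new vertices \<open>R\<close> lies in
  \<open>S\<close>. Since \<open>R\<close> may be empty, a pair that is already present can be
  inserted again, which is why the inductions below first separate the case
  \<open>(R, S) \<in> F\<close>.\<close>

inductive perfect_factors :: "'v set set \<Rightarrow> ('v set \<times> 'v set) set \<Rightarrow> bool" for E where
  empty: "perfect_factors E {}"
| insert: "\<lbrakk>perfect_factors E F; finite R; R \<inter> verts F = {}; S \<subseteq> verts F; complete_in E (R \<union> S);
     \<And>u v. u \<in> R \<Longrightarrow> v \<in> verts F \<Longrightarrow> {u, v} \<in> E \<Longrightarrow> v \<in> S\<rbrakk>
   \<Longrightarrow> perfect_factors E (insert (R, S) F)"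

definition factor_prod ::
  "('v set \<times> 'v set) set \<Rightarrow> (('v, 'a) group \<Rightarrow> ('v \<Rightarrow> 'a) \<Rightarrow> real) \<Rightarrow> ('v \<Rightarrow> 'a) \<Rightarrow> real" where
  "factor_prod F q x = (\<Prod>(R, S)\<in>F. q (R, S, restrict x S) (restrict x R))"

definition cond_family ::
  "('v \<Rightarrow> 'a set) \<Rightarrow> ('v set \<times> 'v set) set \<Rightarrow> (('v, 'a) group \<Rightarrow> ('v \<Rightarrow> 'a) \<Rightarrow> real) \<Rightarrow> bool" where
  "cond_family L F q \<longleftrightarrow> (\<forall>(R, S)\<in>F. \<forall>s\<in>cells L S.
     (\<forall>r\<in>cells L R. 0 < q (R, S, s) r) \<and> (\<Sum>r\<in>cells L R. q (R, S, s) r) = 1)"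

definition levels_ok :: "('v \<Rightarrow> 'a set) \<Rightarrow> 'v set \<Rightarrow> bool" where
  "levels_ok L W \<longleftrightarrow> finite W \<and> (\<forall>\<gamma>\<in>W. finite (L \<gamma>) \<and> L \<gamma> \<noteq> {})"

section \<open>Cells, their restrictions and merges\<close>

lemma levels_ok_subset: "levels_ok L W \<Longrightarrow> D \<subseteq> W \<Longrightarrow> levels_ok L D"
  by (auto simp: levels_ok_def intro: finite_subset)

lemma finite_cells: "levels_ok L W \<Longrightarrow> D \<subseteq> W \<Longrightarrow> finite (cells L D)"
  by (auto simp: levels_ok_def intro!: finite_PiE intro: finite_subset)

lemma cells_nonempty: "levels_ok L W \<Longrightarrow> D \<subseteq> W \<Longrightarrow> cells L D \<noteq> {}"
  by (auto simp: levels_ok_def PiE_eq_empty_iff)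

lemma restrict_cells: "x \<in> cells L H \<Longrightarrow> D \<subseteq> H \<Longrightarrow> restrict x D \<in> cells L D"
  by (auto simp: PiE_iff extensional_def)

lemma restrict_cells_eq: "x \<in> cells L H \<Longrightarrow> restrict x H = x"
  by (rule PiE_restrict)

lemma restrict_merge_left: "S \<subseteq> H \<Longrightarrow> restrict (merge H R (y, r)) S = restrict y S"
  by (auto simp: fun_eq_iff merge_def)

lemma restrict_merge_right:
  "R \<inter> H = {} \<Longrightarrow> r \<in> cells L R \<Longrightarrow> restrict (merge H R (y, r)) R = r"
  by (auto simp: fun_eq_iff merge_def PiE_iff extensional_def)

lemma merge_restrict_self: "x \<in> cells L (H \<union> R) \<Longrightarrow> merge H R (restrict x H, restrict x R) = x"
  by (auto simp: fun_eq_iff merge_def PiE_iff extensional_def)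

lemma merge_cells: "H \<inter> R = {} \<Longrightarrow> y \<in> cells L H \<Longrightarrow> r \<in> cells L R \<Longrightarrow> merge H R (y, r) \<in> cells L (H \<union> R)"
  by (auto simp: PiE_iff merge_def extensional_def)

lemma sum_cells_Un:
  assumes "H \<inter> R = {}"
  shows "(\<Sum>x\<in>cells L (H \<union> R). g x) = (\<Sum>y\<in>cells L H. \<Sum>r\<in>cells L R. g (merge H R (y, r)))"
proof -
  have "(\<Sum>x\<in>cells L (H \<union> R). g x) = (\<Sum>z\<in>cells L H \<times> cells L R. g (merge H R z))"
    by (rule sum.reindex_bij_witness[where j="\<lambda>x. (restrict x H, restrict x R)" and i="merge H R"])
      (use assms in \<open>auto simp: merge_restrict_self restrict_merge_left restrict_cells_eq restrict_cells
        merge_cells intro!: restrict_merge_right\<close>)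
  then show ?thesis by (simp add: sum.cartesian_product)
qed

section \<open>Expectations under a product of conditional probabilities\<close>

lemma perfect_factorsD:
  assumes "perfect_factors E F"
  shows "finite F" "finite (verts F)" "(R, S) \<in> F \<Longrightarrow> S \<subseteq> verts F" "(R, S) \<in> F \<Longrightarrow> R \<inter> S = {}"
    "(R, S) \<in> F \<Longrightarrow> complete_in E (R \<union> S)"
  using assms by (induction rule: perfect_factors.induct) (auto)

lemma factor_prod_insert:
  assumes "perfect_factors E F" "(R, S) \<notin> F"
  shows "factor_prod (insert (R, S) F) q x = q (R, S, restrict x S) (restrict x R) * factor_prod F q x"
  unfolding factor_prod_def using assms perfect_factorsD(1)[OF assms(1)] by simp

lemma factor_prod_cong_restrict:
  assumes "perfect_factors E F" "restrict x (verts F) = restrict y (verts F)"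
  shows "factor_prod F q x = factor_prod F q y"
proof -
  have eq: "restrict x D = restrict y D" if "D \<subseteq> verts F" for D
    using assms(2) that by (metis restrict_restrict Int_absorb1)
  show ?thesis unfolding factor_prod_def
  proof (intro prod.cong refl, clarify)
    fix R S assume "(R, S) \<in> F"
    then have "R \<subseteq> verts F" "S \<subseteq> verts F" using perfect_factorsD(3)[OF assms(1)] by force+
    then show "q (R, S, restrict x S) (restrict x R) = q (R, S, restrict y S) (restrict y R)"
      by (simp add: eq)
  qed
qed

lemma factor_prod_pos:
  assumes "perfect_factors E F" "cond_family L F q" "x \<in> cells L H" "verts F \<subseteq> H"
  shows "0 < factor_prod F q x"
  unfolding factor_prod_def
proof (intro prod_pos, clarify)
  fix R S assume RS: "(R, S) \<in> F"
  then have "R \<subseteq> H" "S \<subseteq> H" using perfect_factorsD(3)[OF assms(1)] assms(4) by force+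
  then have "restrict x S \<in> cells L S" "restrict x R \<in> cells L R" using restrict_cells[OF assms(3)] by blast+
  then show "0 < q (R, S, restrict x S) (restrict x R)"
    using assms(2) RS unfolding cond_family_def by blast
qed

text \<open>No earlier factor sees the last residual, so it can be summed innermost.\<close>

lemma sum_factor_prod_insert:
  assumes "perfect_factors E F" "(R, S) \<notin> F" "R \<inter> verts F = {}" "S \<subseteq> verts F"
  shows "(\<Sum>x\<in>cells L (verts (insert (R, S) F)). factor_prod (insert (R, S) F) q x * g x) =
    (\<Sum>y\<in>cells L (verts F). factor_prod F q y *
       (\<Sum>r\<in>cells L R. q (R, S, restrict y S) r * g (merge (verts F) R (y, r))))"
proof -
  have v: "verts (insert (R, S) F) = verts F \<union> R" by auto
  have "(\<Sum>x\<in>cells L (verts (insert (R, S) F)). factor_prod (insert (R, S) F) q x * g x) =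
    (\<Sum>y\<in>cells L (verts F). \<Sum>r\<in>cells L R. factor_prod (insert (R, S) F) q (merge (verts F) R (y, r))
       * g (merge (verts F) R (y, r)))"
    unfolding v using assms(3) by (intro sum_cells_Un) auto
  also have "\<dots> = (\<Sum>y\<in>cells L (verts F). \<Sum>r\<in>cells L R. factor_prod F q y *
       (q (R, S, restrict y S) r * g (merge (verts F) R (y, r))))"
  proof (intro sum.cong refl)
    fix y r assume "y \<in> cells L (verts F)" and r: "r \<in> cells L R"
    have "factor_prod F q (merge (verts F) R (y, r)) = factor_prod F q y"
      by (rule factor_prod_cong_restrict[OF assms(1)]) (simp add: restrict_merge_left)
    then show "factor_prod (insert (R, S) F) q (merge (verts F) R (y, r)) * g (merge (verts F) R (y, r))
       = factor_prod F q y * (q (R, S, restrict y S) r * g (merge (verts F) R (y, r)))"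
      using assms r by (simp add: factor_prod_insert restrict_merge_left restrict_merge_right[OF _ r])
  qed
  finally show ?thesis by (simp add: sum_distrib_left)
qed

text \<open>The innermost sum of the last factor is one. Hence a factor may be dropped from the end
  of the sequence whenever the integrand lives on the earlier vertices, which drives all the
  inductions that follow.\<close>

lemma sum_factor_prod_insert_old:
  assumes "perfect_factors E F" "(R, S) \<notin> F" "R \<inter> verts F = {}" "S \<subseteq> verts F"
    and q: "cond_family L (insert (R, S) F) q"
    and g: "\<And>y r. y \<in> cells L (verts F) \<Longrightarrow> g (merge (verts F) R (y, r)) = g y"
  shows "(\<Sum>x\<in>cells L (verts (insert (R, S) F)). factor_prod (insert (R, S) F) q x * g x) =
    (\<Sum>y\<in>cells L (verts F). factor_prod F q y * g y)"
  unfolding sum_factor_prod_insert[OF assms(1-4)]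
proof (intro sum.cong refl)
  fix y assume y: "y \<in> cells L (verts F)"
  have "(\<Sum>r\<in>cells L R. q (R, S, restrict y S) r) = 1"
    using q restrict_cells[OF y assms(4)] unfolding cond_family_def by auto
  then show "factor_prod F q y * (\<Sum>r\<in>cells L R. q (R, S, restrict y S) r * g (merge (verts F) R (y, r))) =
      factor_prod F q y * g y"
    by (simp add: g[OF y] sum_distrib_right[symmetric])
qed

lemma cond_family_insertD: "cond_family L (insert f F) q \<Longrightarrow> cond_family L F q"
  by (auto simp: cond_family_def)

lemma sum_factor_prod:
  assumes "perfect_factors E F" "cond_family L F q"
  shows "(\<Sum>x\<in>cells L (verts F). factor_prod F q x) = 1"
  using assms
proof (induction rule: perfect_factors.induct)
  case empty
  then show ?case by (simp add: factor_prod_def)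
next
  case (insert F R S)
  show ?case
  proof (cases "(R, S) \<in> F")
    case True
    then show ?thesis using insert by (simp add: insert_absorb)
  next
    case False
    then show ?thesis
      using sum_factor_prod_insert_old[OF insert.hyps(1) False insert.hyps(3,4) insert.prems, of "\<lambda>_. 1"]
        insert.IH cond_family_insertD[OF insert.prems] by simp
  qed
qed

text \<open>The tower property: given the separator, the residual has law
  \<open>q (R, S, s)\<close>. Later factors are dropped until \<open>(R, S)\<close> is the last one,
  and there the inner sum can be read off.\<close>

lemma expectation_factor:
  assumes "perfect_factors E F" "cond_family L F q" "(R, S) \<in> F"
  shows "(\<Sum>x\<in>cells L (verts F). factor_prod F q x * v (restrict x S) (restrict x R)) =
    (\<Sum>x\<in>cells L (verts F). factor_prod F q x *
       (\<Sum>r\<in>cells L R. q (R, S, restrict x S) r * v (restrict x S) r))"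
  using assms
proof (induction rule: perfect_factors.induct)
  case empty
  then show ?case by simp
next
  case (insert F R' S')
  show ?case
  proof (cases "(R', S') \<in> F")
    case True
    then show ?thesis using insert by (simp add: insert_absorb)
  next
    case False
    note out = sum_factor_prod_insert_old[OF insert.hyps(1) False insert.hyps(3,4) insert.prems(1)]
    show ?thesis
    proof (cases "(R, S) \<in> F")
      case True
      then have sub: "R \<subseteq> verts F" "S \<subseteq> verts F" using perfect_factorsD(3)[OF insert.hyps(1)] by force+
      note IH = insert.IH[OF cond_family_insertD[OF insert.prems(1)] True]
      show ?thesis
        by (rule trans[OF out trans[OF IH out[symmetric]]]) (simp_all add: restrict_merge_left sub)
    next
      case new: False
      then have eq: "R = R'" "S = S'" using insert.prems(2) by auto
      note ins = sum_factor_prod_insert[OF insert.hyps(1) False insert.hyps(3,4)]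
      have merge_new: "v (restrict (merge (verts F) R' (y, r)) S') (restrict (merge (verts F) R' (y, r)) R') =
          v (restrict y S') r" if "r \<in> cells L R'" for y r
        unfolding restrict_merge_left[OF insert.hyps(4)] restrict_merge_right[OF insert.hyps(3) that] ..
      show ?thesis
        unfolding eq
      proof (rule trans[OF ins trans[OF _ out[symmetric]]])
        show "(\<Sum>y\<in>cells L (verts F). factor_prod F q y * (\<Sum>r\<in>cells L R'. q (R', S', restrict y S') r *
            v (restrict (merge (verts F) R' (y, r)) S') (restrict (merge (verts F) R' (y, r)) R'))) =
          (\<Sum>y\<in>cells L (verts F). factor_prod F q y * (\<Sum>r\<in>cells L R'. q (R', S', restrict y S') r * v (restrict y S') r))"
          by (intro sum.cong refl arg_cong2[where f="(*)"] merge_new)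
      qed (simp add: restrict_merge_left[OF insert.hyps(4)])
    qed
  qed
qed

text \<open>Whichever of the two factors comes later has conditional mean zero given everything
  that precedes it.\<close>

lemma expectation_orthogonal:
  assumes "perfect_factors E F" "cond_family L F q" "(R, S) \<in> F" "(R', S') \<in> F" "(R, S) \<noteq> (R', S')"
    and "\<And>s. s \<in> cells L S \<Longrightarrow> (\<Sum>r\<in>cells L R. q (R, S, s) r * v s r) = 0"
    and "\<And>s. s \<in> cells L S' \<Longrightarrow> (\<Sum>r\<in>cells L R'. q (R', S', s) r * v' s r) = 0"
  shows "(\<Sum>x\<in>cells L (verts F). factor_prod F q x *
     (v (restrict x S) (restrict x R) * v' (restrict x S') (restrict x R'))) = 0"
  using assms(1-4)
proof (induction rule: perfect_factors.induct)
  case empty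
  then show ?case by simp
next
  case (insert F R0 S0)
  show ?case
  proof (cases "(R0, S0) \<in> F")
    case True
    then show ?thesis using insert by (simp add: insert_absorb)
  next
    case False
    note out = sum_factor_prod_insert_old[OF insert.hyps(1) False insert.hyps(3,4) insert.prems(1)]
    note ins = sum_factor_prod_insert[OF insert.hyps(1) False insert.hyps(3,4)]
    \<comment> \<open>Here \<open>u\<close> belongs to the last factor and \<open>u'\<close> lives
      on earlier vertices, so \<open>u'\<close> leaves the inner sum and the centering of
      \<open>u\<close> makes it vanish. Either of the two given factors may play the role of
      \<open>u\<close>.\<close>
    have zero: "(\<Sum>x\<in>cells L (verts (insert (R0, S0) F)). factor_prod (insert (R0, S0) F) q x *
        (u (restrict x S0) (restrict x R0) * u' (restrict x S1) (restrict x R1))) = 0"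
      if F: "(R1, S1) \<in> F"
        and u: "\<And>s. s \<in> cells L S0 \<Longrightarrow> (\<Sum>r\<in>cells L R0. q (R0, S0, s) r * u s r) = 0" for u u' R1 S1
    proof -
      have sub: "R1 \<subseteq> verts F" "S1 \<subseteq> verts F" using F perfect_factorsD(3)[OF insert.hyps(1)] by force+
      have "(\<Sum>r\<in>cells L R0. q (R0, S0, restrict y S0) r *
          (u (restrict (merge (verts F) R0 (y, r)) S0) (restrict (merge (verts F) R0 (y, r)) R0) *
           u' (restrict (merge (verts F) R0 (y, r)) S1) (restrict (merge (verts F) R0 (y, r)) R1))) = 0"
        (is "?l = 0") if y: "y \<in> cells L (verts F)" for y
      proof -
        have "?l = (\<Sum>r\<in>cells L R0. q (R0, S0, restrict y S0) r * u (restrict y S0) r) *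
            u' (restrict y S1) (restrict y R1)"
          unfolding sum_distrib_right
          by (intro sum.cong refl)
            (use insert.hyps(3,4) in \<open>simp add: sub restrict_merge_left restrict_merge_right\<close>)
        then show ?thesis using u[OF restrict_cells[OF y insert.hyps(4)]] by simp
      qed
      then show ?thesis unfolding ins by simp
    qed
    consider "(R, S) \<in> F" "(R', S') \<in> F" | "(R, S) = (R0, S0)" "(R', S') \<in> F" | "(R, S) \<in> F" "(R', S') = (R0, S0)"
      using insert.prems assms(5) by auto
    then show ?thesis
    proof cases
      case 1
      then have sub: "R \<subseteq> verts F" "S \<subseteq> verts F" "R' \<subseteq> verts F" "S' \<subseteq> verts F"
        using perfect_factorsD(3)[OF insert.hyps(1)] by force+
      note IH = insert.IH[OF cond_family_insertD[OF insert.prems(1)] 1]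
      show ?thesis
        by (rule trans[OF out IH]) (simp_all add: restrict_merge_left sub)
    next
      case 2
      then have eq: "R0 = R" "S0 = S" by auto
      have u: "(\<Sum>r\<in>cells L R0. q (R0, S0, s) r * v s r) = 0" if "s \<in> cells L S0" for s
        unfolding eq by (rule assms(6)[OF that[unfolded eq]])
      show ?thesis using zero[OF 2(2), where u=v and u'=v', OF u] unfolding eq .
    next
      case 3
      then have eq: "R0 = R'" "S0 = S'" by auto
      have u: "(\<Sum>r\<in>cells L R0. q (R0, S0, s) r * v' s r) = 0" if "s \<in> cells L S0" for s
        unfolding eq by (rule assms(7)[OF that[unfolded eq]])
      show ?thesis
        using zero[OF 3(1), where u=v' and u'=v, OF u] unfolding eq mult.commute[of "v' _ _"] .
    qed
  qed
qed

text \<open>The separator precedes its residual, so its law is made of factors inserted before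
  \<open>(R, S)\<close>; \<open>(R, S)\<close> itself and everything later sum out. This is why the
  information about a group carries a factor that is free of the group's own coordinates.\<close>

lemma expectation_separator_cong:
  assumes "perfect_factors E F" "cond_family L F q" "cond_family L F q'" "(R, S) \<in> F"
    and "\<And>R' S' s r. (R', S') \<in> F \<Longrightarrow> (R', S') \<noteq> (R, S) \<Longrightarrow> q (R', S', s) r = q' (R', S', s) r"
  shows "(\<Sum>x\<in>cells L (verts F). factor_prod F q x * k (restrict x S)) =
    (\<Sum>x\<in>cells L (verts F). factor_prod F q' x * k (restrict x S))"
  using assms
proof (induction rule: perfect_factors.induct)
  case empty
  then show ?case by simp
next
  case (insert F R0 S0)
  show ?case
  proof (cases "(R0, S0) \<in> F")
    case True
    then show ?thesis using insert by (simp add: insert_absorb)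
  next
    case False
    note out = sum_factor_prod_insert_old[OF insert.hyps(1) False insert.hyps(3,4)]
    show ?thesis
    proof (cases "(R, S) \<in> F")
      case True
      then have sub: "R \<subseteq> verts F" "S \<subseteq> verts F" using perfect_factorsD(3)[OF insert.hyps(1)] by force+
      have IH: "(\<Sum>x\<in>cells L (verts F). factor_prod F q x * k (restrict x S)) =
        (\<Sum>x\<in>cells L (verts F). factor_prod F q' x * k (restrict x S))"
        by (rule insert.IH[OF cond_family_insertD[OF insert.prems(1)] cond_family_insertD[OF insert.prems(2)] True])
           (use insert.prems in auto)
      show ?thesis
        by (rule trans[OF out[OF insert.prems(1)] trans[OF IH out[OF insert.prems(2), symmetric]]])
          (simp_all add: restrict_merge_left sub)
    next
      case new: False
      then have eq: "R0 = R" "S0 = S" using insert.prems by auto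
      have "factor_prod F q y = factor_prod F q' y" for y
        unfolding factor_prod_def by (intro prod.cong refl) (use insert.prems(4) new in auto)
      then have IH: "(\<Sum>x\<in>cells L (verts F). factor_prod F q x * k (restrict x S)) =
          (\<Sum>x\<in>cells L (verts F). factor_prod F q' x * k (restrict x S))" by simp
      show ?thesis
        by (rule trans[OF out[OF insert.prems(1)] trans[OF IH out[OF insert.prems(2), symmetric]]])
          (use insert.hyps(4) in \<open>simp_all add: restrict_merge_left eq\<close>)
    qed
  qed
qed

section \<open>Markov property and factorization\<close>

text \<open>The pairwise Markov property without marginals or divisions: every two-by-two
  cross-product ratio in the directions of a nonadjacent pair equals one.\<close>

definition cross_product ::
  "'v set set \<Rightarrow> 'v set \<Rightarrow> ('v \<Rightarrow> 'a set) \<Rightarrow> (('v \<Rightarrow> 'a) \<Rightarrow> real) \<Rightarrow> bool" where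
  "cross_product E W L p \<longleftrightarrow> (\<forall>x\<in>cells L W. \<forall>\<gamma>\<in>W. \<forall>\<delta>\<in>W. \<gamma> \<noteq> \<delta> \<and> {\<gamma>, \<delta>} \<notin> E \<longrightarrow>
     (\<forall>b\<in>L \<gamma>. \<forall>c\<in>L \<delta>. p x * p (x(\<gamma> := b, \<delta> := c)) = p (x(\<gamma> := b)) * p (x(\<delta> := c))))"

lemma cells_update: "x \<in> cells L W \<Longrightarrow> \<gamma> \<in> W \<Longrightarrow> b \<in> L \<gamma> \<Longrightarrow> x(\<gamma> := b) \<in> cells L W"
  by (auto simp: PiE_iff extensional_def)

lemma cells_eval: "x \<in> cells L W \<Longrightarrow> \<gamma> \<in> W \<Longrightarrow> x \<gamma> \<in> L \<gamma>"
  by (rule PiE_mem)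

lemma marginal_all: "i \<in> cells L V \<Longrightarrow> marginal V L p V i = p i"
proof -
  assume i: "i \<in> cells L V"
  then have "{j \<in> cells L V. restrict j V = i} = {i}" by (auto simp: restrict_cells_eq)
  then show ?thesis by (simp add: marginal_def)
qed

lemma marginal_remove:
  assumes "i \<in> cells L V" "\<delta> \<in> V"
  shows "marginal V L p (V - {\<delta>}) (restrict i (V - {\<delta>})) = (\<Sum>c\<in>L \<delta>. p (i(\<delta> := c)))"
  unfolding marginal_def
proof (rule sum.reindex_bij_witness[where j="\<lambda>j. j \<delta>" and i="\<lambda>c. i(\<delta> := c)"])
  fix j assume j: "j \<in> {j \<in> cells L V. restrict j (V - {\<delta>}) = restrict i (V - {\<delta>})}"
  show eq: "i(\<delta> := j \<delta>) = j"
  proof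
    fix x
    have "restrict j (V - {\<delta>}) x = restrict i (V - {\<delta>}) x" using j by simp
    then show "(i(\<delta> := j \<delta>)) x = j x"
      using j assms(1) by (cases "x \<in> V") (auto simp: PiE_iff extensional_def split: if_splits)
  qed
  show "j \<delta> \<in> L \<delta>" using j assms by (auto simp: cells_eval)
  show "p (i(\<delta> := j \<delta>)) = p j" by (simp only: eq)
next
  fix c assume "c \<in> L \<delta>"
  then show "i(\<delta> := c) \<in> {j \<in> cells L V. restrict j (V - {\<delta>}) = restrict i (V - {\<delta>})}"
    using assms by (auto simp: cells_update fun_eq_iff)
qed auto

lemma marginal_remove2:
  assumes "i \<in> cells L V" "\<gamma> \<in> V" "\<delta> \<in> V" "\<gamma> \<noteq> \<delta>"
  shows "marginal V L p (V - {\<gamma>, \<delta>}) (restrict i (V - {\<gamma>, \<delta>})) =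
    (\<Sum>b\<in>L \<gamma>. \<Sum>c\<in>L \<delta>. p (i(\<gamma> := b, \<delta> := c)))"
  unfolding sum.cartesian_product marginal_def
proof (rule sum.reindex_bij_witness[where j="\<lambda>j. (j \<gamma>, j \<delta>)" and i="\<lambda>(b, c). i(\<gamma> := b, \<delta> := c)"])
  fix j assume j: "j \<in> {j \<in> cells L V. restrict j (V - {\<gamma>, \<delta>}) = restrict i (V - {\<gamma>, \<delta>})}"
  have eq: "i(\<gamma> := j \<gamma>, \<delta> := j \<delta>) = j"
  proof
    fix x
    have "restrict j (V - {\<gamma>, \<delta>}) x = restrict i (V - {\<gamma>, \<delta>}) x" using j by simp
    then show "(i(\<gamma> := j \<gamma>, \<delta> := j \<delta>)) x = j x"
      using j assms(1) by (cases "x \<in> V") (auto simp: PiE_iff extensional_def split: if_splits)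
  qed
  then show "(case (j \<gamma>, j \<delta>) of (b, c) \<Rightarrow> i(\<gamma> := b, \<delta> := c)) = j" by simp
  show "(j \<gamma>, j \<delta>) \<in> L \<gamma> \<times> L \<delta>" using j assms by (auto simp: cells_eval)
  show "(case (j \<gamma>, j \<delta>) of (b, c) \<Rightarrow> p (i(\<gamma> := b, \<delta> := c))) = p j" by (simp only: eq prod.case)
next
  fix z assume "z \<in> L \<gamma> \<times> L \<delta>"
  then show "(case z of (b, c) \<Rightarrow> i(\<gamma> := b, \<delta> := c)) \<in>
      {j \<in> cells L V. restrict j (V - {\<gamma>, \<delta>}) = restrict i (V - {\<gamma>, \<delta>})}"
    using assms by (auto simp: cells_update fun_eq_iff)
qed (use assms in auto)

text \<open>The three conditional probabilities share one denominator, the marginal of the remaining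
  variables, which is positive and can be multiplied out.\<close>

lemma markov_iff_sums:
  assumes lv: "levels_ok L V" and pos: "\<forall>i\<in>cells L V. 0 < p i"
  shows "markov V E L p \<longleftrightarrow> (\<forall>\<gamma>\<in>V. \<forall>\<delta>\<in>V. \<gamma> \<noteq> \<delta> \<and> {\<gamma>, \<delta>} \<notin> E \<longrightarrow> (\<forall>i\<in>cells L V.
     p i * (\<Sum>b\<in>L \<gamma>. \<Sum>c\<in>L \<delta>. p (i(\<gamma> := b, \<delta> := c))) = (\<Sum>c\<in>L \<delta>. p (i(\<delta> := c))) * (\<Sum>b\<in>L \<gamma>. p (i(\<gamma> := b)))))"
proof -
  have "(let W = V - {\<gamma>, \<delta>}; s = restrict i W in
        conditional V L p {\<gamma>, \<delta>} W s (restrict i {\<gamma>, \<delta>}) =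
        conditional V L p {\<gamma>} W s (restrict i {\<gamma>}) * conditional V L p {\<delta>} W s (restrict i {\<delta>})) \<longleftrightarrow>
     p i * (\<Sum>b\<in>L \<gamma>. \<Sum>c\<in>L \<delta>. p (i(\<gamma> := b, \<delta> := c))) = (\<Sum>c\<in>L \<delta>. p (i(\<delta> := c))) * (\<Sum>b\<in>L \<gamma>. p (i(\<gamma> := b)))"
    if g: "\<gamma> \<in> V" "\<delta> \<in> V" "\<gamma> \<noteq> \<delta>" and i: "i \<in> cells L V" for \<gamma> \<delta> i
  proof -
    let ?W = "V - {\<gamma>, \<delta>}"
    have u: "{\<gamma>, \<delta>} \<union> ?W = V" "{\<gamma>} \<union> ?W = V - {\<delta>}" "{\<delta>} \<union> ?W = V - {\<gamma>}" using g by auto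
    have m: "merge D ?W (restrict i D, restrict i ?W) = restrict i (D \<union> ?W)" for D
      by (auto simp: merge_def fun_eq_iff)
    have mg: "0 < (\<Sum>b\<in>L \<gamma>. \<Sum>c\<in>L \<delta>. p (i(\<gamma> := b, \<delta> := c)))"
      using g i lv unfolding levels_ok_def
      by (intro sum_pos bspec[OF pos] cells_update) auto
    have c: "conditional V L p {\<gamma>, \<delta>} ?W (restrict i ?W) (restrict i {\<gamma>, \<delta>}) =
        p i / (\<Sum>b\<in>L \<gamma>. \<Sum>c\<in>L \<delta>. p (i(\<gamma> := b, \<delta> := c)))"
      "conditional V L p {\<gamma>} ?W (restrict i ?W) (restrict i {\<gamma>}) =
        (\<Sum>c\<in>L \<delta>. p (i(\<delta> := c))) / (\<Sum>b\<in>L \<gamma>. \<Sum>c\<in>L \<delta>. p (i(\<gamma> := b, \<delta> := c)))"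
      "conditional V L p {\<delta>} ?W (restrict i ?W) (restrict i {\<delta>}) =
        (\<Sum>b\<in>L \<gamma>. p (i(\<gamma> := b))) / (\<Sum>b\<in>L \<gamma>. \<Sum>c\<in>L \<delta>. p (i(\<gamma> := b, \<delta> := c)))"
      unfolding conditional_def m u restrict_cells_eq[OF i] marginal_all[OF i] marginal_remove2[OF i g]
        marginal_remove[OF i g(1)] marginal_remove[OF i g(2)]
      by (rule refl)+
    show ?thesis unfolding Let_def c using mg by (simp add: field_simps)
  qed
  then show ?thesis unfolding markov_def by blast
qed

text \<open>Summing the cross-product identity over the levels of both vertices gives the Markov
  identity. Conversely, \<open>p\<close> is then a product of a function free of
  \<open>\<delta>\<close> and one free of \<open>\<gamma>\<close>, divided by one free of both, and
  in a cross-product ratio all of these cancel.\<close>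

lemma markov_iff_cross_product:
  assumes lv: "levels_ok L V" and pos: "\<forall>i\<in>cells L V. 0 < p i"
  shows "markov V E L p \<longleftrightarrow> cross_product E V L p"
proof
  assume cp: "cross_product E V L p"
  show "markov V E L p"
    unfolding markov_iff_sums[where E=E and p=p, OF assms]
  proof (intro ballI impI)
    fix \<gamma> \<delta> i assume g: "\<gamma> \<in> V" "\<delta> \<in> V" "\<gamma> \<noteq> \<delta> \<and> {\<gamma>, \<delta>} \<notin> E" "i \<in> cells L V"
    have "p i * (\<Sum>b\<in>L \<gamma>. \<Sum>c\<in>L \<delta>. p (i(\<gamma> := b, \<delta> := c))) = (\<Sum>b\<in>L \<gamma>. \<Sum>c\<in>L \<delta>. p (i(\<gamma> := b)) * p (i(\<delta> := c)))"
      unfolding sum_distrib_left using cp g unfolding cross_product_def by (intro sum.cong refl) blast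
    also have "\<dots> = (\<Sum>b\<in>L \<gamma>. p (i(\<gamma> := b))) * (\<Sum>c\<in>L \<delta>. p (i(\<delta> := c)))"
      by (simp only: sum_product)
    also have "\<dots> = (\<Sum>c\<in>L \<delta>. p (i(\<delta> := c))) * (\<Sum>b\<in>L \<gamma>. p (i(\<gamma> := b)))"
      by (rule mult.commute)
    finally show "p i * (\<Sum>b\<in>L \<gamma>. \<Sum>c\<in>L \<delta>. p (i(\<gamma> := b, \<delta> := c))) = (\<Sum>c\<in>L \<delta>. p (i(\<delta> := c))) * (\<Sum>b\<in>L \<gamma>. p (i(\<gamma> := b)))" .
  qed
next
  assume "markov V E L p"
  note mk = this[unfolded markov_iff_sums[where E=E and p=p, OF assms]]
  show "cross_product E V L p"
    unfolding cross_product_def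
  proof (intro ballI impI)
    fix x \<gamma> \<delta> b c
    assume x: "x \<in> cells L V" and g: "\<gamma> \<in> V" "\<delta> \<in> V" "\<gamma> \<noteq> \<delta> \<and> {\<gamma>, \<delta>} \<notin> E" and bc: "b \<in> L \<gamma>" "c \<in> L \<delta>"
    define M where "M i = (\<Sum>b\<in>L \<gamma>. \<Sum>c\<in>L \<delta>. p (i(\<gamma> := b, \<delta> := c)))" for i
    define P where "P i = (\<Sum>c\<in>L \<delta>. p (i(\<delta> := c)))" for i
    define Q where "Q i = (\<Sum>b\<in>L \<gamma>. p (i(\<gamma> := b)))" for i
    have eq: "p i * M i = P i * Q i" if "i \<in> cells L V" for i
      using mk g that unfolding M_def P_def Q_def by blast
    have ne: "\<gamma> \<noteq> \<delta>" using g by simp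
    have inv: "M (x(\<gamma> := b)) = M x" "M (x(\<delta> := c)) = M x" "M (x(\<gamma> := b, \<delta> := c)) = M x"
      "P (x(\<delta> := c)) = P x" "P (x(\<gamma> := b, \<delta> := c)) = P (x(\<gamma> := b))"
      "Q (x(\<gamma> := b)) = Q x" "Q (x(\<gamma> := b, \<delta> := c)) = Q (x(\<delta> := c))"
      unfolding M_def P_def Q_def using ne by (simp_all add: fun_upd_twist[OF ne])
    have M: "M x > 0"
      unfolding M_def using g x lv unfolding levels_ok_def by (intro sum_pos bspec[OF pos] cells_update) auto
    have xs: "x(\<gamma> := b) \<in> cells L V" "x(\<delta> := c) \<in> cells L V" "x(\<gamma> := b, \<delta> := c) \<in> cells L V"
      using x g bc by (simp_all add: cells_update)
    have "(p x * p (x(\<gamma> := b, \<delta> := c))) * (M x * M x) = (p x * M x) * (p (x(\<gamma> := b, \<delta> := c)) * M (x(\<gamma> := b, \<delta> := c)))"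
      unfolding inv by (simp add: ac_simps)
    also have "\<dots> = (p (x(\<gamma> := b)) * M (x(\<gamma> := b))) * (p (x(\<delta> := c)) * M (x(\<delta> := c)))"
      unfolding eq[OF x] eq[OF xs(1)] eq[OF xs(2)] eq[OF xs(3)] unfolding inv by (simp add: ac_simps)
    also have "\<dots> = (p (x(\<gamma> := b)) * p (x(\<delta> := c))) * (M x * M x)"
      unfolding inv by (simp add: ac_simps)
    finally show "p x * p (x(\<gamma> := b, \<delta> := c)) = p (x(\<gamma> := b)) * p (x(\<delta> := c))"
      using M by simp
  qed
qed

text \<open>A nonadjacent pair cannot lie inside the complete set \<open>R \<union> S\<close>, so
  each factor ignores one of the two vertices and has cross-product ratio one by itself.\<close>

lemma cross_product_factor_prod:
  assumes F: "perfect_factors E F"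
  shows "cross_product E W L (factor_prod F q)"
  unfolding cross_product_def factor_prod_def prod.distrib[symmetric]
proof (intro ballI impI prod.cong refl, clarify)
  fix x \<gamma> \<delta> b c R S
  assume ne: "\<gamma> \<noteq> \<delta>" "{\<gamma>, \<delta>} \<notin> E" and RS: "(R, S) \<in> F"
  have "\<gamma> \<notin> R \<union> S \<or> \<delta> \<notin> R \<union> S"
    using perfect_factorsD(5)[OF F RS] ne unfolding complete_in_def by blast
  moreover have u: "restrict (y(\<alpha> := a)) D = restrict y D" if "\<alpha> \<notin> D" for y :: "'a \<Rightarrow> 'b" and \<alpha> a and D :: "'a set"
    using that by (auto simp: fun_eq_iff)
  ultimately show "q (R, S, restrict x S) (restrict x R) *
      q (R, S, restrict (x(\<gamma> := b, \<delta> := c)) S) (restrict (x(\<gamma> := b, \<delta> := c)) R) =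
      q (R, S, restrict (x(\<gamma> := b)) S) (restrict (x(\<gamma> := b)) R) *
      q (R, S, restrict (x(\<delta> := c)) S) (restrict (x(\<delta> := c)) R)"
  proof (elim disjE)
    assume "\<gamma> \<notin> R \<union> S"
    then have a: "\<gamma> \<notin> R" "\<gamma> \<notin> S" by auto
    show ?thesis unfolding fun_upd_twist[OF ne(1)] u[OF a(1)] u[OF a(2)] ..
  next
    assume "\<delta> \<notin> R \<union> S"
    then have a: "\<delta> \<notin> R" "\<delta> \<notin> S" by auto
    show ?thesis unfolding u[OF a(1)] u[OF a(2)] by (rule mult.commute)
  qed
qed

section \<open>From pairs of vertices to pairs of vertex sets\<close>

lemma override_on_cells:
  "x \<in> cells L W \<Longrightarrow> y \<in> cells L W \<Longrightarrow> override_on x y D \<in> cells L W"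
  by (auto simp: override_on_def PiE_iff extensional_def)

text \<open>The coordinates in \<open>D\<close> are changed one at a time; each change contributes a
  ratio equal to one, and positivity permits cancelling the intermediate values.\<close>

lemma cross_product_point_set:
  assumes cp: "cross_product E W L g" and pos: "\<And>i. i \<in> cells L W \<Longrightarrow> 0 < g i"
    and "finite D" "D \<subseteq> W" "\<gamma> \<in> W - D" "\<And>v. v \<in> D \<Longrightarrow> {\<gamma>, v} \<notin> E"
    and x: "x \<in> cells L W" "z \<in> cells L W" and b: "b \<in> L \<gamma>"
  shows "g x * g ((override_on x z D)(\<gamma> := b)) = g (x(\<gamma> := b)) * g (override_on x z D)"
  using assms(3-6)
proof (induction D rule: finite_induct)
  case empty
  then show ?case by simp
next
  case (insert \<delta> D)
  let ?x = "override_on x z D"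
  have x': "?x \<in> cells L W" using x by (rule override_on_cells)
  have IH: "g x * g (?x(\<gamma> := b)) = g (x(\<gamma> := b)) * g ?x"
    by (rule insert.IH) (use insert.prems in auto)
  have C: "g ?x * g (?x(\<gamma> := b, \<delta> := z \<delta>)) = g (?x(\<gamma> := b)) * g (?x(\<delta> := z \<delta>))"
    using cp x' insert.prems b cells_eval[OF x(2)] unfolding cross_product_def by auto
  have p: "0 < g ?x" "0 < g (?x(\<gamma> := b))" using x' insert.prems b by (auto intro!: pos cells_update)
  have "(g x * g (?x(\<gamma> := b, \<delta> := z \<delta>))) * (g ?x * g (?x(\<gamma> := b))) =
      (g x * g (?x(\<gamma> := b))) * (g ?x * g (?x(\<gamma> := b, \<delta> := z \<delta>)))" by (simp add: ac_simps)
  also have "\<dots> = (g (x(\<gamma> := b)) * g (?x(\<delta> := z \<delta>))) * (g ?x * g (?x(\<gamma> := b)))"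
    unfolding IH C by (simp add: ac_simps)
  finally have "g x * g (?x(\<gamma> := b, \<delta> := z \<delta>)) = g (x(\<gamma> := b)) * g (?x(\<delta> := z \<delta>))"
    using p by (metis mult_cancel_right mult_eq_0_iff less_irrefl)
  moreover have "(override_on x z (insert \<delta> D))(\<gamma> := b) = ?x(\<gamma> := b, \<delta> := z \<delta>)"
    "override_on x z (insert \<delta> D) = ?x(\<delta> := z \<delta>)"
    using insert.prems by (auto simp: override_on_def fun_eq_iff)
  ultimately show ?case by (simp only:)
qed

text \<open>The same telescoping in the other argument. Together the two inductions lead from the
  pairwise to the setwise Markov property, which fails in general without positivity.\<close>

lemma cross_product_sets:
  assumes cp: "cross_product E W L g" and pos: "\<And>i. i \<in> cells L W \<Longrightarrow> 0 < g i"
    and "finite C" "C \<subseteq> W" "finite D" "D \<subseteq> W" "C \<inter> D = {}" "\<And>u v. u \<in> C \<Longrightarrow> v \<in> D \<Longrightarrow> {u, v} \<notin> E"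
    and x: "x \<in> cells L W" "y \<in> cells L W" "z \<in> cells L W"
  shows "g x * g (override_on (override_on x y C) z D) = g (override_on x y C) * g (override_on x z D)"
  using assms(3,4,7,8)
proof (induction C rule: finite_induct)
  case empty
  then show ?case by simp
next
  case (insert \<gamma> C)
  let ?x = "override_on x y C"
  have x': "?x \<in> cells L W" using x(1,2) by (rule override_on_cells)
  have x'': "override_on ?x z D \<in> cells L W" using x' x(3) by (rule override_on_cells)
  have IH: "g x * g (override_on ?x z D) = g ?x * g (override_on x z D)"
    by (rule insert.IH) (use insert.prems in auto)
  have C: "g ?x * g ((override_on ?x z D)(\<gamma> := y \<gamma>)) = g (?x(\<gamma> := y \<gamma>)) * g (override_on ?x z D)"
    using insert.prems assms(5,6)
    by (intro cross_product_point_set[OF cp pos] x' x(3) cells_eval[OF x(2)]) auto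
  have p: "0 < g ?x" "0 < g (override_on ?x z D)" using pos x' x'' by auto
  have "(g x * g ((override_on ?x z D)(\<gamma> := y \<gamma>))) * (g ?x * g (override_on ?x z D)) =
     (g x * g (override_on ?x z D)) * (g ?x * g ((override_on ?x z D)(\<gamma> := y \<gamma>)))" by (simp add: ac_simps)
  also have "\<dots> = (g (?x(\<gamma> := y \<gamma>)) * g (override_on x z D)) * (g ?x * g (override_on ?x z D))"
    unfolding IH C by (simp add: ac_simps)
  finally have "g x * g ((override_on ?x z D)(\<gamma> := y \<gamma>)) = g (?x(\<gamma> := y \<gamma>)) * g (override_on x z D)"
    using p by (metis mult_cancel_right mult_eq_0_iff less_irrefl)
  moreover have "(override_on ?x z D)(\<gamma> := y \<gamma>) = override_on (override_on x y (insert \<gamma> C)) z D"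
    "?x(\<gamma> := y \<gamma>) = override_on x y (insert \<gamma> C)"
    using insert.prems by (auto simp: override_on_def fun_eq_iff)
  ultimately show ?case by (simp only:)
qed

lemma factor_prod_cong:
  assumes "\<And>R S s r. (R, S) \<in> F \<Longrightarrow> s \<in> cells L S \<Longrightarrow> r \<in> cells L R \<Longrightarrow> q (R, S, s) r = q' (R, S, s) r"
    and "perfect_factors E F" "verts F \<subseteq> H" "x \<in> cells L H"
  shows "factor_prod F q x = factor_prod F q' x"
  unfolding factor_prod_def
proof (intro prod.cong refl, clarify)
  fix R S assume RS: "(R, S) \<in> F"
  then have "R \<subseteq> H" "S \<subseteq> H" using perfect_factorsD(3)[OF assms(2)] assms(3) by force+
  then show "q (R, S, restrict x S) (restrict x R) = q' (R, S, restrict x S) (restrict x R)"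
    by (intro assms(1)[OF RS] restrict_cells[OF assms(4)])
qed

text \<open>Summing the last residual out of \<open>g\<close> leaves \<open>g'\<close>, which again
  has trivial cross-product ratios, and \<open>g / g'\<close> depends on the earlier vertices only
  through \<open>S\<close>: this quotient is the new conditional probability. The constant
  \<open>c\<close> allows the induction to run over unnormalized functions.\<close>

lemma cross_product_factorizes:
  assumes "perfect_factors E F" "levels_ok L (verts F)" "\<And>x. x \<in> cells L (verts F) \<Longrightarrow> 0 < g x"
    and "cross_product E (verts F) L g"
  shows "\<exists>q c. cond_family L F q \<and> 0 < c \<and> (\<forall>x\<in>cells L (verts F). g x = c * factor_prod F q x)"
  using assms
proof (induction arbitrary: g rule: perfect_factors.induct)
  case empty
  \<comment> \<open>The empty domain has the constantly \<open>undefined\<close> function as its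
    only cell, and \<open>c\<close> is the value of \<open>g\<close> there.\<close>
  then show ?case by (intro exI[of _ "\<lambda>_ _. 1"] exI[of _ "g (\<lambda>_. undefined)"])
      (auto simp: cond_family_def factor_prod_def)
next
  case (insert F R S)
  show ?case
  proof (cases "(R, S) \<in> F")
    case True
    then show ?thesis using insert by (simp add: insert_absorb)
  next
    case False
    define H where "H = verts F"
    have HR: "verts (insert (R, S) F) = H \<union> R" unfolding H_def by auto
    note lv = insert.prems(1)[unfolded HR] and gpos = insert.prems(2)[unfolded HR]
      and cp = insert.prems(3)[unfolded HR]
    have dis: "H \<inter> R = {}" "R \<inter> H = {}" and SH: "S \<subseteq> H" using insert.hyps unfolding H_def by auto
    have fin: "finite H" "finite R" using lv by (auto simp: levels_ok_def)
    define m where "m y r = merge H R (y, r)" for y r :: "'a \<Rightarrow> 'b"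
    have m: "m y r \<in> cells L (H \<union> R)" if "y \<in> cells L H" "r \<in> cells L R" for y r
      unfolding m_def using dis(1) that by (rule merge_cells)
    define g' where "g' y = (\<Sum>r\<in>cells L R. g (m y r))" for y
    obtain a where a: "a \<in> cells L R" using cells_nonempty[OF lv, of R] by auto
    have finR: "finite (cells L R)" by (rule finite_cells[OF lv]) auto
    have g'pos: "0 < g' y" if "y \<in> cells L H" for y
      unfolding g'_def using finR a that by (intro sum_pos gpos m) auto
    have nb: "{u, v} \<notin> E" if "u \<in> R" "v \<in> H - S" for u v
      using insert.hyps(6)[of u v] that unfolding H_def by blast
    \<comment> \<open>Starting from the cell \<open>(y', a)\<close>, two moves commute: replacing
      \<open>a\<close> by \<open>r\<close> on \<open>R\<close>, and replacing \<open>y'\<close> by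
      \<open>y\<close> on \<open>H - S\<close>. No edge joins these two sets, and the second move
      turns \<open>y'\<close> into \<open>y\<close> because both agree on \<open>S\<close>.\<close>
    have key: "g (m y r) * g (m y' a) = g (m y' r) * g (m y a)"
      if "y \<in> cells L H" "y' \<in> cells L H" "restrict y S = restrict y' S" "r \<in> cells L R" "a \<in> cells L R"
      for y y' r a
    proof -
      have agree: "y v = y' v" if "v \<in> S" for v using \<open>restrict y S = restrict y' S\<close> that
        by (metis restrict_apply')
      have "g (m y' a) * g (override_on (override_on (m y' a) (m y r) R) (m y r) (H - S)) =
          g (override_on (m y' a) (m y r) R) * g (override_on (m y' a) (m y r) (H - S))"
        using that fin dis nb
        by (intro cross_product_sets[OF cp gpos] m) auto
      moreover have "override_on (m y' a) (m y r) R = m y' r"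
        using dis that by (auto simp: override_on_def m_def merge_def fun_eq_iff)
      moreover have "override_on (m y' r) (m y r) (H - S) = m y r"
        using dis agree by (auto simp: override_on_def m_def merge_def fun_eq_iff)
      moreover have "override_on (m y' a) (m y r) (H - S) = m y a"
        using dis agree by (auto simp: override_on_def m_def merge_def fun_eq_iff)
      ultimately show ?thesis by (simp add: mult.commute)
    qed
    have key1: "g (m y r) * g' y' = g (m y' r) * g' y"
      if "y \<in> cells L H" "y' \<in> cells L H" "restrict y S = restrict y' S" "r \<in> cells L R" for y y' r
      unfolding g'_def sum_distrib_left using key that by (intro sum.cong refl) blast
    \<comment> \<open>The quotient of the marginal \<open>g'\<close> by the slice of
      \<open>g\<close> at the fixed cell \<open>a\<close> is a function of the values on
      \<open>S\<close> alone. The slice has trivial cross-product ratios, so only this quotient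
      needs attention for \<open>g'\<close>.\<close>
    have key2: "g' y * g (m y' a) = g' y' * g (m y a)"
      if "y \<in> cells L H" "y' \<in> cells L H" "restrict y S = restrict y' S" for y y'
      unfolding g'_def sum_distrib_right using key that a by (intro sum.cong refl) blast
    have "cross_product E H L g'"
      unfolding cross_product_def
    proof (intro ballI impI)
      fix y \<gamma> \<delta> b c
      assume y: "y \<in> cells L H" and g: "\<gamma> \<in> H" "\<delta> \<in> H" "\<gamma> \<noteq> \<delta> \<and> {\<gamma>, \<delta>} \<notin> E" and bc: "b \<in> L \<gamma>" "c \<in> L \<delta>"
      let ?b = "y(\<gamma> := b)" and ?c = "y(\<delta> := c)" and ?bc = "y(\<gamma> := b, \<delta> := c)"
      have ys: "?b \<in> cells L H" "?c \<in> cells L H" "?bc \<in> cells L H" using y g bc by (simp_all add: cells_update)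
      have mu: "m (x(\<alpha> := d)) a = (m x a)(\<alpha> := d)" if "\<alpha> \<in> H" for x \<alpha> d
        using dis that by (auto simp: m_def merge_def fun_eq_iff)
      have "g (m y a) * g ((m y a)(\<gamma> := b, \<delta> := c)) = g ((m y a)(\<gamma> := b)) * g ((m y a)(\<delta> := c))"
        using cp m[OF y a] g bc unfolding cross_product_def by blast
      then have G: "g (m y a) * g (m ?bc a) = g (m ?b a) * g (m ?c a)" using g by (simp add: mu)
      have pp: "0 < g (m ?b a)" "0 < g (m ?c a)" using ys a by (auto intro!: gpos m)
      \<comment> \<open>As \<open>S\<close> is complete, one of the two nonadjacent vertices lies
        outside it, and changing that vertex leaves the quotient in \<open>key2\<close>
        unchanged.\<close>
      have "\<gamma> \<notin> S \<or> \<delta> \<notin> S" using insert.hyps(5) g unfolding complete_in_def by blast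
      then have "(g' y * g' ?bc) * (g (m ?b a) * g (m ?c a)) = (g' ?b * g' ?c) * (g (m y a) * g (m ?bc a))"
      proof
        assume S: "\<gamma> \<notin> S"
        have "restrict ?b S = restrict y S" "restrict ?c S = restrict ?bc S"
          using S g by (auto simp: fun_eq_iff)
        then have e: "g' ?b * g (m y a) = g' y * g (m ?b a)" "g' ?c * g (m ?bc a) = g' ?bc * g (m ?c a)"
          using key2 y ys by blast+
        have "(g' ?b * g' ?c) * (g (m y a) * g (m ?bc a)) = (g' ?b * g (m y a)) * (g' ?c * g (m ?bc a))"
          by (simp only: ac_simps)
        then show ?thesis unfolding e by (simp only: ac_simps)
      next
        assume S: "\<delta> \<notin> S"
        have "restrict ?c S = restrict y S" "restrict ?b S = restrict ?bc S"
          using S g by (auto simp: fun_eq_iff)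
        then have e: "g' ?c * g (m y a) = g' y * g (m ?c a)" "g' ?b * g (m ?bc a) = g' ?bc * g (m ?b a)"
          using key2 y ys by blast+
        have "(g' ?b * g' ?c) * (g (m y a) * g (m ?bc a)) = (g' ?c * g (m y a)) * (g' ?b * g (m ?bc a))"
          by (simp only: ac_simps)
        then show ?thesis unfolding e by (simp only: ac_simps)
      qed
      then show "g' y * g' ?bc = g' ?b * g' ?c" unfolding G using pp by simp
    qed
    moreover have "levels_ok L H" using lv by (rule levels_ok_subset) simp
    ultimately obtain q0 c where q0: "cond_family L F q0" "0 < c" "\<And>y. y \<in> cells L H \<Longrightarrow> g' y = c * factor_prod F q0 y"
      using insert.IH[of g', folded H_def] g'pos by metis
    obtain z where z: "z \<in> cells L H" using cells_nonempty[OF lv, of H] by auto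
    \<comment> \<open>The conditional probability may refer only to a cell on \<open>S\<close>,
      whereas \<open>g\<close> needs a cell on all of \<open>H\<close>. An arbitrary fixed
      \<open>z\<close> fills the gap; by \<open>key1\<close> the choice does not matter.\<close>
    define ext where "ext s = merge S (H - S) (s, z)" for s
    have ext: "ext s \<in> cells L H" "restrict (ext s) S = s" if "s \<in> cells L S" for s
    proof -
      have "merge S (H - S) (s, restrict z (H - S)) \<in> cells L (S \<union> (H - S))"
        using that z by (intro merge_cells restrict_cells[of z H L]) auto
      moreover have "S \<union> (H - S) = H" using SH by auto
      ultimately show "ext s \<in> cells L H" unfolding ext_def merge_restrict by (simp only:)
      show "restrict (ext s) S = s" using that unfolding ext_def by (simp add: restrict_merge_left restrict_cells_eq)
    qed
    define q where "q = (\<lambda>(R', S', s) r. if (R', S') = (R, S) then g (m (ext s) r) / g' (ext s) else q0 (R', S', s) r)"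
    have qRS: "q (R, S, restrict y S) r = g (m y r) / g' y" if y: "y \<in> cells L H" and r: "r \<in> cells L R" for y r
    proof -
      have s: "restrict y S \<in> cells L S" using y SH by (rule restrict_cells)
      show ?thesis using key1[OF y ext(1)[OF s] _ r] ext(2)[OF s] g'pos[OF y] g'pos[OF ext(1)[OF s]]
        unfolding q_def by (simp add: field_simps)
    qed
    have "cond_family L (insert (R, S) F) q"
      unfolding cond_family_def
    proof (clarify, intro conjI ballI)
      fix R' S' s assume RS': "(R', S') \<in> insert (R, S) F" and s: "s \<in> cells L S'"
      show "0 < q (R', S', s) r" if r: "r \<in> cells L R'" for r
      proof (cases "(R', S') = (R, S)")
        case True
        then show ?thesis using r s ext g'pos gpos m unfolding q_def by auto
      next
        case False
        then show ?thesis using q0(1) RS' s r unfolding q_def cond_family_def by auto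
      qed
      show "(\<Sum>r\<in>cells L R'. q (R', S', s) r) = 1"
      proof (cases "(R', S') = (R, S)")
        case True
        then have "(\<Sum>r\<in>cells L R'. q (R', S', s) r) = (\<Sum>r\<in>cells L R. g (m (ext s) r) / g' (ext s))"
          unfolding q_def by simp
        also have "\<dots> = g' (ext s) / g' (ext s)"
          unfolding sum_divide_distrib[symmetric] by (simp only: g'_def)
        finally have "(\<Sum>r\<in>cells L R'. q (R', S', s) r) = g' (ext s) / g' (ext s)" .
        then show ?thesis using g'pos[OF ext(1)[of s]] s True by simp
      next
        case False
        have "(\<Sum>r\<in>cells L R'. q (R', S', s) r) = (\<Sum>r\<in>cells L R'. q0 (R', S', s) r)"
          unfolding q_def prod.case if_not_P[OF False] ..
        moreover have "(R', S') \<in> F" using RS' False by blast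
        ultimately show ?thesis using q0(1) s unfolding cond_family_def by auto
      qed
    qed
    moreover have "g x = c * factor_prod (insert (R, S) F) q x" if x: "x \<in> cells L (H \<union> R)" for x
    proof -
      define y where "y = restrict x H"
      define r where "r = restrict x R"
      have y: "y \<in> cells L H" and r: "r \<in> cells L R" unfolding y_def r_def using x by (auto intro: restrict_cells)
      have xm: "x = m y r" unfolding m_def y_def r_def using merge_restrict_self[OF x] by simp
      have ys: "restrict y S = restrict x S" unfolding y_def using SH by (simp add: Int_absorb1)
      have "factor_prod F q x = factor_prod F q0 x"
        unfolding factor_prod_def by (intro prod.cong refl) (use False in \<open>auto simp: q_def\<close>)
      also have "\<dots> = factor_prod F q0 y"
        by (rule factor_prod_cong_restrict[OF insert.hyps(1)]) (simp add: y_def H_def)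
      finally have "c * factor_prod (insert (R, S) F) q x = g (m y r) / g' y * g' y"
        using qRS[OF y r] q0(3)[OF y] by (simp add: factor_prod_insert[OF insert.hyps(1) False] ys r_def)
      then show ?thesis using g'pos[OF y] xm by simp
    qed
    ultimately show ?thesis unfolding HR using q0(2) by blast
  qed
qed

section \<open>Marginals and conditionals of a factorized distribution\<close>

lemma marginal_eq_sum:
  assumes "levels_ok L V"
  shows "marginal V L p D s = (\<Sum>x\<in>cells L V. p x * of_bool (restrict x D = s))"
proof -
  have "(\<Sum>x\<in>cells L V. p x * of_bool (restrict x D = s)) = (\<Sum>x\<in>cells L V. if restrict x D = s then p x else 0)"
    by (intro sum.cong refl) auto
  then show ?thesis unfolding marginal_def
    using finite_cells[OF assms order_refl] by (simp add: sum.inter_filter)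
qed

lemma marginal_pos:
  assumes lv: "levels_ok L V" and "\<And>x. x \<in> cells L V \<Longrightarrow> 0 < p x" and "S \<subseteq> V" "s \<in> cells L S"
  shows "0 < marginal V L p S s"
proof -
  obtain z where z: "z \<in> cells L V" using cells_nonempty[OF lv order_refl] by auto
  have "S \<union> (V - S) = V" using assms(3) by auto
  moreover have "merge S (V - S) (s, restrict z (V - S)) \<in> cells L (S \<union> (V - S))"
    using assms(4) z by (intro merge_cells restrict_cells[of z V L]) auto
  ultimately have "merge S (V - S) (s, restrict z (V - S)) \<in> cells L V" by (simp only:)
  moreover have "restrict (merge S (V - S) (s, restrict z (V - S))) S = s"
    using assms(4) by (simp add: restrict_merge_left restrict_cells_eq)
  ultimately show ?thesis
    unfolding marginal_def using finite_cells[OF lv order_refl] assms(2)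
    by (intro sum_pos) auto
qed

text \<open>The marginal is the expectation of the indicator that the residual is \<open>r\<close>
  and the separator is \<open>s\<close>; the tower property evaluates the first indicator as
  \<open>q (R, S, s) r\<close>.\<close>

lemma marginal_factor:
  assumes lv: "levels_ok L (verts F)" and F: "perfect_factors E F" and q: "cond_family L F q" and RS: "(R, S) \<in> F"
    and s: "s \<in> cells L S" and r: "r \<in> cells L R"
  shows "marginal (verts F) L (factor_prod F q) (R \<union> S) (merge R S (r, s)) =
    marginal (verts F) L (factor_prod F q) S s * q (R, S, s) r"
proof -
  have eq: "restrict x (R \<union> S) = merge R S (r, s) \<longleftrightarrow> restrict x R = r \<and> restrict x S = s" for x
  proof
    assume h: "restrict x (R \<union> S) = merge R S (r, s)"
    have "restrict x R = restrict (restrict x (R \<union> S)) R" "restrict x S = restrict (restrict x (R \<union> S)) S"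
      by (simp_all add: Int_absorb1)
    then show "restrict x R = r \<and> restrict x S = s"
      unfolding h using s perfect_factorsD(4)[OF F RS] r
      by (auto simp: restrict_merge_left restrict_cells_eq restrict_merge_right Int_commute)
  next
    assume "restrict x R = r \<and> restrict x S = s"
    then have e: "r = restrict x R" "s = restrict x S" by simp_all
    show "restrict x (R \<union> S) = merge R S (r, s)" unfolding e merge_restrict merge_x_x_eq_restrict ..
  qed
  have "marginal (verts F) L (factor_prod F q) (R \<union> S) (merge R S (r, s)) =
      (\<Sum>x\<in>cells L (verts F). factor_prod F q x * (of_bool (restrict x R = r) * of_bool (restrict x S = s)))"
    unfolding marginal_eq_sum[OF lv] eq of_bool_conj ..
  also have "\<dots> = (\<Sum>x\<in>cells L (verts F). factor_prod F q x *
      (\<Sum>r'\<in>cells L R. q (R, S, restrict x S) r' * (of_bool (r' = r) * of_bool (restrict x S = s))))"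
    by (rule expectation_factor[OF F q RS, where v="\<lambda>s' r'. of_bool (r' = r) * of_bool (s' = s)"])
  also have "\<dots> = (\<Sum>x\<in>cells L (verts F). factor_prod F q x * of_bool (restrict x S = s) * q (R, S, s) r)"
  proof (intro sum.cong refl)
    fix x
    have "finite (cells L R)" using finite_cells[OF lv, of R] RS by force
    have "(\<Sum>r'\<in>cells L R. q (R, S, restrict x S) r' * (of_bool (r' = r) * of_bool (restrict x S = s))) =
        (\<Sum>r'\<in>cells L R. if r' = r then of_bool (restrict x S = s) * q (R, S, s) r' else 0)"
      by (intro sum.cong refl) auto
    also have "\<dots> = of_bool (restrict x S = s) * q (R, S, s) r"
      using r \<open>finite (cells L R)\<close> by (simp add: sum.delta)
    finally have "(\<Sum>r'\<in>cells L R. q (R, S, restrict x S) r' * (of_bool (r' = r) * of_bool (restrict x S = s))) =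
        of_bool (restrict x S = s) * q (R, S, s) r" .
    then show "factor_prod F q x * (\<Sum>r'\<in>cells L R. q (R, S, restrict x S) r' * (of_bool (r' = r) * of_bool (restrict x S = s))) =
        factor_prod F q x * of_bool (restrict x S = s) * q (R, S, s) r" by simp
  qed
  finally show ?thesis unfolding marginal_eq_sum[OF lv] sum_distrib_right .
qed

text \<open>The prescribed vectors are recovered from the distribution, so the parametrization is
  injective and its coordinates vary independently.\<close>

lemma conditional_factor_prod:
  assumes lv: "levels_ok L (verts F)" and F: "perfect_factors E F" and q: "cond_family L F q" and RS: "(R, S) \<in> F"
    and s: "s \<in> cells L S" and r: "r \<in> cells L R"
  shows "conditional (verts F) L (factor_prod F q) R S s r = q (R, S, s) r"
proof -
  have "0 < marginal (verts F) L (factor_prod F q) S s"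
    using perfect_factorsD(3)[OF F RS] s factor_prod_pos[OF F q] by (intro marginal_pos[OF lv]) auto
  then show ?thesis unfolding conditional_def marginal_factor[OF assms] by simp
qed

lemma marginal_cong: "(\<And>x. x \<in> cells L V \<Longrightarrow> p x = p' x) \<Longrightarrow> marginal V L p D s = marginal V L p' D s"
  unfolding marginal_def by (intro sum.cong) auto

lemma conditional_cong: "(\<And>x. x \<in> cells L V \<Longrightarrow> p x = p' x) \<Longrightarrow> conditional V L p R S s r = conditional V L p' R S s r"
  unfolding conditional_def by (simp add: marginal_cong[of V L p p'])

section \<open>The cut parametrization\<close>

type_synonym ('v, 'a) param = "('v, 'a) group \<times> ('v \<Rightarrow> 'a) \<Rightarrow> real"

text \<open>The whole probability vector of a group, including the cell left out of the coordinates.\<close>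

definition full_prob :: "(('v, 'a) group \<Rightarrow> ('v \<Rightarrow> 'a) list) \<Rightarrow> ('v, 'a) param \<Rightarrow>
    ('v, 'a) group \<Rightarrow> ('v \<Rightarrow> 'a) \<Rightarrow> real" where
  "full_prob fc \<theta> g r = (if r \<in> set (fc g) then \<theta> (g, r) else 1 - (\<Sum>r'\<in>set (fc g). \<theta> (g, r')))"

text \<open>What the statistical argument uses of the cut parametrization: a perfect sequence
  covering \<open>V\<close>, its groups in an arbitrary order, and one omitted cell for each group.
  Clique orders enter only through \<open>F\<close>.\<close>

locale factor_model =
  fixes V :: "'v set" and E :: "'v set set" and L :: "'v \<Rightarrow> 'a set" and F :: "('v set \<times> 'v set) set"
    and gl :: "('v, 'a) group list" and fc :: "('v, 'a) group \<Rightarrow> ('v \<Rightarrow> 'a) list"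
  assumes factors: "perfect_factors E F" and verts: "verts F = V" and levels: "levels_ok L V"
    and distinct_gl: "distinct gl" and set_gl: "set gl = {(R, S, s). (R, S) \<in> F \<and> s \<in> cells L S}"
    and coords: "\<And>g. g \<in> set gl \<Longrightarrow> all_but_one L g (fc g)"
begin

definition gcells :: "('v, 'a) group \<Rightarrow> ('v \<Rightarrow> 'a) set" where
  "gcells g = cells L (fst g)"

definition last_cell :: "('v, 'a) group \<Rightarrow> 'v \<Rightarrow> 'a" where
  "last_cell g = (SOME r. r \<in> gcells g \<and> set (fc g) = gcells g - {r})"

abbreviation "\<Theta> \<equiv> cut_space gl fc"
abbreviation "coord_set \<equiv> set (concat (ordered_groups gl fc))"
abbreviation "groups \<equiv> ordered_groups gl fc"
abbreviation "counts N \<equiv> count_tables V L N"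
abbreviation "lik N \<theta> \<equiv> multinomial_prob V L N (cut_dist V E L gl fc \<theta>)"
abbreviation "pr \<equiv> full_prob fc"

text \<open>An explicit inverse of \<open>cut_param\<close>, which makes \<open>cut_dist\<close>
  computable on the parameter space. The restriction to cells is there because members of the Markov
  family are extensional.\<close>

definition theta_dist :: "('v, 'a) param \<Rightarrow> ('v \<Rightarrow> 'a) \<Rightarrow> real" where
  "theta_dist \<theta> = restrict (factor_prod F (pr \<theta>)) (cells L V)"

lemma groupD:
  assumes "(R, S, s) \<in> set gl"
  shows "(R, S) \<in> F" "s \<in> cells L S" "R \<subseteq> V" "S \<subseteq> V"
proof -
  show "(R, S) \<in> F" "s \<in> cells L S" using assms set_gl by auto
  then show "R \<subseteq> V" "S \<subseteq> V" using perfect_factorsD(3)[OF factors] verts by force+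
qed

lemma finite_gcells: "g \<in> set gl \<Longrightarrow> finite (gcells g)"
  by (cases g) (auto simp: gcells_def intro!: finite_cells[OF levels] dest: groupD)

lemma last_cell:
  assumes "g \<in> set gl"
  shows "last_cell g \<in> gcells g" "set (fc g) = gcells g - {last_cell g}" "distinct (fc g)"
proof -
  obtain R S s where g: "g = (R, S, s)" by (cases g)
  have "\<exists>r. r \<in> gcells g \<and> set (fc g) = gcells g - {r}"
    using coords[OF assms] unfolding all_but_one_def gcells_def g by auto
  from someI_ex[OF this] show "last_cell g \<in> gcells g" "set (fc g) = gcells g - {last_cell g}"
    unfolding last_cell_def by blast+
  show "distinct (fc g)" using coords[OF assms] unfolding all_but_one_def g by auto
qed

lemma gcells_eq: "g \<in> set gl \<Longrightarrow> gcells g = insert (last_cell g) (set (fc g))"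
  and last_notin: "g \<in> set gl \<Longrightarrow> last_cell g \<notin> set (fc g)"
  using last_cell(1,2)[of g] by blast+

lemma sum_gcells: "g \<in> set gl \<Longrightarrow> (\<Sum>r\<in>gcells g. u r) = u (last_cell g) + (\<Sum>r\<in>set (fc g). u r)"
  by (simp add: gcells_eq last_notin)

lemma prod_gcells: "g \<in> set gl \<Longrightarrow> (\<Prod>r\<in>gcells g. u r) = u (last_cell g) * (\<Prod>r\<in>set (fc g). u r)"
  by (simp add: gcells_eq last_notin)

lemma mem_coord_set: "(g, r) \<in> coord_set \<longleftrightarrow> g \<in> set gl \<and> r \<in> set (fc g)"
  unfolding ordered_groups_def by auto

lemma full_prob_coord: "r \<in> set (fc g) \<Longrightarrow> pr \<theta> g r = \<theta> (g, r)"
  by (simp add: full_prob_def)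

lemma full_prob_last: "g \<in> set gl \<Longrightarrow> pr \<theta> g (last_cell g) = 1 - (\<Sum>r\<in>set (fc g). \<theta> (g, r))"
  by (simp add: full_prob_def last_notin)

lemma sum_full_prob: "g \<in> set gl \<Longrightarrow> (\<Sum>r\<in>gcells g. pr \<theta> g r) = 1"
  by (simp add: sum_gcells full_prob_last full_prob_coord)

lemma full_prob_pos: "\<theta> \<in> \<Theta> \<Longrightarrow> g \<in> set gl \<Longrightarrow> r \<in> gcells g \<Longrightarrow> 0 < pr \<theta> g r"
  unfolding cut_space_def by (auto simp: gcells_eq full_prob_last full_prob_coord)

lemma full_prob_le_1:
  assumes "\<theta> \<in> \<Theta>" "g \<in> set gl" "r \<in> gcells g" shows "pr \<theta> g r \<le> 1"
proof -
  have "pr \<theta> g r \<le> (\<Sum>r\<in>gcells g. pr \<theta> g r)"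
    using assms by (intro member_le_sum finite_gcells less_imp_le full_prob_pos) auto
  then show ?thesis by (simp add: sum_full_prob assms)
qed

lemma group_of_factor: "(R, S) \<in> F \<Longrightarrow> s \<in> cells L S \<Longrightarrow> (R, S, s) \<in> set gl"
  using set_gl by auto

lemma cond_family_full_prob: "\<theta> \<in> \<Theta> \<Longrightarrow> cond_family L F (pr \<theta>)"
  unfolding cond_family_def
  using group_of_factor full_prob_pos sum_full_prob by (fastforce simp: gcells_def)

lemma theta_dist_pos: "\<theta> \<in> \<Theta> \<Longrightarrow> i \<in> cells L V \<Longrightarrow> 0 < theta_dist \<theta> i"
  unfolding theta_dist_def using factor_prod_pos[OF factors cond_family_full_prob] verts by auto

lemma sum_theta_dist: "\<theta> \<in> \<Theta> \<Longrightarrow> (\<Sum>i\<in>cells L V. theta_dist \<theta> i) = 1"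
  unfolding theta_dist_def using sum_factor_prod[OF factors cond_family_full_prob] verts by simp

lemma conditional_theta_dist:
  assumes "\<theta> \<in> \<Theta>" "(R, S, s) \<in> set gl" "r \<in> cells L R"
  shows "conditional V L (theta_dist \<theta>) R S s r = pr \<theta> (R, S, s) r"
proof -
  have "conditional V L (theta_dist \<theta>) R S s r = conditional V L (factor_prod F (pr \<theta>)) R S s r"
    by (rule conditional_cong) (simp add: theta_dist_def)
  also have "\<dots> = pr \<theta> (R, S, s) r"
    using conditional_factor_prod[OF _ factors cond_family_full_prob[OF assms(1)] groupD(1,2)[OF assms(2)] assms(3)]
      levels verts by simp
  finally show ?thesis .
qed

lemma cross_product_cong:
  assumes "cross_product E W L p" "\<And>x. x \<in> cells L W \<Longrightarrow> p' x = p x"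
  shows "cross_product E W L p'"
  using assms(1) unfolding cross_product_def by (simp add: assms(2) cells_update)

lemma theta_dist_family: "\<theta> \<in> \<Theta> \<Longrightarrow> theta_dist \<theta> \<in> positive_markov_family V E L"
  unfolding positive_markov_family_def
  using theta_dist_pos[of \<theta>] sum_theta_dist[of \<theta>]
    markov_iff_cross_product[where E=E and p="theta_dist \<theta>", OF levels]
    cross_product_cong[OF cross_product_factor_prod[OF factors], of V "theta_dist \<theta>" "pr \<theta>"]
  by (simp add: theta_dist_def)

lemma family_factorizes:
  assumes p: "p \<in> positive_markov_family V E L"
  obtains q where "cond_family L F q" "\<And>x. x \<in> cells L V \<Longrightarrow> p x = factor_prod F q x"
proof -
  have pos: "\<And>i. i \<in> cells L V \<Longrightarrow> 0 < p i" and sum: "(\<Sum>i\<in>cells L V. p i) = 1" and "markov V E L p"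
    using p unfolding positive_markov_family_def by auto
  then have "cross_product E (verts F) L p" using markov_iff_cross_product[OF levels, of p E] verts by simp
  then have "\<exists>q c. cond_family L F q \<and> 0 < c \<and> (\<forall>x\<in>cells L (verts F). p x = c * factor_prod F q x)"
    using cross_product_factorizes[OF factors, of L p] levels pos verts by auto
  then obtain q c where q: "cond_family L F q" "\<And>x. x \<in> cells L V \<Longrightarrow> p x = c * factor_prod F q x"
    unfolding verts by blast
  \<comment> \<open>Both \<open>p\<close> and the product of its factors have total mass
    one.\<close>
  have "c = 1" using sum_factor_prod[OF factors q(1)] sum q(2) verts by (simp add: sum_distrib_left[symmetric])
  then show ?thesis using that q by simp
qed

lemma cut_param_family:
  assumes p: "p \<in> positive_markov_family V E L"
  shows "cut_param V L gl fc p \<in> \<Theta>" "theta_dist (cut_param V L gl fc p) = p"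
proof -
  obtain q where q: "cond_family L F q" "\<And>x. x \<in> cells L V \<Longrightarrow> p x = factor_prod F q x"
    using family_factorizes[OF p] by blast
  let ?\<theta> = "cut_param V L gl fc p"
  have cond: "conditional V L p R S s r = q (R, S, s) r" if "(R, S, s) \<in> set gl" "r \<in> cells L R" for R S s r
  proof -
    have "conditional V L p R S s r = conditional V L (factor_prod F q) R S s r"
      by (rule conditional_cong) (rule q(2))
    also have "\<dots> = q (R, S, s) r"
      using conditional_factor_prod[OF _ factors q(1) groupD(1,2)[OF that(1)] that(2)] levels verts by simp
    finally show ?thesis .
  qed
  have coord: "?\<theta> (g, r) = q g r" if g: "g \<in> set gl" and r: "r \<in> set (fc g)" for g r
  proof -
    obtain R S s where gg: "g = (R, S, s)" by (cases g)
    have "r \<in> cells L R" using r last_cell(2)[OF g] by (auto simp: gcells_def gg)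
    moreover have "(g, r) \<in> coord_set" using g r mem_coord_set by blast
    ultimately show ?thesis using cond g unfolding cut_param_def gg by simp
  qed
  have qs: "(\<Sum>r\<in>gcells g. q g r) = 1" "\<And>r. r \<in> gcells g \<Longrightarrow> 0 < q g r" if "g \<in> set gl" for g
    using q(1) that groupD unfolding cond_family_def gcells_def by (cases g; fastforce)+
  \<comment> \<open>On the coordinates both sides agree by \<open>coord\<close>; on the omitted cell
    they agree because both vectors sum to one.\<close>
  have full: "pr ?\<theta> g r = q g r" if g: "g \<in> set gl" and r: "r \<in> gcells g" for g r
    using r qs(1)[OF g, unfolded sum_gcells[OF g]] g
    by (auto simp: gcells_eq full_prob_last full_prob_coord coord)
  show "?\<theta> \<in> \<Theta>"
    unfolding cut_space_def
  proof (intro CollectI conjI ballI)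
    show "?\<theta> \<in> extensional coord_set" unfolding cut_param_def by simp
    fix g assume g: "g \<in> set gl"
    show "0 < ?\<theta> (g, r)" if "r \<in> set (fc g)" for r using that g qs(2)[OF g] by (simp add: coord gcells_eq)
    show "(\<Sum>r\<in>set (fc g). ?\<theta> (g, r)) < 1"
      using qs[OF g] g by (simp add: coord sum_gcells) (smt (verit) gcells_eq insertI1)
  qed
  show "theta_dist ?\<theta> = p"
  proof
    fix x
    show "theta_dist ?\<theta> x = p x"
    proof (cases "x \<in> cells L V")
      case True
      have "factor_prod F (pr ?\<theta>) x = factor_prod F q x"
        by (rule factor_prod_cong[OF _ factors _ True])
          (use verts full group_of_factor in \<open>auto simp: gcells_def\<close>)
      then show ?thesis using q(2)[OF True] True by (simp add: theta_dist_def)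
    next
      case False
      then show ?thesis using p unfolding positive_markov_family_def theta_dist_def by (auto simp: extensional_def)
    qed
  qed
qed

lemma cut_param_theta_dist:
  assumes "\<theta> \<in> \<Theta>"
  shows "cut_param V L gl fc (theta_dist \<theta>) = \<theta>"
proof
  fix c :: "('v, 'a) group \<times> ('v \<Rightarrow> 'a)"
  obtain R S s r where c: "c = ((R, S, s), r)" by (metis surj_pair)
  show "cut_param V L gl fc (theta_dist \<theta>) c = \<theta> c"
  proof (cases "c \<in> coord_set")
    case True
    then have g: "(R, S, s) \<in> set gl" "r \<in> set (fc (R, S, s))" unfolding c using mem_coord_set by blast+
    then have "r \<in> cells L R" using last_cell(2)[OF g(1)] by (auto simp: gcells_def)
    then show ?thesis using True conditional_theta_dist[OF assms g(1)] g(2)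
      unfolding c cut_param_def by (simp add: full_prob_coord)
  next
    case False
    have "\<theta> \<in> extensional coord_set" using assms unfolding cut_space_def by blast
    then have "\<theta> c = undefined" using False by (rule extensional_arb)
    then show ?thesis unfolding cut_param_def restrict_apply if_not_P[OF False] by simp
  qed
qed

lemma bij_cut_param: "bij_betw (cut_param V L gl fc) (positive_markov_family V E L) \<Theta>"
  by (rule bij_betw_byWitness[where f'=theta_dist])
    (use cut_param_family cut_param_theta_dist theta_dist_family in auto)

lemma cut_dist_eq: "\<theta> \<in> \<Theta> \<Longrightarrow> cut_dist V E L gl fc \<theta> = theta_dist \<theta>"
  unfolding cut_dist_def
  using inv_into_f_eq[OF bij_betw_imp_inj_on[OF bij_cut_param]] theta_dist_family cut_param_theta_dist by blast

end

section \<open>Perfect sequences from perfect clique orders\<close>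

lemma complete_in_clique:
  assumes "finite W" "K \<subseteq> W" "complete_in E K"
  obtains C where "C \<in> cliques E W" "K \<subseteq> C"
proof -
  let ?A = "{K'. K' \<subseteq> W \<and> complete_in E K'}"
  have "finite ?A" using assms(1) by simp
  then obtain C where "C \<in> ?A" "K \<subseteq> C" "\<forall>b\<in>?A. C \<subseteq> b \<longrightarrow> C = b"
    using finite_has_maximal2[of ?A K] assms by auto
  then have "C \<in> cliques E W" unfolding cliques_def by blast
  then show ?thesis using that \<open>K \<subseteq> C\<close> by blast
qed

lemma perfect_order_facts:
  assumes "perfect_clique_order E W Cs" "finite W"
  shows "Cs \<noteq> []" "\<Union>(set Cs) = W" "\<And>l. l < length Cs \<Longrightarrow> complete_in E (Cs ! l)"
    "\<And>l. l < length Cs \<Longrightarrow> Cs ! l \<subseteq> W"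
proof -
  have Cs: "set Cs = cliques E W" using assms(1) by (simp add: perfect_clique_order_def)
  obtain C where "C \<in> cliques E W"
    using complete_in_clique[OF assms(2), of "{}" E] by (auto simp: complete_in_def)
  then show "Cs \<noteq> []" using Cs by auto
  show "\<Union>(set Cs) = W"
  proof
    show "W \<subseteq> \<Union>(set Cs)"
    proof
      fix x assume "x \<in> W"
      then show "x \<in> \<Union>(set Cs)"
        using complete_in_clique[OF assms(2), of "{x}" E] Cs by (auto simp: complete_in_def)
    qed
  qed (auto simp: Cs cliques_def)
  show "complete_in E (Cs ! l)" "Cs ! l \<subseteq> W" if "l < length Cs" for l
    using nth_mem[OF that] unfolding Cs by (auto simp: cliques_def)
qed

lemma mem_Union_take: "v \<in> \<Union>(set (take l Cs)) \<longleftrightarrow> (\<exists>i<l. i < length Cs \<and> v \<in> Cs ! i)"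
proof -
  have "set (take l Cs) = (!) Cs ` {0..<min l (length Cs)}"
    using nth_image[of l Cs] nth_image[of "length Cs" Cs] by (cases "l \<le> length Cs") simp_all
  then show ?thesis by auto
qed

text \<open>An edge from a residual to an earlier vertex lies in some clique; the first clique at or after
  position \<open>l\<close> that contains it cannot come strictly after, because its separator would lie in an
  earlier clique.\<close>

lemma residual_edge:
  assumes "perfect_clique_order E W Cs" "finite W" "l < length Cs"
    and u: "u \<in> residual Cs l" and v: "v \<in> \<Union>(set (take l Cs))" and e: "{u, v} \<in> E"
  shows "v \<in> separator Cs l"
proof (rule ccontr)
  assume "v \<notin> separator Cs l"
  then have vl: "v \<notin> Cs ! l" using v unfolding separator_def by blast
  have ul: "u \<in> Cs ! l" "u \<notin> \<Union>(set (take l Cs))" using u by (auto simp: residual_def separator_def)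
  note facts = perfect_order_facts[OF assms(1,2)]
  have W: "u \<in> W" "v \<in> W"
    using facts(2) ul(1) nth_mem[OF assms(3)] v by (auto dest: in_set_takeD)
  have "complete_in E {u, v}" using e by (auto simp: complete_in_def insert_commute)
  then obtain C where C: "C \<in> cliques E W" "{u, v} \<subseteq> C"
    using complete_in_clique[OF assms(2), of "{u, v}" E] W by blast
  then have "\<exists>m<length Cs. {u, v} \<subseteq> Cs ! m"
    using assms(1) unfolding perfect_clique_order_def by (metis in_set_conv_nth)
  then obtain m where m: "m < length Cs" "{u, v} \<subseteq> Cs ! m"
    and least: "\<And>i. i < m \<Longrightarrow> \<not> (i < length Cs \<and> {u, v} \<subseteq> Cs ! i)"
    using exists_least_iff[of "\<lambda>m. m < length Cs \<and> {u, v} \<subseteq> Cs ! m"] by blast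
  have "l \<le> m" using ul(2) m unfolding mem_Union_take by (metis insert_subset not_le)
  moreover have "l \<noteq> m" using vl m by auto
  ultimately have lm: "l < m" by simp
  have "u \<in> \<Union>(set (take m Cs))" "v \<in> \<Union>(set (take m Cs))"
    using lm ul(1) v assms(3) unfolding mem_Union_take by (auto intro: less_trans)
  then have "{u, v} \<subseteq> separator Cs m" using m(2) by (auto simp: separator_def)
  moreover obtain i where "i < m" "separator Cs m \<subseteq> Cs ! i"
    using assms(1) m(1) lm unfolding perfect_clique_order_def by (metis gr_implies_not0 neq0_conv)
  ultimately show False using least[of i] m(1) by auto
qed

lemma residual_Un_separator: "residual Cs l \<union> separator Cs l = Cs ! l"
  by (auto simp: residual_def separator_def)

lemma residual_disjoint: "residual Cs l \<inter> \<Union>(set (take l Cs)) = {}"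
  by (auto simp: residual_def separator_def)

lemma Union_take_Suc: "l < length Cs \<Longrightarrow> \<Union>(set (take (Suc l) Cs)) = \<Union>(set (take l Cs)) \<union> Cs ! l"
  by (auto simp: take_Suc_conv_app_nth)

text \<open>Every prefix of the order yields a perfect sequence on its union. The first clique is no
  special case, since its separator is empty and its residual is the whole clique.\<close>

lemma perfect_factors_marginal:
  assumes "perfect_clique_order E W Cs" "finite W"
  shows "perfect_factors E (marginal_factors Cs)" "verts (marginal_factors Cs) = W"
proof -
  have "perfect_factors E {(residual Cs l, separator Cs l) | l. l < k} \<and>
      verts {(residual Cs l, separator Cs l) | l. l < k} = \<Union>(set (take k Cs))" if "k \<le> length Cs" for k
    using that
  proof (induction k)
    case 0
    then show ?case by (simp add: perfect_factors.empty)
  next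
    case (Suc k)
    let ?F = "{(residual Cs l, separator Cs l) | l. l < k}"
    have k: "k < length Cs" using Suc by simp
    have F: "{(residual Cs l, separator Cs l) | l. l < Suc k} = insert (residual Cs k, separator Cs k) ?F"
      by (auto simp: less_Suc_eq)
    have IH: "perfect_factors E ?F" "verts ?F = \<Union>(set (take k Cs))" using Suc by auto
    have "perfect_factors E (insert (residual Cs k, separator Cs k) ?F)"
    proof (rule perfect_factors.insert[OF IH(1)])
      show "finite (residual Cs k)"
        using perfect_order_facts(4)[OF assms k] assms(2) unfolding residual_def by (meson finite_Diff finite_subset)
      show "complete_in E (residual Cs k \<union> separator Cs k)"
        unfolding residual_Un_separator by (rule perfect_order_facts(3)[OF assms k])
      show "v \<in> separator Cs k" if "u \<in> residual Cs k" "v \<in> verts ?F" "{u, v} \<in> E" for u v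
        by (rule residual_edge[OF assms k that(1) that(2)[unfolded IH(2)] that(3)])
    qed (unfold IH(2), rule residual_disjoint, auto simp: separator_def)
    moreover have "verts (insert (residual Cs k, separator Cs k) ?F) = \<Union>(set (take (Suc k) Cs))"
      unfolding Union_take_Suc[OF k] using IH(2) by (auto simp: residual_def separator_def)
    ultimately show ?case unfolding F by blast
  qed
  from this[of "length Cs"] show "perfect_factors E (marginal_factors Cs)" "verts (marginal_factors Cs) = W"
    unfolding marginal_factors_def perfect_order_facts(2)[OF assms, symmetric] by simp_all
qed

text \<open>The boundary \<open>D\<close> is already covered by \<open>F0\<close> and contained in
  the first clique, so that clique attaches with separator \<open>D\<close>. From then on the
  separators computed inside \<open>B \<union> D\<close> are also the right ones relative to
  \<open>F0\<close>, because vertices of \<open>B\<close> have no neighbours in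
  \<open>verts F0\<close> outside \<open>D\<close>.\<close>

lemma perfect_factors_component:
  assumes F0: "perfect_factors E F0" and B: "finite B" "B \<inter> verts F0 = {}" and D: "D = boundary V E B" "D \<subseteq> verts F0"
    and nb: "\<And>u v. u \<in> B \<Longrightarrow> v \<in> verts F0 \<Longrightarrow> {u, v} \<in> E \<Longrightarrow> v \<in> D"
    and Cs: "perfect_clique_order E (B \<union> D) Cs" "D \<subseteq> Cs ! 0"
  shows "perfect_factors E (F0 \<union> component_factors V E B Cs)" "verts (F0 \<union> component_factors V E B Cs) = verts F0 \<union> B"
proof -
  have finD: "finite D" using perfect_factorsD(2)[OF F0] D(2) by (rule finite_subset[rotated])
  then have fin: "finite (B \<union> D)" using B by simp
  note facts = perfect_order_facts[OF Cs(1) fin]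
  define Fk where "Fk k = F0 \<union> insert (Cs ! 0 - D, D) {(residual Cs j, separator Cs j) | j. 0 < j \<and> j < k}" for k
  have "perfect_factors E (Fk k) \<and> verts (Fk k) = verts F0 \<union> \<Union>(set (take k Cs))"
    if "0 < k" "k \<le> length Cs" for k
    using that
  proof (induction k rule: nat_induct_non_zero)
    case 1
    then have l: "0 < length Cs" by (cases Cs) auto
    have F1: "Fk 1 = insert (Cs ! 0 - D, D) F0" unfolding Fk_def by auto
    have sub: "Cs ! 0 \<subseteq> B \<union> D" using facts(4)[OF l] .
    have "perfect_factors E (insert (Cs ! 0 - D, D) F0)"
    proof (rule perfect_factors.insert[OF F0])
      show "finite (Cs ! 0 - D)" using sub fin by (meson finite_Diff finite_subset)
      show "(Cs ! 0 - D) \<inter> verts F0 = {}" using sub B(2) by auto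
      have "Cs ! 0 - D \<union> D = Cs ! 0" using Cs(2) by auto
      then show "complete_in E (Cs ! 0 - D \<union> D)" using facts(3)[OF l] by simp
      show "v \<in> D" if "u \<in> Cs ! 0 - D" "v \<in> verts F0" "{u, v} \<in> E" for u v
        using nb[of u v] that sub by auto
    qed (rule D(2))
    moreover have "\<Union>(set (take 1 Cs)) = Cs ! 0" using l by (simp add: take_Suc_conv_app_nth)
    ultimately show ?case unfolding F1 using Cs(2) D(2) by auto
  next
    case (Suc k)
    then have k: "k < length Cs" and IH: "perfect_factors E (Fk k)" "verts (Fk k) = verts F0 \<union> \<Union>(set (take k Cs))"
      by auto
    have F: "Fk (Suc k) = insert (residual Cs k, separator Cs k) (Fk k)"
      unfolding Fk_def using Suc.hyps by (auto simp: less_Suc_eq)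
    have "Cs ! 0 \<in> set (take k Cs)" using Suc.hyps k by (cases Cs; cases k) auto
    \<comment> \<open>Once the first clique is present, the boundary belongs to the covered part, so
      all later residuals consist of vertices of \<open>B\<close>.\<close>
    then have D0: "D \<subseteq> \<Union>(set (take k Cs))" using Cs(2) by blast
    have RB: "residual Cs k \<subseteq> B" using facts(4)[OF k] D0 by (auto simp: residual_def separator_def)
    have "perfect_factors E (insert (residual Cs k, separator Cs k) (Fk k))"
    proof (rule perfect_factors.insert[OF IH(1)])
      show "finite (residual Cs k)" using RB B(1) by (rule finite_subset)
      show "residual Cs k \<inter> verts (Fk k) = {}" unfolding IH(2) using RB B(2) residual_disjoint[of Cs k] by blast
      show "separator Cs k \<subseteq> verts (Fk k)" unfolding IH(2) by (auto simp: separator_def)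
      show "complete_in E (residual Cs k \<union> separator Cs k)"
        unfolding residual_Un_separator by (rule facts(3)[OF k])
      show "v \<in> separator Cs k" if "u \<in> residual Cs k" "v \<in> verts (Fk k)" "{u, v} \<in> E" for u v
      proof (rule residual_edge[OF Cs(1) fin k that(1) _ that(3)])
        show "v \<in> \<Union>(set (take k Cs))" using that nb[of u v] RB D0 unfolding IH(2) by auto
      qed
    qed
    moreover have "verts (insert (residual Cs k, separator Cs k) (Fk k)) = verts F0 \<union> \<Union>(set (take (Suc k) Cs))"
      unfolding Union_take_Suc[OF k] using IH(2) by (auto simp: residual_def separator_def)
    ultimately show ?case unfolding F by blast
  qed
  from this[of "length Cs"] have res: "perfect_factors E (Fk (length Cs))"
    "verts (Fk (length Cs)) = verts F0 \<union> (B \<union> D)"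
    using facts(1,2) by simp_all
  have "Fk (length Cs) = F0 \<union> component_factors V E B Cs"
    unfolding Fk_def component_factors_def D(1) ..
  then show "perfect_factors E (F0 \<union> component_factors V E B Cs)"
    "verts (F0 \<union> component_factors V E B Cs) = verts F0 \<union> B"
    using res D(2) by auto
qed

lemma component_facts:
  assumes "B \<in> graph_components E W"
  shows "B \<subseteq> W" "\<And>u v. u \<in> B \<Longrightarrow> v \<in> W \<Longrightarrow> {u, v} \<in> E \<Longrightarrow> v \<in> B"
    "\<And>B'. B' \<in> graph_components E W \<Longrightarrow> B \<noteq> B' \<Longrightarrow> B \<inter> B' = {}"
proof -
  define r where "r = {(u, v). u \<in> W \<and> v \<in> W \<and> {u, v} \<in> E}"
  have comp: "\<exists>x\<in>W. B = r\<^sup>* `` {x}" if "B \<in> graph_components E W" for B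
    using that unfolding graph_components_def r_def by (auto elim!: quotientE)
  have sym: "sym (r\<^sup>*)" by (intro sym_rtrancl symI) (auto simp: r_def insert_commute)
  obtain x where x: "x \<in> W" "B = r\<^sup>* `` {x}" using comp[OF assms] by blast
  have "y \<in> W" if "(x, y) \<in> r\<^sup>*" for y using that x(1) by (induction) (auto simp: r_def)
  then show BW: "B \<subseteq> W" using x by auto
  show "v \<in> B" if "u \<in> B" "v \<in> W" "{u, v} \<in> E" for u v
  proof -
    have "(u, v) \<in> r" using that BW by (auto simp: r_def)
    then show ?thesis using that(1) unfolding x(2) by (auto intro: rtrancl_into_rtrancl)
  qed
  show "B \<inter> B' = {}" if B': "B' \<in> graph_components E W" and ne: "B \<noteq> B'" for B'
  proof (rule ccontr)
    assume "B \<inter> B' \<noteq> {}"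
    then obtain z where z: "z \<in> B" "z \<in> B'" by auto
    obtain x' where x': "B' = r\<^sup>* `` {x'}" using comp[OF B'] by blast
    have "(x, z) \<in> r\<^sup>*" "(x', z) \<in> r\<^sup>*" using z x(2) x' by auto
    then have "(x, x') \<in> r\<^sup>*" "(x', x) \<in> r\<^sup>*" using sym by (meson symD rtrancl_trans)+
    then have "B = B'" unfolding x(2) x' by (auto intro: rtrancl_trans)
    then show False using ne by simp
  qed
qed

lemma Union_graph_components: "\<Union>(graph_components E W) = W"
proof
  show "W \<subseteq> \<Union>(graph_components E W)"
    unfolding graph_components_def by (auto simp: quotient_def)
qed (use component_facts(1) in blast)

lemma finite_graph_components: "finite W \<Longrightarrow> finite (graph_components E W)"
  unfolding graph_components_def quotient_def by auto

text \<open>A neighbour lying outside \<open>A\<close> would belong to the same component.\<close>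

lemma boundary_component:
  assumes "A \<subseteq> V" "B \<in> graph_components E (V - A)"
  shows "boundary V E B \<subseteq> A"
  using component_facts(2)[OF assms(2)] unfolding boundary_def by blast

text \<open>The components are attached in any order: since two of them are never adjacent, the
  earlier neighbours of a component all lie in its boundary, hence in \<open>A\<close>.\<close>

lemma perfect_factors_cut:
  assumes "finite V" "A \<subseteq> V" and CA: "perfect_clique_order E A CA"
    and CB: "\<And>B. B \<in> graph_components E (V - A) \<Longrightarrow>
      perfect_clique_order E (B \<union> boundary V E B) (CB B) \<and> boundary V E B \<subseteq> CB B ! 0"
  defines "F \<equiv> marginal_factors CA \<union> (\<Union>B\<in>graph_components E (V - A). component_factors V E B (CB B))"
  shows "perfect_factors E F" "verts F = V"
proof -
  have finA: "finite A" using assms(1,2) by (rule finite_subset[rotated])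
  let ?F = "\<lambda>\<B>. marginal_factors CA \<union> (\<Union>B\<in>\<B>. component_factors V E B (CB B))"
  have "perfect_factors E (?F \<B>) \<and> verts (?F \<B>) = A \<union> \<Union>\<B>" if "finite \<B>" "\<B> \<subseteq> graph_components E (V - A)" for \<B>
    using that
  proof (induction \<B> rule: finite_induct)
    case empty
    then show ?case using perfect_factors_marginal[OF CA finA] by simp
  next
    case (insert B \<B>)
    then have B: "B \<in> graph_components E (V - A)" and IH: "perfect_factors E (?F \<B>)" "verts (?F \<B>) = A \<union> \<Union>\<B>"
      by auto
    note c = component_facts[OF B]
    have dis: "B \<inter> \<Union>\<B> = {}" using c(3) insert by blast
    have sub: "A \<union> \<Union>\<B> \<subseteq> V" using assms(2) insert.prems component_facts(1) by blast
    have FB: "?F (insert B \<B>) = ?F \<B> \<union> component_factors V E B (CB B)" by auto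
    have *: "finite B" "B \<inter> verts (?F \<B>) = {}" "boundary V E B \<subseteq> verts (?F \<B>)"
      "\<And>u v. u \<in> B \<Longrightarrow> v \<in> verts (?F \<B>) \<Longrightarrow> {u, v} \<in> E \<Longrightarrow> v \<in> boundary V E B"
    proof -
      show "finite B" using c(1) assms(1) by (meson finite_Diff finite_subset)
      show "B \<inter> verts (?F \<B>) = {}" unfolding IH(2) using dis c(1) by auto
      show "boundary V E B \<subseteq> verts (?F \<B>)" unfolding IH(2) using boundary_component[OF assms(2) B] by auto
      fix u v assume "u \<in> B" "v \<in> verts (?F \<B>)" "{u, v} \<in> E"
      then show "v \<in> boundary V E B" unfolding IH(2) boundary_def using dis c(1) sub by auto
    qed
    show ?case
      using perfect_factors_component[OF IH(1) *(1,2) refl *(3,4), where Cs="CB B"] CB[OF B]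
      unfolding FB IH(2) by auto
  qed
  from this[OF finite_graph_components order_refl] show "perfect_factors E F" "verts F = V"
    unfolding F_def using assms(1,2) by (auto simp: Union_graph_components)
qed

section \<open>Inverses and determinants of block matrices\<close>

lemma sum_lessThan_upto:
  fixes f :: "nat \<Rightarrow> real"
  assumes "m < n" "\<And>k. m < k \<Longrightarrow> f k = 0"
  shows "(\<Sum>k\<in>{0..<n}. f k) = (\<Sum>k<m. f k) + f m"
proof -
  have "(\<Sum>k\<in>{0..<n}. f k) = (\<Sum>k\<in>{..m}. f k)"
    using assms by (intro sum.mono_neutral_right) auto
  then show ?thesis by (simp add: lessThan_Suc_atMost[symmetric])
qed

text \<open>Gaussian elimination in closed form. After \<open>k\<close> steps the constant
  \<open>c\<close> has shrunk to \<open>c / s k\<close>, the next pivot is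
  \<open>x k + c / s k = x k * s (Suc k) / s k\<close>, and \<open>W\<close> holds the multipliers.
  The value is the rank-one update formula for determinants.\<close>

lemma det_diagonal_plus_constant:
  fixes x :: "nat \<Rightarrow> real" and c :: real
  assumes x: "\<And>i. i < n \<Longrightarrow> 0 < x i" and c: "0 < c"
  shows "Determinant.det (Matrix.mat n n (\<lambda>(i, j). (if i = j then x i else 0) + c)) =
    (\<Prod>i<n. x i) * (1 + c * (\<Sum>i<n. 1 / x i))"
proof -
  define s where "s k = 1 + c * (\<Sum>i<k. 1 / x i)" for k
  have s0: "s 0 = 1" by (simp add: s_def)
  have sS: "s (Suc k) = s k + c / x k" for k by (simp add: s_def algebra_simps)
  have spos: "0 < s k" if "k \<le> n" for k
  proof -
    have "0 \<le> (\<Sum>i<k. 1 / x i)" using x that by (intro sum_nonneg) (auto intro: less_imp_le)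
    then show ?thesis unfolding s_def using c by (simp add: add_pos_nonneg)
  qed
  define U where "U = Matrix.mat n n (\<lambda>(i, j). if i = j then x i * s (Suc i) / s i else if i < j then c / s i else 0)"
  define W where "W = Matrix.mat n n (\<lambda>(i, j). if i = j then 1 else if j < i then c / (x j * s (Suc j)) else 0)"
  \<comment> \<open>Each summand equals \<open>c / s k - c / s (Suc k)\<close>, because consecutive
    \<open>s\<close> differ by \<open>c / x k\<close>.\<close>
  have tele: "(\<Sum>k<m. c / (x k * s (Suc k)) * (c / s k)) = c - c / s m" if "m \<le> n" for m
    using that
  proof (induction m)
    case (Suc m)
    have p: "0 < s m" "0 < s (Suc m)" "0 < x m" using spos x Suc.prems by auto
    have "c / s m - c / s (Suc m) = c * (s (Suc m) - s m) / (s m * s (Suc m))"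
      using p by (simp add: field_simps)
    then have "c / (x m * s (Suc m)) * (c / s m) = c / s m - c / s (Suc m)"
      by (simp add: sS)
    then show ?case using Suc by simp
  qed (simp add: s0)
  have diag: "x i * s (Suc i) / s i = x i + c / s i" if "i < n" for i
    using spos[of i] x[OF that] that unfolding sS by (simp add: field_simps)
  have WU: "W * U = Matrix.mat n n (\<lambda>(i, j). (if i = j then x i else 0) + c)"
  proof (rule eq_matI)
    fix i j assume "i < dim_row (Matrix.mat n n (\<lambda>(i, j). (if i = j then x i else 0) + c))"
      "j < dim_col (Matrix.mat n n (\<lambda>(i, j). (if i = j then x i else 0) + c))"
    then have ij: "i < n" "j < n" by simp_all
    let ?w = "\<lambda>k. if i = k then 1 else if k < i then c / (x k * s (Suc k)) else 0"
    let ?u = "\<lambda>k. if k = j then x k * s (Suc k) / s k else if k < j then c / s k else 0"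
    have "(W * U) $$ (i, j) = (\<Sum>k\<in>{0..<n}. ?w k * ?u k)"
      unfolding W_def U_def using ij by (simp add: scalar_prod_def)
    also have "\<dots> = (\<Sum>k<min i j. ?w k * ?u k) + ?w (min i j) * ?u (min i j)"
      using ij by (intro sum_lessThan_upto) auto
    also have "(\<Sum>k<min i j. ?w k * ?u k) = (\<Sum>k<min i j. c / (x k * s (Suc k)) * (c / s k))"
      by (intro sum.cong refl) auto
    also have "\<dots> = c - c / s (min i j)" using ij by (intro tele) auto
    also have "?w (min i j) * ?u (min i j) = (if i = j then x i else 0) + c / s (min i j)"
    proof -
      consider "i = j" | "i < j" | "j < i" by linarith
      then show ?thesis
      proof cases
        case 3
        then have "0 < x j" "0 < s (Suc j)" using x ij spos by auto
        then show ?thesis using 3 by (simp add: min_def)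
      qed (use ij diag in \<open>simp_all add: min_def\<close>)
    qed
    finally show "(W * U) $$ (i, j) = Matrix.mat n n (\<lambda>(i, j). (if i = j then x i else 0) + c) $$ (i, j)"
      using ij by simp
  qed (simp_all add: W_def U_def)
  have carr: "W \<in> carrier_mat n n" "U \<in> carrier_mat n n" by (simp_all add: W_def U_def)
  have "Determinant.det W = prod_list (diag_mat W)"
    by (rule det_lower_triangular[OF _ carr(1)]) (simp add: W_def)
  then have dW: "Determinant.det W = 1" unfolding prod_list_diag_prod by (simp add: W_def)
  have "upper_triangular U" by (rule upper_triangularI) (simp add: U_def)
  then have "Determinant.det U = prod_list (diag_mat U)" using carr(2) by (rule det_upper_triangular)
  also have "\<dots> = (\<Prod>i\<in>{0..<n}. x i * s (Suc i) / s i)" unfolding prod_list_diag_prod by (simp add: U_def)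
  also have "\<dots> = (\<Prod>i<n. x i * s (Suc i) / s i)" by (simp add: atLeast0LessThan)
  \<comment> \<open>The quotients of consecutive \<open>s\<close> telescope as the splitting point
    \<open>m\<close> moves up; at \<open>m = n\<close> only \<open>s n\<close> remains, as
    \<open>s 0 = 1\<close>.\<close>
  also have "\<dots> = (\<Prod>i<m. x i) * s m * (\<Prod>i\<in>{m..<n}. x i * s (Suc i) / s i)" if "m \<le> n" for m
    using that
  proof (induction m)
    case (Suc m)
    have "(\<Prod>i\<in>{m..<n}. x i * s (Suc i) / s i) = x m * s (Suc m) / s m * (\<Prod>i\<in>{Suc m..<n}. x i * s (Suc i) / s i)"
      using Suc.prems by (simp add: prod.atLeast_Suc_lessThan)
    then show ?case using Suc spos[of m] by simp
  qed (simp add: s0 atLeast0LessThan)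
  from this[of n] have dU: "Determinant.det U = (\<Prod>i<n. x i) * s n"
    using calculation by simp
  show ?thesis unfolding WU[symmetric] det_mult[OF carr] dW dU s_def by simp
qed

text \<open>\<open>inverse_mat\<close> unwraps an option. A two-sided inverse makes the matrix a
  unit, so the option is not \<open>None\<close>, and inverses are unique.\<close>

lemma inverse_mat_eq:
  assumes A: "A \<in> carrier_mat n n" and B: "B \<in> carrier_mat n n" and AB: "A * B = 1\<^sub>m n" "B * A = 1\<^sub>m n"
  shows "inverse_mat A = B" "invertible_mat A"
proof -
  have "A \<in> Units (ring_mat TYPE(real) n ())"
    unfolding Units_def using A B AB by (auto simp: ring_mat_def)
  then obtain C where "mat_inverse A = Some C" using mat_inverse(1)[OF A, of "()"] by fastforce
  from mat_inverse(2)[OF A this] have C: "C * A = 1\<^sub>m n" "C \<in> carrier_mat n n" by auto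
  have "C = C * (A * B)" using C AB by simp
  also have "\<dots> = (C * A) * B" by (rule assoc_mult_mat[OF C(2) A B, symmetric])
  also have "\<dots> = B" using C(1) B by simp
  finally show "inverse_mat A = B" unfolding inverse_mat_def \<open>mat_inverse A = Some C\<close> by simp
  show "invertible_mat A"
    unfolding invertible_mat_def inverts_mat_def using A B AB by auto
qed

text \<open>Entries are indexed by coordinates rather than positions, which turns matrix products
  into sums over sets of coordinates and block structure into a condition on pairs of
  coordinates.\<close>

definition entry_mat :: "'c list \<Rightarrow> ('c \<Rightarrow> 'c \<Rightarrow> real) \<Rightarrow> real mat" where
  "entry_mat cs g = Matrix.mat (length cs) (length cs) (\<lambda>(a, b). g (cs ! a) (cs ! b))"

lemma entry_mat_carrier: "entry_mat cs g \<in> carrier_mat (length cs) (length cs)"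
  by (simp add: entry_mat_def)

lemma entry_mat_times:
  assumes "distinct cs" "\<And>c c'. c \<in> set cs \<Longrightarrow> c' \<in> set cs \<Longrightarrow> (\<Sum>e\<in>set cs. g c e * h e c') = of_bool (c = c')"
  shows "entry_mat cs g * entry_mat cs h = 1\<^sub>m (length cs)"
proof (rule eq_matI)
  fix i j assume "i < dim_row (1\<^sub>m (length cs) :: real mat)" "j < dim_col (1\<^sub>m (length cs) :: real mat)"
  then have ij: "i < length cs" "j < length cs" by simp_all
  have "(entry_mat cs g * entry_mat cs h) $$ (i, j) = (\<Sum>k\<in>{0..<length cs}. g (cs ! i) (cs ! k) * h (cs ! k) (cs ! j))"
    unfolding entry_mat_def using ij by (simp add: scalar_prod_def)
  also have "\<dots> = (\<Sum>e\<in>set cs. g (cs ! i) e * h e (cs ! j))"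
    by (rule sum.reindex_bij_betw[of "(!) cs"], rule bij_betw_nth) (use assms(1) in auto)
  also have "\<dots> = of_bool (cs ! i = cs ! j)" using assms(2) ij by simp
  finally show "(entry_mat cs g * entry_mat cs h) $$ (i, j) = 1\<^sub>m (length cs) $$ (i, j)"
    using ij assms(1) by (simp add: nth_eq_iff_index_eq)
qed (simp_all add: entry_mat_def)

lemma leading_block_entry_mat:
  "leading_block (length cs) (entry_mat (cs @ ds) g) = entry_mat cs g"
  unfolding leading_block_def entry_mat_def by (rule eq_matI) (auto simp: nth_append)

text \<open>\<open>g\<close> and \<open>h\<close> are entries of two block diagonal matrices that
  are inverse to each other block by block. Later \<open>g\<close> is the Fisher information and
  \<open>h\<close> its inverse.\<close>

locale block_inverse =
  fixes gs :: "'c list list" and g h :: "'c \<Rightarrow> 'c \<Rightarrow> real"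
  assumes distinct: "distinct (concat gs)"
    and off: "\<And>i j c c'. i < length gs \<Longrightarrow> j < length gs \<Longrightarrow> i \<noteq> j \<Longrightarrow> c \<in> set (gs ! i) \<Longrightarrow> c' \<in> set (gs ! j) \<Longrightarrow>
      g c c' = 0 \<and> h c c' = 0"
    and inv: "\<And>j c c'. j < length gs \<Longrightarrow> c \<in> set (gs ! j) \<Longrightarrow> c' \<in> set (gs ! j) \<Longrightarrow>
      (\<Sum>e\<in>set (gs ! j). g c e * h e c') = of_bool (c = c') \<and> (\<Sum>e\<in>set (gs ! j). h c e * g e c') = of_bool (c = c')"
begin

lemma blocks_disjoint: "i < length gs \<Longrightarrow> j < length gs \<Longrightarrow> i \<noteq> j \<Longrightarrow> set (gs ! i) \<inter> set (gs ! j) = {}"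
proof (induction i j rule: linorder_wlog)
  case (le i j)
  have "gs = take (Suc i) gs @ drop (Suc i) gs" by simp
  then have "distinct (concat (take (Suc i) gs) @ concat (drop (Suc i) gs))"
    using distinct by (metis concat_append)
  then have "set (concat (take (Suc i) gs)) \<inter> set (concat (drop (Suc i) gs)) = {}" by simp
  moreover have "set (gs ! i) \<subseteq> set (concat (take (Suc i) gs))" using le by (auto simp: take_Suc_conv_app_nth)
  moreover have "gs ! j \<in> set (drop (Suc i) gs)"
    using le in_set_conv_nth[of "gs ! j" "drop (Suc i) gs"] by (auto intro!: exI[of _ "j - Suc i"])
  ultimately show ?case by auto
qed auto

lemma sum_blocks:
  assumes "m \<le> length gs" "c \<in> set (concat (take m gs))" "c' \<in> set (concat (take m gs))"
  shows "(\<Sum>e\<in>set (concat (take m gs)). g c e * h e c') = of_bool (c = c')"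
    "(\<Sum>e\<in>set (concat (take m gs)). h c e * g e c') = of_bool (c = c')"
proof -
  have mem: "\<exists>i<m. c \<in> set (gs ! i)" if "c \<in> set (concat (take m gs))" for c
  proof -
    obtain ys where ys: "ys \<in> set (take m gs)" "c \<in> set ys" using \<open>c \<in> set (concat (take m gs))\<close> by auto
    then obtain i where "i < length (take m gs)" "take m gs ! i = ys" by (metis in_set_conv_nth)
    then show ?thesis using ys(2) by (intro exI[of _ i]) auto
  qed
  obtain i j where i: "i < m" "c \<in> set (gs ! i)" and j: "j < m" "c' \<in> set (gs ! j)"
    using mem assms(2,3) by metis
  have gi: "set (gs ! i) \<subseteq> set (concat (take m gs))"
    using i assms(1) by (auto simp: in_set_conv_nth intro!: bexI[of _ "gs ! i"] exI[of _ i])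
  have z: "g c e = 0" "h c e = 0" if e: "e \<in> set (concat (take m gs)) - set (gs ! i)" for e
  proof -
    obtain k where "k < m" "e \<in> set (gs ! k)" using mem[of e] e by blast
    then show "g c e = 0" "h c e = 0" using off[of i k c e] i e assms(1) by auto
  qed
  have red: "(\<Sum>e\<in>set (concat (take m gs)). g c e * h e c') = (\<Sum>e\<in>set (gs ! i). g c e * h e c')"
    "(\<Sum>e\<in>set (concat (take m gs)). h c e * g e c') = (\<Sum>e\<in>set (gs ! i). h c e * g e c')"
    by (intro sum.mono_neutral_right gi ballI; simp add: z)+
  have "(\<Sum>e\<in>set (gs ! i). g c e * h e c') = of_bool (c = c') \<and> (\<Sum>e\<in>set (gs ! i). h c e * g e c') = of_bool (c = c')"
  proof (cases "i = j")
    case True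
    then show ?thesis using inv[of i c c'] i j assms(1) by auto
  next
    case False
    then have "c \<noteq> c'" using blocks_disjoint[of i j] i j assms(1) by auto
    then show ?thesis using off[OF _ _ False] i j assms(1) by auto
  qed
  then show "(\<Sum>e\<in>set (concat (take m gs)). g c e * h e c') = of_bool (c = c')"
    "(\<Sum>e\<in>set (concat (take m gs)). h c e * g e c') = of_bool (c = c')"
    unfolding red by auto
qed

lemma distinct_take: "distinct (concat (take m gs))"
  using distinct by (metis append_take_drop_id concat_append distinct_append)

lemma entry_mat_inverses:
  assumes "m \<le> length gs"
  shows "inverse_mat (entry_mat (concat (take m gs)) g) = entry_mat (concat (take m gs)) h"
    "inverse_mat (entry_mat (concat (take m gs)) h) = entry_mat (concat (take m gs)) g"
    "invertible_mat (entry_mat (concat (take m gs)) g)" "invertible_mat (entry_mat (concat (take m gs)) h)"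
proof -
  have "entry_mat (concat (take m gs)) g * entry_mat (concat (take m gs)) h = 1\<^sub>m (length (concat (take m gs)))"
    "entry_mat (concat (take m gs)) h * entry_mat (concat (take m gs)) g = 1\<^sub>m (length (concat (take m gs)))"
    using entry_mat_times[OF distinct_take] sum_blocks[OF assms] by blast+
  then show "inverse_mat (entry_mat (concat (take m gs)) g) = entry_mat (concat (take m gs)) h"
    "inverse_mat (entry_mat (concat (take m gs)) h) = entry_mat (concat (take m gs)) g"
    "invertible_mat (entry_mat (concat (take m gs)) g)" "invertible_mat (entry_mat (concat (take m gs)) h)"
    using inverse_mat_eq entry_mat_carrier by blast+
qed

text \<open>For a block diagonal matrix, inversion commutes with passing to the leading groups.
  Inverting, cutting and inverting again therefore restores the information of the first groups, and
  its last block is the information block of group \<open>j\<close>.\<close>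

lemma h_block_eq:
  assumes fi: "fisher_info f X (concat gs) \<theta> = entry_mat (concat gs) g" and j: "j < length gs"
  shows "Sigma_block f X gs j \<theta> = entry_mat (concat (take (Suc j) gs)) h"
    "h_block f X gs j \<theta> = entry_mat (gs ! j) g"
proof -
  have "inverse_mat (entry_mat (concat gs) g) = entry_mat (concat (take (Suc j) gs) @ concat (drop (Suc j) gs)) h"
    using entry_mat_inverses(1)[OF order_refl] by (simp flip: concat_append)
  then show S: "Sigma_block f X gs j \<theta> = entry_mat (concat (take (Suc j) gs)) h"
    unfolding Sigma_block_def fi dims_upto_def by (simp only: leading_block_entry_mat)
  have tk: "concat (take (Suc j) gs) = concat (take j gs) @ gs ! j" using j by (simp add: take_Suc_conv_app_nth)
  have "inverse_mat (Sigma_block f X gs j \<theta>) = entry_mat (concat (take j gs) @ gs ! j) g"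
    unfolding S using entry_mat_inverses(2)[of "Suc j"] j unfolding tk by simp
  then show "h_block f X gs j \<theta> = entry_mat (gs ! j) g"
    unfolding h_block_def Let_def dims_upto_def by (intro eq_matI) (auto simp: entry_mat_def nth_append)
qed

end

text \<open>The block is a diagonal matrix plus the constant \<open>\<kappa> / q0\<close>. The
  correction factor of the rank-one formula is one plus the sum of the \<open>q c\<close> over
  \<open>q0\<close>, which equals \<open>1 / q0\<close> as all cells sum to one.\<close>

lemma det_multinomial_block:
  assumes "distinct cs" and \<kappa>: "0 < \<kappa>" and q: "\<And>c. c \<in> set cs \<Longrightarrow> 0 < q c" "0 < q0" "q0 + (\<Sum>c\<in>set cs. q c) = 1"
  shows "Determinant.det (entry_mat cs (\<lambda>c c'. \<kappa> * (of_bool (c = c') / q c + 1 / q0))) =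
    \<kappa> ^ length cs * ((\<Prod>c\<in>set cs. 1 / q c) * (1 / q0))"
proof -
  have bij: "bij_betw ((!) cs) {..<length cs} (set cs)" by (rule bij_betw_nth) (use assms(1) in auto)
  have "entry_mat cs (\<lambda>c c'. \<kappa> * (of_bool (c = c') / q c + 1 / q0)) =
     Matrix.mat (length cs) (length cs) (\<lambda>(i, j). (if i = j then \<kappa> / q (cs ! i) else 0) + \<kappa> / q0)"
    unfolding entry_mat_def using assms(1)
    by (intro eq_matI) (auto simp: nth_eq_iff_index_eq distrib_left)
  then have "Determinant.det (entry_mat cs (\<lambda>c c'. \<kappa> * (of_bool (c = c') / q c + 1 / q0))) =
     (\<Prod>i<length cs. \<kappa> / q (cs ! i)) * (1 + \<kappa> / q0 * (\<Sum>i<length cs. 1 / (\<kappa> / q (cs ! i))))"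
    using \<kappa> q by (simp only:) (intro det_diagonal_plus_constant, auto)
  also have "(\<Prod>i<length cs. \<kappa> / q (cs ! i)) = (\<Prod>c\<in>set cs. \<kappa> / q c)"
    by (rule prod.reindex_bij_betw[OF bij])
  also have "(\<Sum>i<length cs. 1 / (\<kappa> / q (cs ! i))) = (\<Sum>c\<in>set cs. 1 / (\<kappa> / q c))"
    by (rule sum.reindex_bij_betw[OF bij])
  also have "\<dots> = (\<Sum>c\<in>set cs. q c) / \<kappa>" by (simp add: sum_divide_distrib)
  also have "1 + \<kappa> / q0 * ((\<Sum>c\<in>set cs. q c) / \<kappa>) = 1 / q0"
    using \<kappa> q by (simp add: field_simps)
  also have "(\<Prod>c\<in>set cs. \<kappa> / q c) = \<kappa> ^ length cs * (\<Prod>c\<in>set cs. 1 / q c)"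
    using assms(1) by (simp add: prod_dividef distinct_card)
  finally show ?thesis by simp
qed

section \<open>Integrals over products of simplices\<close>

text \<open>Only the coordinates in \<open>K\<close> are constrained and no extensionality is asked
  for, so a parameter with more coordinates can be tested one group at a time.\<close>

definition simplex_on :: "'c set \<Rightarrow> ('c \<Rightarrow> real) set" where
  "simplex_on K = {y. (\<forall>c\<in>K. 0 < y c) \<and> (\<Sum>c\<in>K. y c) < 1}"

text \<open>The unnormalized symmetric Dirichlet density with parameter \<open>a + 1\<close>; the
  first factor belongs to the omitted cell.\<close>

definition simplex_powr :: "real \<Rightarrow> 'c set \<Rightarrow> ('c \<Rightarrow> real) \<Rightarrow> real" where
  "simplex_powr a K y = (1 - (\<Sum>c\<in>K. y c)) powr a * (\<Prod>c\<in>K. y c powr a)"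

lemma product_sigma_finite_lborel: "product_sigma_finite (\<lambda>_. lborel :: real measure)"
  by (simp add: product_sigma_finite_def sigma_finite_lborel)

lemma simplex_on_sets: "finite K \<Longrightarrow> simplex_on K \<inter> space (lborel_on K) \<in> sets (lborel_on K)"
proof -
  assume [simp]: "finite K"
  have "{y \<in> space (lborel_on K). (\<forall>c\<in>K. 0 < y c) \<and> (\<Sum>c\<in>K. y c) < 1} \<in> sets (lborel_on K)"
    by measurable
  then show ?thesis unfolding simplex_on_def by (simp add: Int_def conj_commute)
qed

lemma measurable_simplex_powr: "finite K \<Longrightarrow> simplex_powr a K \<in> borel_measurable (lborel_on K)"
  unfolding simplex_powr_def by measurable

lemma measurable_indicator_simplex_on: "finite K \<Longrightarrow> (indicator (simplex_on K) :: _ \<Rightarrow> real) \<in> borel_measurable (lborel_on K)"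
  using simplex_on_sets[of K] by (simp add: borel_measurable_indicator_iff)

text \<open>The exponent \<open>-3/4\<close> lies between the \<open>-1/2\<close> of the prior and
  the limit \<open>-1\<close>; the gap of \<open>1/4\<close> will absorb logarithms.\<close>

lemma nn_integral_powr_unit:
  "(\<integral>\<^sup>+t. ennreal (indicator {0<..<1} t * t powr (-3/4)) \<partial>lborel) < \<infinity>"
proof -
  let ?f = "\<lambda>t::real. if t \<in> {0..1} then t powr (-3/4) else 0"
  have "((\<lambda>t::real. t powr (-3/4)) has_integral (1 powr (-3/4 + 1) / (-3/4 + 1))) {0..1}"
    by (rule has_integral_powr_from_0) auto
  then have "(?f has_integral (1 powr (-3/4 + 1) / (-3/4 + 1))) UNIV"
    by (simp only: has_integral_restrict_UNIV)
  then have "integral\<^sup>N lborel ?f = ennreal (1 powr (-3/4 + 1) / (-3/4 + 1))"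
    by (intro nn_integral_has_integral_lborel) auto
  moreover have "(\<integral>\<^sup>+t. ennreal (indicator {0<..<1} t * t powr (-3/4)) \<partial>lborel) \<le> integral\<^sup>N lborel ?f"
    by (intro nn_integral_mono ennreal_leI) (auto simp: indicator_def)
  ultimately show ?thesis by (simp add: le_less_trans)
qed

text \<open>Pigeonhole for \<open>card K + 1\<close> cells with total mass one.\<close>

lemma simplex_large_coordinate:
  assumes "finite K" and y: "y \<in> simplex_on K"
  shows "1 / (real (card K) + 1) \<le> 1 - (\<Sum>c\<in>K. y c) \<or> (\<exists>k\<in>K. 1 / (real (card K) + 1) \<le> y k)"
proof (rule ccontr)
  define \<delta> where "\<delta> = 1 / (real (card K) + 1)"
  assume "\<not> ?thesis"
  then have a: "1 - (\<Sum>c\<in>K. y c) < \<delta>" and b: "\<And>k. k \<in> K \<Longrightarrow> y k \<le> \<delta>"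
    unfolding \<delta>_def by force+
  have "(\<Sum>c\<in>K. y c) \<le> real (card K) * \<delta>"
    using b sum_bounded_above[of K y \<delta>] by simp
  moreover have "real (card K) * \<delta> + \<delta> = 1" unfolding \<delta>_def by (simp add: field_simps)
  ultimately show False using a by linarith
qed

text \<open>Some cell of a probability vector has mass at least \<open>1 / (card K + 1)\<close>; the power of that cell
  is bounded, and the other cells can be taken as coordinates.\<close>

lemma nn_integral_simplex_powr:
  assumes K: "finite K"
  shows "(\<integral>\<^sup>+y. ennreal (indicator (simplex_on K) y * simplex_powr (-3/4) K y) \<partial>lborel_on K) < \<infinity>"
proof -
  interpret product_sigma_finite "\<lambda>_. lborel :: real measure" by (rule product_sigma_finite_lborel)
  define \<phi> :: "real \<Rightarrow> ennreal" where "\<phi> t = ennreal (indicator {0<..<1} t * t powr (-3/4))" for t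
  have [measurable]: "\<phi> \<in> borel_measurable borel" unfolding \<phi>_def by measurable
  define I0 where "I0 = integral\<^sup>N lborel \<phi>"
  have I0: "I0 < \<infinity>" unfolding I0_def \<phi>_def by (rule nn_integral_powr_unit)
  define M where "M = (1 / (real (card K) + 1)) powr (-3/4)"
  \<comment> \<open>\<open>f0\<close> is the majorant where the omitted cell is the large one, and
    \<open>f k\<close> where cell \<open>k\<close> is: in each case the power of the large cell has
    been replaced by its bound \<open>M\<close>.\<close>
  define f0 where "f0 y = (\<Prod>c\<in>K. \<phi> (y c))" for y
  define f where "f k y = \<phi> (1 - (\<Sum>c\<in>K. y c)) * (\<Prod>c\<in>K - {k}. \<phi> (y c))" for k y
  have bound: "ennreal (indicator (simplex_on K) y * simplex_powr (-3/4) K y) \<le> ennreal M * (f0 y + (\<Sum>k\<in>K. f k y))"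
    for y
  proof (cases "y \<in> simplex_on K")
    case True
    define q0 where "q0 = 1 - (\<Sum>c\<in>K. y c)"
    have pos: "0 < y c" if "c \<in> K" for c using True that by (simp add: simplex_on_def)
    have q0: "0 < q0" using True by (simp add: simplex_on_def q0_def)
    have le: "y c \<le> (\<Sum>c\<in>K. y c)" if "c \<in> K" for c
      using K pos that by (intro member_le_sum) (auto intro: less_imp_le)
    have \<phi>y: "\<phi> (y c) = ennreal (y c powr (-3/4))" if "c \<in> K" for c
      using pos[OF that] le[OF that] q0 unfolding \<phi>_def q0_def by simp
    have \<delta>: "0 < 1 / (real (card K) + 1)" by simp
    have *: "simplex_powr (-3/4) K y = q0 powr (-3/4) * (\<Prod>c\<in>K. y c powr (-3/4))"
      by (simp add: simplex_powr_def q0_def)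
    from simplex_large_coordinate[OF K True] show ?thesis
    proof (elim disjE bexE)
      assume "1 / (real (card K) + 1) \<le> 1 - (\<Sum>c\<in>K. y c)"
      then have "q0 powr (-3/4) \<le> M" unfolding M_def q0_def using \<delta> by (intro powr_mono2') auto
      then have "q0 powr (-3/4) * (\<Prod>c\<in>K. y c powr (-3/4)) \<le> M * (\<Prod>c\<in>K. y c powr (-3/4))"
        by (intro mult_right_mono prod_nonneg) auto
      then have "ennreal (simplex_powr (-3/4) K y) \<le> ennreal (M * (\<Prod>c\<in>K. y c powr (-3/4)))"
        unfolding * by (rule ennreal_leI)
      also have "\<dots> = ennreal M * f0 y"
        unfolding f0_def by (simp add: \<phi>y prod_ennreal ennreal_mult' M_def)
      also have "\<dots> \<le> ennreal M * (f0 y + (\<Sum>k\<in>K. f k y))" by (intro mult_left_mono) auto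
      finally show ?thesis using True by simp
    next
      fix k assume k: "k \<in> K" and "1 / (real (card K) + 1) \<le> y k"
      then have M: "y k powr (-3/4) \<le> M" unfolding M_def using \<delta> by (intro powr_mono2') auto
      have "q0 < 1" using pos[OF k] le[OF k] unfolding q0_def by simp
      then have \<phi>q: "\<phi> q0 = ennreal (q0 powr (-3/4))" using q0 unfolding \<phi>_def by simp
      have "(\<Prod>c\<in>K. y c powr (-3/4)) = y k powr (-3/4) * (\<Prod>c\<in>K - {k}. y c powr (-3/4))"
        using K k by (rule prod.remove)
      also have "\<dots> \<le> M * (\<Prod>c\<in>K - {k}. y c powr (-3/4))"
        using M by (intro mult_right_mono prod_nonneg) auto
      finally have "q0 powr (-3/4) * (\<Prod>c\<in>K. y c powr (-3/4)) \<le> q0 powr (-3/4) * (M * (\<Prod>c\<in>K - {k}. y c powr (-3/4)))"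
        by (intro mult_left_mono) auto
      then have "ennreal (simplex_powr (-3/4) K y) \<le> ennreal (M * (q0 powr (-3/4) * (\<Prod>c\<in>K - {k}. y c powr (-3/4))))"
        unfolding * by (intro ennreal_leI) (simp add: ac_simps)
      also have "\<dots> = ennreal M * f k y"
        unfolding f_def q0_def[symmetric] \<phi>q
        by (simp add: \<phi>y prod_ennreal ennreal_mult' M_def prod_nonneg)
      also have "\<dots> \<le> ennreal M * (f0 y + (\<Sum>k\<in>K. f k y))"
      proof (intro mult_left_mono)
        have "f k y \<le> (\<Sum>k\<in>K. f k y)" using K k by (intro member_le_sum) auto
        then show "f k y \<le> f0 y + (\<Sum>k\<in>K. f k y)" by (simp add: add_increasing)
      qed simp
      finally show ?thesis using True by simp
    qed
  qed simp
  have f0: "integral\<^sup>N (lborel_on K) f0 = I0 ^ card K"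
    unfolding f0_def I0_def using K by (subst product_nn_integral_prod) auto
  have f: "integral\<^sup>N (lborel_on K) (f k) = I0 * I0 ^ card (K - {k})" if k: "k \<in> K" for k
  proof -
    have fm: "f k \<in> borel_measurable (lborel_on (insert k (K - {k})))"
      unfolding f_def insert_Diff[OF k] by measurable
    have upd: "f k (x(k := t)) = (\<Prod>c\<in>K - {k}. \<phi> (x c)) * \<phi> (1 - (\<Sum>c\<in>K - {k}. x c) + (-1) * t)" for x t
    proof -
      have "(\<Sum>c\<in>K. (x(k := t)) c) = t + (\<Sum>c\<in>K - {k}. x c)"
        using K k by (simp add: sum.remove[of K k])
      moreover have "(\<Prod>c\<in>K - {k}. \<phi> ((x(k := t)) c)) = (\<Prod>c\<in>K - {k}. \<phi> (x c))"
        by (intro prod.cong) auto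
      ultimately show ?thesis unfolding f_def by (simp add: algebra_simps)
    qed
    \<comment> \<open>With cell \<open>k\<close> large, the omitted cell takes over as coordinate.
      In the direction of \<open>k\<close> this is a reflection and a shift of the line, which
      preserves the integral.\<close>
    have shift: "(\<integral>\<^sup>+t. \<phi> (a + (-1) * t) \<partial>lborel) = I0" for a
      unfolding I0_def using nn_integral_real_affine[of \<phi> "-1" a] by simp
    have "integral\<^sup>N (lborel_on K) (f k) = integral\<^sup>N (lborel_on (insert k (K - {k}))) (f k)"
      by (simp only: insert_Diff[OF k])
    also have "\<dots> = (\<integral>\<^sup>+x. (\<integral>\<^sup>+t. f k (x(k := t)) \<partial>lborel) \<partial>lborel_on (K - {k}))"
      using K fm by (intro product_nn_integral_insert) auto
    also have "\<dots> = (\<integral>\<^sup>+x. (\<Prod>c\<in>K - {k}. \<phi> (x c)) * I0 \<partial>lborel_on (K - {k}))"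
      unfolding upd by (intro nn_integral_cong, subst nn_integral_cmult) (simp_all add: shift[simplified])
    also have "\<dots> = (\<integral>\<^sup>+x. (\<Prod>c\<in>K - {k}. \<phi> (x c)) \<partial>lborel_on (K - {k})) * I0"
      by (rule nn_integral_multc) measurable
    also have "(\<integral>\<^sup>+x. (\<Prod>c\<in>K - {k}. \<phi> (x c)) \<partial>lborel_on (K - {k})) = I0 ^ card (K - {k})"
      unfolding I0_def using K by (subst product_nn_integral_prod) auto
    finally show ?thesis by (simp add: mult.commute)
  qed
  have [measurable]: "f0 \<in> borel_measurable (lborel_on K)" unfolding f0_def by measurable
  have [measurable]: "f k \<in> borel_measurable (lborel_on K)" for k unfolding f_def by measurable
  have "(\<integral>\<^sup>+y. ennreal (indicator (simplex_on K) y * simplex_powr (-3/4) K y) \<partial>lborel_on K)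
      \<le> (\<integral>\<^sup>+y. ennreal M * (f0 y + (\<Sum>k\<in>K. f k y)) \<partial>lborel_on K)"
    by (intro nn_integral_mono bound)
  also have "\<dots> = ennreal M * (I0 ^ card K + (\<Sum>k\<in>K. I0 * I0 ^ card (K - {k})))"
    by (simp add: nn_integral_cmult nn_integral_add nn_integral_sum f0 f)
  also have "\<dots> < \<infinity>"
    using I0 K by (simp add: ennreal_mult_less_top power_less_top_ennreal of_nat_less_top)
  finally show ?thesis .
qed

text \<open>All cells, including the omitted one, are at most one, so smaller exponents give larger
  powers.\<close>

lemma simplex_powr_mono:
  assumes "finite K" "y \<in> simplex_on K" "a \<le> b"
  shows "simplex_powr b K y \<le> simplex_powr a K y"
proof -
  have pos: "\<And>c. c \<in> K \<Longrightarrow> 0 < y c" and q0: "(\<Sum>c\<in>K. y c) < 1" using assms(2) by (auto simp: simplex_on_def)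
  have le: "y c \<le> 1" if "c \<in> K" for c
  proof -
    have "y c \<le> (\<Sum>c\<in>K. y c)" using assms(1) pos that by (intro member_le_sum) (auto intro: less_imp_le)
    then show ?thesis using q0 by simp
  qed
  have nn: "0 \<le> (\<Sum>c\<in>K. y c)" using pos by (intro sum_nonneg) (auto intro: less_imp_le)
  have m: "x powr b \<le> x powr a" if "0 < x" "x \<le> 1" for x :: real
    using that assms(3) by (intro powr_mono') auto
  show ?thesis unfolding simplex_powr_def
    using pos le q0 nn by (intro mult_mono prod_mono m) (auto intro!: prod_nonneg m)
qed

lemma simplex_powr_integral:
  assumes K: "finite K"
  shows "set_integrable (lborel_on K) (simplex_on K) (simplex_powr (-1/2) K)"
    "0 < (LINT y:simplex_on K|lborel_on K. simplex_powr (-1/2) K y)"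
proof -
  have nn: "0 \<le> simplex_powr a K y" for a y by (auto simp: simplex_powr_def intro!: mult_nonneg_nonneg prod_nonneg)
  note [measurable] = measurable_simplex_powr[OF K] measurable_indicator_simplex_on[OF K]
  let ?g = "\<lambda>y. indicator (simplex_on K) y * simplex_powr (-1/2) K y"
  have "(\<integral>\<^sup>+y. ennreal (?g y) \<partial>lborel_on K) \<le> (\<integral>\<^sup>+y. ennreal (indicator (simplex_on K) y * simplex_powr (-3/4) K y) \<partial>lborel_on K)"
    using simplex_powr_mono[OF K, of _ "-3/4" "-1/2"]
    by (intro nn_integral_mono ennreal_leI) (auto simp: indicator_def)
  then have fin: "(\<integral>\<^sup>+y. ennreal (?g y) \<partial>lborel_on K) < \<infinity>"
    using nn_integral_simplex_powr[OF K] by (rule le_less_trans)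
  then have int: "integrable (lborel_on K) ?g"
    using nn by (intro integrableI_nonneg) auto
  then show "set_integrable (lborel_on K) (simplex_on K) (simplex_powr (-1/2) K)"
    by (simp add: set_integrable_def)
  \<comment> \<open>The cube of side \<open>\<delta>\<close> lies inside the simplex since
    \<open>card K * \<delta> < 1\<close>, and the density is at least one there. Its volume is thus
    a positive lower bound for the integral.\<close>
  define \<delta> where "\<delta> = 1 / (real (card K) + 1)"
  have \<delta>: "0 < \<delta>" by (simp add: \<delta>_def)
  interpret finite_product_sigma_finite "\<lambda>_. lborel :: real measure" K
    using K product_sigma_finite_lborel by (simp add: finite_product_sigma_finite_def finite_product_sigma_finite_axioms_def)
  have "0 < ennreal (\<delta> ^ card K)" using \<delta> by simp
  also have "\<dots> = (\<Prod>c\<in>K. ennreal \<delta>)" using \<delta> by (simp add: ennreal_power less_imp_le)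
  also have "\<dots> = emeasure (lborel_on K) (PiE K (\<lambda>_. {0<..<\<delta>}))"
    using \<delta> by (subst measure_times) auto
  also have "\<dots> = (\<integral>\<^sup>+y. indicator (PiE K (\<lambda>_. {0<..<\<delta>})) y \<partial>lborel_on K)"
    using K by (subst nn_integral_indicator) (auto intro!: sets_PiM_I_finite)
  also have "\<dots> \<le> (\<integral>\<^sup>+y. ennreal (?g y) \<partial>lborel_on K)"
  proof (intro nn_integral_mono)
    fix y :: "'a \<Rightarrow> real"
    show "indicator (PiE K (\<lambda>_. {0<..<\<delta>})) y \<le> ennreal (?g y)"
    proof (cases "y \<in> PiE K (\<lambda>_. {0<..<\<delta>})")
      case True
      then have y: "0 < y c" "y c < \<delta>" if "c \<in> K" for c using that by (auto simp: PiE_iff)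
      have "(\<Sum>c\<in>K. y c) \<le> real (card K) * \<delta>"
        using sum_bounded_above[of K y \<delta>] y by (simp add: less_imp_le)
      also have "\<dots> < 1" by (simp add: \<delta>_def)
      finally have s: "y \<in> simplex_on K" using y by (simp add: simplex_on_def)
      have "simplex_powr 0 K y = 1" using s by (auto simp: simplex_powr_def simplex_on_def intro!: prod.neutral)
      then have "1 \<le> simplex_powr (-1/2) K y" using simplex_powr_mono[OF K s, of "-1/2" 0] by simp
      then show ?thesis using True s by (simp add: ennreal_ge_1)
    qed simp
  qed
  finally have "0 < (\<integral>\<^sup>+y. ennreal (?g y) \<partial>lborel_on K)" .
  moreover have "(LINT y:simplex_on K|lborel_on K. simplex_powr (-1/2) K y) = enn2real (\<integral>\<^sup>+y. ennreal (?g y) \<partial>lborel_on K)"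
    unfolding set_lebesgue_integral_def real_scaleR_def using nn by (intro integral_eq_nn_integral) auto
  ultimately show "0 < (LINT y:simplex_on K|lborel_on K. simplex_powr (-1/2) K y)"
    using fin by (simp add: enn2real_positive_iff)
qed

text \<open>Tonelli over disjoint blocks of coordinates, peeling off one block at a time. That
  \<open>\<psi> g\<close> reads only its own block is expressed by invariance under
  restriction.\<close>

lemma nn_integral_PiM_blocks:
  fixes K :: "'g \<Rightarrow> 'c set" and \<psi> :: "'g \<Rightarrow> ('c \<Rightarrow> real) \<Rightarrow> ennreal"
  assumes "finite G" "\<And>g. g \<in> G \<Longrightarrow> finite (K g)" "\<And>g g'. g \<in> G \<Longrightarrow> g' \<in> G \<Longrightarrow> g \<noteq> g' \<Longrightarrow> K g \<inter> K g' = {}"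
    and "\<And>g. g \<in> G \<Longrightarrow> \<psi> g \<in> borel_measurable (lborel_on (K g))"
    and "\<And>g x. g \<in> G \<Longrightarrow> \<psi> g (restrict x (K g)) = \<psi> g x"
  shows "(\<lambda>y. \<Prod>g\<in>G. \<psi> g y) \<in> borel_measurable (lborel_on (\<Union>g\<in>G. K g))"
    "(\<integral>\<^sup>+y. (\<Prod>g\<in>G. \<psi> g y) \<partial>lborel_on (\<Union>g\<in>G. K g)) = (\<Prod>g\<in>G. integral\<^sup>N (lborel_on (K g)) (\<psi> g))"
proof -
  interpret product_sigma_finite "\<lambda>_. lborel :: real measure" by (rule product_sigma_finite_lborel)
  have meas: "\<psi> g \<in> borel_measurable (lborel_on J)" if "g \<in> G" "K g \<subseteq> J" for g J
  proof -
    have "(\<lambda>y. \<psi> g (restrict y (K g))) \<in> borel_measurable (lborel_on J)"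
      using measurable_restrict_subset[OF that(2)] assms(4)[OF that(1)] by (rule measurable_compose)
    then show ?thesis using assms(5)[OF that(1)] by simp
  qed
  have measP: "(\<lambda>y. \<Prod>g\<in>G'. \<psi> g y) \<in> borel_measurable (lborel_on J)" if "G' \<subseteq> G" "(\<Union>g\<in>G'. K g) \<subseteq> J" for G' J
    using that by (intro borel_measurable_prod_ennreal meas) auto
  show "(\<lambda>y. \<Prod>g\<in>G. \<psi> g y) \<in> borel_measurable (lborel_on (\<Union>g\<in>G. K g))" by (rule measP) auto
  have "(\<integral>\<^sup>+y. (\<Prod>g\<in>G'. \<psi> g y) \<partial>lborel_on (\<Union>g\<in>G'. K g)) = (\<Prod>g\<in>G'. integral\<^sup>N (lborel_on (K g)) (\<psi> g))"
    if "G' \<subseteq> G" for G'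
    using finite_subset[OF that assms(1)] that
  proof (induction G' rule: finite_induct)
    case empty
    then show ?case by (simp add: product_nn_integral_prod[of "{}" "\<lambda>_ _. 1", simplified])
  next
    case (insert g G')
    let ?J = "\<Union>g\<in>G'. K g"
    have g: "g \<in> G" "G' \<subseteq> G" and disj: "K g \<inter> ?J = {}" using insert assms(3) by auto
    have finJ: "finite ?J" using insert assms(2) by auto
    have depends: "\<psi> g' (merge (K g) ?J (x, y)) = \<psi> g' (if g' = g then x else y)" if "g' \<in> insert g G'" for g' x y
    proof -
      have "restrict (merge (K g) ?J (x, y)) (K g') = restrict (if g' = g then x else y) (K g')"
        using that disj by (auto simp: fun_eq_iff merge_def)
      then show ?thesis using assms(5)[of g'] that g insert.prems by (metis subsetD)
    qed
    have "(\<integral>\<^sup>+y. (\<Prod>g\<in>insert g G'. \<psi> g y) \<partial>lborel_on (\<Union>g\<in>insert g G'. K g)) =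
        (\<integral>\<^sup>+y. (\<Prod>g\<in>insert g G'. \<psi> g y) \<partial>lborel_on (K g \<union> ?J))" by simp
    also have "\<dots> = (\<integral>\<^sup>+x. (\<integral>\<^sup>+y. (\<Prod>g'\<in>insert g G'. \<psi> g' (merge (K g) ?J (x, y))) \<partial>lborel_on ?J) \<partial>lborel_on (K g))"
      using disj finJ assms(2) g insert.prems by (intro product_nn_integral_fold measP) auto
    also have "\<dots> = (\<integral>\<^sup>+x. (\<integral>\<^sup>+y. \<psi> g x * (\<Prod>g'\<in>G'. \<psi> g' y) \<partial>lborel_on ?J) \<partial>lborel_on (K g))"
    proof (intro nn_integral_cong)
      fix x y
      have "(\<Prod>g'\<in>insert g G'. \<psi> g' (merge (K g) ?J (x, y))) = (\<Prod>g'\<in>insert g G'. \<psi> g' (if g' = g then x else y))"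
        by (intro prod.cong refl depends)
      also have "\<dots> = \<psi> g x * (\<Prod>g'\<in>G'. \<psi> g' y)"
        using insert.hyps by (simp, intro arg_cong2[where f="(*)"] refl prod.cong) auto
      finally show "(\<Prod>g'\<in>insert g G'. \<psi> g' (merge (K g) ?J (x, y))) = \<psi> g x * (\<Prod>g'\<in>G'. \<psi> g' y)" .
    qed
    also have "\<dots> = (\<integral>\<^sup>+x. \<psi> g x * (\<integral>\<^sup>+y. (\<Prod>g'\<in>G'. \<psi> g' y) \<partial>lborel_on ?J) \<partial>lborel_on (K g))"
      by (intro nn_integral_cong nn_integral_cmult measP) (use g in auto)
    also have "\<dots> = integral\<^sup>N (lborel_on (K g)) (\<psi> g) * (\<integral>\<^sup>+y. (\<Prod>g'\<in>G'. \<psi> g' y) \<partial>lborel_on ?J)"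
      by (intro nn_integral_multc assms(4) g)
    finally show ?case using insert.IH[OF g(2)] insert.hyps by simp
  qed
  then show "(\<integral>\<^sup>+y. (\<Prod>g\<in>G. \<psi> g y) \<partial>lborel_on (\<Union>g\<in>G. K g)) = (\<Prod>g\<in>G. integral\<^sup>N (lborel_on (K g)) (\<psi> g))"
    by simp
qed

section \<open>Moments of multinomial counts\<close>

text \<open>The count tables over a bare index set: the moments below have nothing to do with the
  graph.\<close>

definition tables :: "'i set \<Rightarrow> nat \<Rightarrow> ('i \<Rightarrow> nat) set" where
  "tables I N = {n \<in> I \<rightarrow>\<^sub>E UNIV. (\<Sum>i\<in>I. n i) = N}"

definition mult_prob :: "'i set \<Rightarrow> ('i \<Rightarrow> real) \<Rightarrow> nat \<Rightarrow> ('i \<Rightarrow> nat) \<Rightarrow> real" where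
  "mult_prob I p N n = fact N / (\<Prod>i\<in>I. fact (n i)) * (\<Prod>i\<in>I. p i ^ n i)"

context
  fixes I :: "'i set" and p :: "'i \<Rightarrow> real"
  assumes I: "finite I" and p: "(\<Sum>i\<in>I. p i) = 1"
begin

lemma finite_tables: "finite (tables I N)"
proof (rule finite_subset)
  have "n i \<le> N" if "n \<in> tables I N" "i \<in> I" for n i
    using member_le_sum[of i I n] that I unfolding tables_def by auto
  moreover have "n \<in> extensional I" if "n \<in> tables I N" for n
    using that unfolding tables_def by (simp add: PiE_iff)
  ultimately show "tables I N \<subseteq> I \<rightarrow>\<^sub>E {..N}" by (intro subsetI PiE_I) (auto dest: extensional_arb)
qed (use I in \<open>auto intro: finite_PiE\<close>)

text \<open>Size biasing: weighting by the count of the cell \<open>i\<close> amounts to adding one observation in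
  that cell.\<close>

lemma sum_size_biased:
  assumes i: "i \<in> I"
  shows "(\<Sum>n\<in>tables I (Suc N). mult_prob I p (Suc N) n * (real (n i) * h n)) =
    real (Suc N) * p i * (\<Sum>m\<in>tables I N. mult_prob I p N m * h (m(i := Suc (m i))))"
proof -
  let ?up = "\<lambda>m. m(i := Suc (m i))"
  have step: "mult_prob I p (Suc N) (?up m) * real (Suc (m i)) = real (Suc N) * p i * mult_prob I p N m" for m
  proof -
    have "(\<Prod>j\<in>I. fact (?up m j)) = fact (Suc (m i)) * (\<Prod>j\<in>I - {i}. fact (m j) :: real)"
      "(\<Prod>j\<in>I. p j ^ ?up m j) = p i ^ Suc (m i) * (\<Prod>j\<in>I - {i}. p j ^ m j)"
      "(\<Prod>j\<in>I. fact (m j)) = fact (m i) * (\<Prod>j\<in>I - {i}. fact (m j) :: real)"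
      "(\<Prod>j\<in>I. p j ^ m j) = p i ^ m i * (\<Prod>j\<in>I - {i}. p j ^ m j)"
      using I i by (simp_all add: prod.remove[of I i])
    moreover have "(\<Prod>j\<in>I - {i}. fact (m j) :: real) \<noteq> 0" using I by simp
    ultimately show ?thesis
      unfolding mult_prob_def by (simp add: field_simps del: of_nat_Suc)
  qed
  \<comment> \<open>Tables with \<open>n i = 0\<close> have weight zero, and they are exactly the
    ones not reached by adding an observation in cell \<open>i\<close>.\<close>
  have "(\<Sum>n\<in>tables I (Suc N). mult_prob I p (Suc N) n * (real (n i) * h n)) =
      (\<Sum>n\<in>{n \<in> tables I (Suc N). n i \<noteq> 0}. mult_prob I p (Suc N) n * (real (n i) * h n))"
    by (rule sum.mono_neutral_right) (use finite_tables in auto)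
  also have "\<dots> = (\<Sum>m\<in>tables I N. mult_prob I p (Suc N) (?up m) * (real (?up m i) * h (?up m)))"
  proof (rule sum.reindex_bij_witness[where i="?up" and j="\<lambda>n. n(i := n i - 1)"])
    fix m assume m: "m \<in> tables I N"
    have "(\<Sum>j\<in>I. ?up m j) = Suc (\<Sum>j\<in>I. m j)" using I i by (simp add: sum.remove[of I i])
    then show "?up m \<in> {n \<in> tables I (Suc N). n i \<noteq> 0}"
      using m i unfolding tables_def by (auto simp: PiE_iff extensional_def)
  next
    fix n assume n: "n \<in> {n \<in> tables I (Suc N). n i \<noteq> 0}"
    then have "(\<Sum>j\<in>I. n j) = Suc (\<Sum>j\<in>I. (n(i := n i - 1)) j)" using I i by (simp add: sum.remove[of I i])
    then show "n(i := n i - 1) \<in> tables I N"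
      using n i unfolding tables_def by (auto simp: PiE_iff extensional_def)
  qed auto
  also have "\<dots> = (\<Sum>m\<in>tables I N. (mult_prob I p (Suc N) (?up m) * real (Suc (m i))) * h (?up m))"
    by (intro sum.cong refl) simp
  also have "\<dots> = (\<Sum>m\<in>tables I N. real (Suc N) * p i * (mult_prob I p N m * h (?up m)))"
    unfolding step by (intro sum.cong refl) (simp only: mult.assoc)
  finally show ?thesis by (simp only: sum_distrib_left)
qed

text \<open>The multinomial theorem by size biasing: as the counts of a table add up to
  \<open>Suc N\<close>, weighting by each count in turn expresses the total mass for
  \<open>Suc N\<close> trials through the one for \<open>N\<close>.\<close>

lemma sum_mult_prob: "(\<Sum>n\<in>tables I N. mult_prob I p N n) = 1"
proof (induction N)
  case 0
  have "tables I 0 = {\<lambda>i\<in>I. 0}" unfolding tables_def using I by (auto simp: PiE_iff extensional_def)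
  then show ?case by (simp add: mult_prob_def)
next
  case (Suc N)
  have "real (Suc N) * (\<Sum>n\<in>tables I (Suc N). mult_prob I p (Suc N) n) =
      (\<Sum>n\<in>tables I (Suc N). \<Sum>i\<in>I. mult_prob I p (Suc N) n * (real (n i) * 1))"
    unfolding sum_distrib_left
  proof (intro sum.cong refl)
    fix n assume "n \<in> tables I (Suc N)"
    then have "real (Suc N) = (\<Sum>i\<in>I. real (n i))" unfolding tables_def by (auto simp flip: of_nat_sum)
    moreover have "(\<Sum>i\<in>I. mult_prob I p (Suc N) n * (real (n i) * 1)) = mult_prob I p (Suc N) n * (\<Sum>i\<in>I. real (n i))"
      by (simp only: sum_distrib_left mult_1_right)
    ultimately show "real (Suc N) * mult_prob I p (Suc N) n = (\<Sum>i\<in>I. mult_prob I p (Suc N) n * (real (n i) * 1))"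
      by (simp only: mult.commute)
  qed
  also have "\<dots> = (\<Sum>i\<in>I. \<Sum>n\<in>tables I (Suc N). mult_prob I p (Suc N) n * (real (n i) * 1))" by (rule sum.swap)
  also have "\<dots> = (\<Sum>i\<in>I. real (Suc N) * p i)"
    using sum_size_biased[of _ N "\<lambda>_. 1"] Suc by (intro sum.cong refl) simp
  also have "\<dots> = real (Suc N) * 1" by (simp only: sum_distrib_left[symmetric] p)
  finally show ?case by (simp del: of_nat_Suc)
qed

lemma first_moment: "i \<in> I \<Longrightarrow> (\<Sum>n\<in>tables I N. mult_prob I p N n * real (n i)) = real N * p i"
proof (cases N)
  case 0
  assume "i \<in> I"
  then have "n i = 0" if "n \<in> tables I N" for n using that I 0 unfolding tables_def by auto
  then have "(\<Sum>n\<in>tables I N. mult_prob I p N n * real (n i)) = 0" by (intro sum.neutral) auto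
  then show ?thesis using 0 by simp
next
  case (Suc k)
  assume "i \<in> I"
  then show ?thesis using sum_size_biased[of i k "\<lambda>_. 1"] sum_mult_prob[of k] Suc by simp
qed

lemma second_moment:
  assumes "i \<in> I" "j \<in> I"
  shows "(\<Sum>n\<in>tables I N. mult_prob I p N n * (real (n i) * real (n j))) =
    real N * p i * (of_bool (i = j) + (real N - 1) * p j)"
proof (cases N)
  case 0
  have "n i = 0" if "n \<in> tables I N" for n using that I 0 assms unfolding tables_def by auto
  then have "(\<Sum>n\<in>tables I N. mult_prob I p N n * (real (n i) * real (n j))) = 0" by (intro sum.neutral) auto
  then show ?thesis using 0 by simp
next
  case (Suc k)
  \<comment> \<open>The observation added in cell \<open>i\<close> raises the count of
    \<open>j\<close> exactly when both cells coincide; what is left is the first moment for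
    \<open>k = N - 1\<close> trials.\<close>
  have "(\<Sum>m\<in>tables I k. mult_prob I p k m * real ((m(i := Suc (m i))) j)) =
      (\<Sum>m\<in>tables I k. mult_prob I p k m * real (m j) + of_bool (i = j) * mult_prob I p k m)"
    by (intro sum.cong refl) (auto simp: algebra_simps)
  also have "\<dots> = of_bool (i = j) + (real N - 1) * p j"
    using first_moment[OF assms(2), of k] sum_mult_prob[of k] Suc by (simp add: sum.distrib sum_distrib_left[symmetric])
  finally show ?thesis using sum_size_biased[OF assms(1), of k "\<lambda>n. real (n j)"] Suc by simp
qed

text \<open>For scores, which have mean zero, the last term disappears, and \<open>N\<close> trials
  carry \<open>N\<close> times the information of one.\<close>

lemma multinomial_covariance:
  "(\<Sum>n\<in>tables I N. mult_prob I p N n * (\<Sum>i\<in>I. real (n i) * u i) * (\<Sum>j\<in>I. real (n j) * v j)) =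
    real N * (\<Sum>i\<in>I. p i * (u i * v i)) + real N * (real N - 1) * ((\<Sum>i\<in>I. p i * u i) * (\<Sum>j\<in>I. p j * v j))"
proof -
  have "(\<Sum>n\<in>tables I N. mult_prob I p N n * (\<Sum>i\<in>I. real (n i) * u i) * (\<Sum>j\<in>I. real (n j) * v j)) =
      (\<Sum>n\<in>tables I N. \<Sum>i\<in>I. \<Sum>j\<in>I. mult_prob I p N n * (real (n i) * real (n j)) * (u i * v j))"
    unfolding mult.assoc unfolding sum_product unfolding sum_distrib_left
    by (intro sum.cong refl) (simp only: ac_simps)
  also have "\<dots> = (\<Sum>i\<in>I. \<Sum>j\<in>I. (\<Sum>n\<in>tables I N. mult_prob I p N n * (real (n i) * real (n j))) * (u i * v j))"
    by (subst sum.swap, intro sum.cong refl, subst sum.swap) (simp add: sum_distrib_right)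
  also have "\<dots> = (\<Sum>i\<in>I. \<Sum>j\<in>I. (if i = j then real N * (p i * (u i * v j)) else 0) +
      real N * (real N - 1) * ((p i * u i) * (p j * v j)))"
    by (intro sum.cong refl) (simp only: second_moment, simp add: algebra_simps)
  also have "\<dots> = (\<Sum>i\<in>I. real N * (p i * (u i * v i)) + (\<Sum>j\<in>I. real N * (real N - 1) * ((p i * u i) * (p j * v j))))"
    using I by (intro sum.cong refl) (simp add: sum.distrib)
  also have "\<dots> = real N * (\<Sum>i\<in>I. p i * (u i * v i)) + real N * (real N - 1) * (\<Sum>i\<in>I. \<Sum>j\<in>I. (p i * u i) * (p j * v j))"
    by (simp only: sum.distrib sum_distrib_left)
  also have "(\<Sum>i\<in>I. \<Sum>j\<in>I. (p i * u i) * (p j * v j)) = (\<Sum>i\<in>I. p i * u i) * (\<Sum>j\<in>I. p j * v j)"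
    by (simp only: sum_product)
  finally show ?thesis .
qed

end

lemma entry_mat_cong:
  "(\<And>c c'. c \<in> set cs \<Longrightarrow> c' \<in> set cs \<Longrightarrow> g c c' = g' c c') \<Longrightarrow> entry_mat cs g = entry_mat cs g'"
  unfolding entry_mat_def by (intro eq_matI) auto

section \<open>Fisher information\<close>

context factor_model
begin

text \<open>The marginal probability of the conditioning cell of \<open>g\<close>, written as an
  expectation so that the results on factor products apply directly.\<close>

definition sep_prob :: "('v, 'a) param \<Rightarrow> ('v, 'a) group \<Rightarrow> real" where
  "sep_prob \<theta> g = (\<Sum>x\<in>cells L V. factor_prod F (pr \<theta>) x * of_bool (restrict x (fst (snd g)) = snd (snd g)))"

text \<open>The derivative of the log probability of a cell with respect to one coordinate. Raising
  the probability of \<open>r0\<close> lowers that of the omitted cell by the same amount, hence the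
  negative term; nothing happens for other conditioning cells.\<close>

definition cell_score ::
  "('v, 'a) param \<Rightarrow> ('v, 'a) group \<times> ('v \<Rightarrow> 'a) \<Rightarrow> ('v \<Rightarrow> 'a) \<Rightarrow> ('v \<Rightarrow> 'a) \<Rightarrow> real" where
  "cell_score \<theta> c s r = (case c of ((R, S, s0), r0) \<Rightarrow> of_bool (s = s0) *
     (of_bool (r = r0) / pr \<theta> (R, S, s0) r0 -
      of_bool (r = last_cell (R, S, s0)) / pr \<theta> (R, S, s0) (last_cell (R, S, s0))))"

lemma coordD:
  assumes "((R, S, s), r) \<in> coord_set"
  shows "(R, S, s) \<in> set gl" "r \<in> set (fc (R, S, s))" "(R, S) \<in> F" "R \<subseteq> V" "S \<subseteq> V"
proof -
  show g: "(R, S, s) \<in> set gl" and "r \<in> set (fc (R, S, s))"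
    using iffD1[OF mem_coord_set assms] by blast+
  show "(R, S) \<in> F" "R \<subseteq> V" "S \<subseteq> V" by (rule groupD[OF g])+
qed

lemma cell_score_centered:
  assumes "\<theta> \<in> \<Theta>" "((R, S, s0), r0) \<in> coord_set" "s \<in> cells L S"
  shows "(\<Sum>r\<in>cells L R. pr \<theta> (R, S, s) r * cell_score \<theta> ((R, S, s0), r0) s r) = 0"
proof -
  let ?g = "(R, S, s0)"
  note g = coordD(1,2)[OF assms(2)]
  have r0: "r0 \<in> gcells ?g" "last_cell ?g \<in> gcells ?g" using last_cell[OF g(1)] g(2) by auto
  have pos: "pr \<theta> ?g r0 \<noteq> 0" "pr \<theta> ?g (last_cell ?g) \<noteq> 0"
    using full_prob_pos[OF assms(1) g(1)] r0 by (metis less_irrefl)+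
  have "(\<Sum>r\<in>gcells ?g. pr \<theta> ?g r * (of_bool (r = r0) / pr \<theta> ?g r0 -
      of_bool (r = last_cell ?g) / pr \<theta> ?g (last_cell ?g))) =
      (\<Sum>r\<in>gcells ?g. (if r = r0 then pr \<theta> ?g r / pr \<theta> ?g r0 else 0) -
        (if r = last_cell ?g then pr \<theta> ?g r / pr \<theta> ?g (last_cell ?g) else 0))"
    by (intro sum.cong refl) (auto simp: algebra_simps)
  also have "\<dots> = 0" using pos r0 finite_gcells[OF g(1)] by (simp add: sum_subtractf)
  finally show ?thesis unfolding cell_score_def gcells_def by (cases "s = s0") simp_all
qed

text \<open>Each score lives on its own cell and on the omitted one. Two scores of a group always
  meet on the omitted cell, giving the constant term, and on their own cells only if these
  coincide.\<close>

lemma cell_score_product: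
  assumes "\<theta> \<in> \<Theta>" "((R, S, s0), r0) \<in> coord_set" "((R, S, s0), r1) \<in> coord_set"
  shows "(\<Sum>r\<in>cells L R. pr \<theta> (R, S, s) r * (cell_score \<theta> ((R, S, s0), r0) s r * cell_score \<theta> ((R, S, s0), r1) s r)) =
    of_bool (s = s0) * (of_bool (r0 = r1) / pr \<theta> (R, S, s0) r0 + 1 / pr \<theta> (R, S, s0) (last_cell (R, S, s0)))"
proof (cases "s = s0")
  case True
  let ?g = "(R, S, s0)"
  let ?l = "last_cell ?g"
  note g = coordD(1,2)[OF assms(2)] coordD(2)[OF assms(3)]
  have r0: "r0 \<in> gcells ?g" "r1 \<in> gcells ?g" "?l \<in> gcells ?g" "r0 \<noteq> ?l" "r1 \<noteq> ?l"
    using last_cell[OF g(1)] g(2,3) by auto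
  have pos: "pr \<theta> ?g r0 \<noteq> 0" "pr \<theta> ?g r1 \<noteq> 0" "pr \<theta> ?g ?l \<noteq> 0"
    using full_prob_pos[OF assms(1) g(1)] r0 by (metis less_irrefl)+
  have "(\<Sum>r\<in>gcells ?g. pr \<theta> ?g r * ((of_bool (r = r0) / pr \<theta> ?g r0 - of_bool (r = ?l) / pr \<theta> ?g ?l) *
        (of_bool (r = r1) / pr \<theta> ?g r1 - of_bool (r = ?l) / pr \<theta> ?g ?l))) =
      (\<Sum>r\<in>gcells ?g. (if r = r0 then of_bool (r0 = r1) / pr \<theta> ?g r0 else 0) +
        (if r = ?l then 1 / pr \<theta> ?g ?l else 0))"
    using r0 pos by (intro sum.cong refl) (auto simp: field_simps)
  also have "\<dots> = of_bool (r0 = r1) / pr \<theta> ?g r0 + 1 / pr \<theta> ?g ?l"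
    using r0 finite_gcells[OF g(1)] by (simp add: sum.distrib)
  finally show ?thesis unfolding cell_score_def gcells_def True by simp
qed (simp add: cell_score_def)

lemma sum_score:
  assumes \<theta>: "\<theta> \<in> \<Theta>" and c: "((R, S, s0), r0) \<in> coord_set"
  shows "(\<Sum>x\<in>cells L V. theta_dist \<theta> x * cell_score \<theta> ((R, S, s0), r0) (restrict x S) (restrict x R)) = 0"
proof -
  note RS = coordD(3,5)[OF c]
  have "(\<Sum>x\<in>cells L V. theta_dist \<theta> x * cell_score \<theta> ((R, S, s0), r0) (restrict x S) (restrict x R)) =
     (\<Sum>x\<in>cells L V. factor_prod F (pr \<theta>) x * cell_score \<theta> ((R, S, s0), r0) (restrict x S) (restrict x R))"
    by (intro sum.cong refl) (simp add: theta_dist_def)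
  also have "\<dots> = (\<Sum>x\<in>cells L V. factor_prod F (pr \<theta>) x *
     (\<Sum>r\<in>cells L R. pr \<theta> (R, S, restrict x S) r * cell_score \<theta> ((R, S, s0), r0) (restrict x S) r))"
    using expectation_factor[OF factors cond_family_full_prob[OF \<theta>] RS(1)] unfolding verts .
  also have "\<dots> = 0"
  proof (intro sum.neutral ballI)
    fix x assume x: "x \<in> cells L V"
    show "factor_prod F (pr \<theta>) x * (\<Sum>r\<in>cells L R. pr \<theta> (R, S, restrict x S) r *
        cell_score \<theta> ((R, S, s0), r0) (restrict x S) r) = 0"
      unfolding cell_score_centered[OF \<theta> c restrict_cells[OF x RS(2)]] by simp
  qed
  finally show ?thesis .
qed

text \<open>Three situations: different factors are orthogonal, different conditioning cells of one
  factor give scores with disjoint supports, and within one group the tower property leaves the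
  multinomial information times the probability of the conditioning cell.\<close>

lemma sum_score_product:
  assumes \<theta>: "\<theta> \<in> \<Theta>" and c: "((R, S, s0), r0) \<in> coord_set" and c': "((R', S', s1), r1) \<in> coord_set"
  shows "(\<Sum>x\<in>cells L V. theta_dist \<theta> x * (cell_score \<theta> ((R, S, s0), r0) (restrict x S) (restrict x R) *
      cell_score \<theta> ((R', S', s1), r1) (restrict x S') (restrict x R'))) =
    of_bool ((R, S, s0) = (R', S', s1)) * sep_prob \<theta> (R, S, s0) *
      (of_bool (r0 = r1) / pr \<theta> (R, S, s0) r0 + 1 / pr \<theta> (R, S, s0) (last_cell (R, S, s0)))" (is "?lhs = _")
proof -
  note RS = coordD(3)[OF c] coordD(3)[OF c']
  have lhs: "?lhs = (\<Sum>x\<in>cells L (verts F). factor_prod F (pr \<theta>) x * (cell_score \<theta> ((R, S, s0), r0) (restrict x S) (restrict x R) *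
      cell_score \<theta> ((R', S', s1), r1) (restrict x S') (restrict x R')))"
    unfolding verts by (intro sum.cong refl) (simp add: theta_dist_def)
  consider "(R, S) \<noteq> (R', S')" | "R' = R" "S' = S" "s0 \<noteq> s1" | "R' = R" "S' = S" "s1 = s0" by blast
  then show ?thesis
  proof cases
    case 1
    have "?lhs = 0"
      unfolding lhs
      by (rule expectation_orthogonal[OF factors cond_family_full_prob[OF \<theta>] RS 1])
        (use cell_score_centered[OF \<theta> c] cell_score_centered[OF \<theta> c'] in blast)+
    then show ?thesis using 1 by auto
  next
    case 2
    then have "?lhs = 0" by (intro sum.neutral) (auto simp: cell_score_def)
    then show ?thesis using 2 by simp
  next
    case 3
    have "?lhs = (\<Sum>x\<in>cells L (verts F). factor_prod F (pr \<theta>) x *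
        (\<Sum>r\<in>cells L R. pr \<theta> (R, S, restrict x S) r *
          (cell_score \<theta> ((R, S, s0), r0) (restrict x S) r * cell_score \<theta> ((R, S, s0), r1) (restrict x S) r)))"
      unfolding lhs unfolding 3
      by (rule expectation_factor[OF factors cond_family_full_prob[OF \<theta>] RS(1),
            where v="\<lambda>s r. cell_score \<theta> ((R, S, s0), r0) s r * cell_score \<theta> ((R, S, s0), r1) s r"])
    then show ?thesis
      unfolding cell_score_product[OF \<theta> c c'[unfolded 3]] verts sep_prob_def 3
      by (simp add: sum_distrib_right mult.assoc)
  qed
qed

lemma full_prob_has_derivative:
  assumes c: "(g0, r0) \<in> coord_set" and g: "g \<in> set gl" and r: "r \<in> gcells g"
  shows "((\<lambda>t. pr (\<theta>((g0, r0) := t)) g r) has_field_derivative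
    of_bool (g = g0) * (of_bool (r = r0) - of_bool (r = last_cell g0))) (at t)"
proof -
  have g0: "g0 \<in> set gl" "r0 \<in> set (fc g0)" using iffD1[OF mem_coord_set c] by blast+
  have ne: "r0 \<noteq> last_cell g0" using last_notin[OF g0(1)] g0(2) by auto
  show ?thesis
  proof (cases "g = g0")
    case False
    then have "pr (\<theta>((g0, r0) := t)) g r = pr \<theta> g r" for t
      unfolding full_prob_def by (auto intro!: sum.cong)
    then show ?thesis using False by simp
  next
    case True
    show ?thesis
    proof (cases "r = last_cell g0")
      case last: True
      have "pr (\<theta>((g0, r0) := t)) g r = 1 - (t + (\<Sum>r'\<in>set (fc g0) - {r0}. \<theta> (g0, r')))" for t
      proof -
        have "(\<Sum>r'\<in>set (fc g0). (\<theta>((g0, r0) := t)) (g0, r')) = t + (\<Sum>r'\<in>set (fc g0) - {r0}. \<theta> (g0, r'))"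
          using g0(2) by (simp add: sum.remove[of _ r0])
        then show ?thesis unfolding True last full_prob_last[OF g0(1)] by simp
      qed
      then show ?thesis using True last ne by (auto intro!: derivative_eq_intros)
    next
      case False
      then have "r \<in> set (fc g0)" using r True gcells_eq[OF g0(1)] by auto
      then have "pr (\<theta>((g0, r0) := t)) g r = (if r = r0 then t else \<theta> (g0, r))" for t
        unfolding True by (simp add: full_prob_coord)
      then show ?thesis using True False by (auto intro!: derivative_eq_intros)
    qed
  qed
qed

text \<open>The likelihood has its explicit form only on \<open>\<Theta>\<close>, so differentiating
  it requires a whole neighbourhood of coordinate values that stay in
  \<open>\<Theta>\<close>.\<close>

lemma eventually_update_Theta:
  assumes \<theta>: "\<theta> \<in> \<Theta>" and c: "c \<in> coord_set"
  shows "\<forall>\<^sub>F t in nhds (\<theta> c). \<theta>(c := t) \<in> \<Theta>"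
proof -
  obtain g0 r0 where cc: "c = (g0, r0)" by (cases c)
  have g0: "g0 \<in> set gl" "r0 \<in> set (fc g0)" using iffD1[OF mem_coord_set c[unfolded cc]] by blast+
  define d where "d = (\<Sum>r'\<in>set (fc g0) - {r0}. \<theta> (g0, r'))"
  have sum: "(\<Sum>r'\<in>set (fc g0). (\<theta>(c := t)) (g0, r')) = t + d" for t
    using g0(2) unfolding cc d_def by (simp add: sum.remove[of _ r0])
  have \<theta>': "\<theta> \<in> extensional coord_set" "\<And>g r. g \<in> set gl \<Longrightarrow> r \<in> set (fc g) \<Longrightarrow> 0 < \<theta> (g, r)"
    "\<And>g. g \<in> set gl \<Longrightarrow> (\<Sum>r\<in>set (fc g). \<theta> (g, r)) < 1"
    using \<theta> unfolding cut_space_def by auto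
  have "0 < \<theta> c" "\<theta> c < 1 - d"
    using \<theta>'(2)[OF g0] \<theta>'(3)[OF g0(1)] sum[of "\<theta> c"] unfolding cc by simp_all
  then have "\<forall>\<^sub>F t in nhds (\<theta> c). t \<in> {0<..<1 - d}"
    by (intro eventually_nhds_in_open) auto
  then show ?thesis
  proof (rule eventually_mono)
    fix t assume t: "t \<in> {0<..<1 - d}"
    have "(\<Sum>r\<in>set (fc g). (\<theta>(c := t)) (g, r)) < 1" if "g \<in> set gl" for g
    proof (cases "g = g0")
      case True
      then show ?thesis using sum[of t] t by simp
    next
      case False
      then have "(\<Sum>r\<in>set (fc g). (\<theta>(c := t)) (g, r)) = (\<Sum>r\<in>set (fc g). \<theta> (g, r))"
        unfolding cc by (intro sum.cong) auto
      then show ?thesis using \<theta>'(3)[OF that] by simp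
    qed
    moreover have "\<theta>(c := t) \<in> extensional coord_set" using \<theta>'(1) c by (auto simp: extensional_def)
    moreover have "0 < (\<theta>(c := t)) (g, r)" if "g \<in> set gl" "r \<in> set (fc g)" for g r
      using t \<theta>'(2)[OF that] by auto
    ultimately show "\<theta>(c := t) \<in> \<Theta>" unfolding cut_space_def by blast
  qed
qed

text \<open>For a given cell \<open>x\<close> each factor reads one entry of one group, so only the
  factor \<open>(R0, S0)\<close> can react to the coordinate, and only if \<open>x\<close> restricts
  to \<open>s0\<close>.\<close>

lemma log_theta_dist_derivative:
  assumes \<theta>: "\<theta> \<in> \<Theta>" and c: "((R0, S0, s0), r0) \<in> coord_set" and x: "x \<in> cells L V"
  shows "((\<lambda>t. \<Sum>(R, S)\<in>F. ln (pr (\<theta>(((R0, S0, s0), r0) := t)) (R, S, restrict x S) (restrict x R)))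
    has_field_derivative cell_score \<theta> ((R0, S0, s0), r0) (restrict x S0) (restrict x R0)) (at (\<theta> ((R0, S0, s0), r0)))"
proof -
  let ?c = "((R0, S0, s0), r0)"
  define D where "D = (\<lambda>(R, S). of_bool ((R, S, restrict x S) = (R0, S0, s0)) *
    (of_bool (restrict x R = r0) - of_bool (restrict x R = last_cell (R0, S0, s0))) / pr \<theta> (R, S, restrict x S) (restrict x R))"
  note g0 = coordD(1,2)[OF c] and F0 = coordD(3)[OF c]
  have "((\<lambda>t. \<Sum>(R, S)\<in>F. ln (pr (\<theta>(?c := t)) (R, S, restrict x S) (restrict x R))) has_field_derivative
      (\<Sum>f\<in>F. D f)) (at (\<theta> ?c))"
  proof (intro DERIV_sum, clarify)
    fix R S assume RS: "(R, S) \<in> F"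
    then have sub: "R \<subseteq> V" "S \<subseteq> V" using perfect_factorsD(3)[OF factors] verts by force+
    have g: "(R, S, restrict x S) \<in> set gl" using RS group_of_factor restrict_cells[OF x sub(2)] by blast
    have r: "restrict x R \<in> gcells (R, S, restrict x S)" unfolding gcells_def using restrict_cells[OF x sub(1)] by simp
    have "0 < pr (\<theta>(?c := \<theta> ?c)) (R, S, restrict x S) (restrict x R)"
      using full_prob_pos[OF \<theta> g r] by simp
    from DERIV_ln_divide[THEN DERIV_chain2, OF this full_prob_has_derivative[OF c g r]]
    show "((\<lambda>t. ln (pr (\<theta>(?c := t)) (R, S, restrict x S) (restrict x R))) has_field_derivative D (R, S)) (at (\<theta> ?c))"
      unfolding D_def by (simp add: mult.commute)
  qed
  also have "(\<Sum>f\<in>F. D f) = (\<Sum>f\<in>F. if f = (R0, S0) then cell_score \<theta> ?c (restrict x S0) (restrict x R0) else 0)"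
  proof (intro sum.cong refl)
    fix f assume "f \<in> F"
    have pos: "0 < pr \<theta> (R0, S0, s0) r0" "0 < pr \<theta> (R0, S0, s0) (last_cell (R0, S0, s0))"
      using full_prob_pos[OF \<theta> g0(1)] last_cell[OF g0(1)] g0(2) by auto
    have ne: "r0 \<noteq> last_cell (R0, S0, s0)" using last_notin[OF g0(1)] g0(2) by auto
    show "D f = (if f = (R0, S0) then cell_score \<theta> ?c (restrict x S0) (restrict x R0) else 0)"
      using ne unfolding D_def cell_score_def by (cases f) (auto simp: diff_divide_distrib)
  qed
  also have "\<dots> = cell_score \<theta> ?c (restrict x S0) (restrict x R0)"
    using F0 perfect_factorsD(1)[OF factors] by simp
  finally show ?thesis .
qed

lemma theta_dist_score:
  assumes \<theta>: "\<theta> \<in> \<Theta>" and c: "((R, S, s), r) \<in> coord_set"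
  shows "((\<lambda>t. ln (lik N (\<theta>(((R, S, s), r) := t)) n)) has_field_derivative
    (\<Sum>i\<in>cells L V. real (n i) * cell_score \<theta> ((R, S, s), r) (restrict i S) (restrict i R))) (at (\<theta> ((R, S, s), r)))"
proof -
  let ?c = "((R, S, s), r)"
  have fin: "finite (cells L V)" by (rule finite_cells[OF levels order_refl])
  define K :: real where "K = ln (fact N / (\<Prod>i\<in>cells L V. fact (n i)))"
  define l where "l t = K + (\<Sum>i\<in>cells L V. real (n i) *
      (\<Sum>(R, S)\<in>F. ln (pr (\<theta>(?c := t)) (R, S, restrict i S) (restrict i R))))" for t
  have eq: "ln (lik N \<eta> n) =
      K + (\<Sum>i\<in>cells L V. real (n i) * (\<Sum>(R, S)\<in>F. ln (pr \<eta> (R, S, restrict i S) (restrict i R))))"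
    if \<eta>: "\<eta> \<in> \<Theta>" for \<eta>
  proof -
    have logp: "ln (theta_dist \<eta> i) = (\<Sum>(R, S)\<in>F. ln (pr \<eta> (R, S, restrict i S) (restrict i R)))"
      if i: "i \<in> cells L V" for i
    proof -
      have posRS: "0 < pr \<eta> (R, S, restrict i S) (restrict i R)" if "(R, S) \<in> F" for R S
      proof (rule full_prob_pos[OF \<eta>])
        have sub: "R \<subseteq> V" "S \<subseteq> V" using that perfect_factorsD(3)[OF factors] verts by force+
        show "(R, S, restrict i S) \<in> set gl" using that group_of_factor restrict_cells[OF i sub(2)] by blast
        show "restrict i R \<in> gcells (R, S, restrict i S)"
          unfolding gcells_def using restrict_cells[OF i sub(1)] by simp
      qed
      have "ln (\<Prod>(R, S)\<in>F. pr \<eta> (R, S, restrict i S) (restrict i R)) =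
          (\<Sum>f\<in>F. ln (case f of (R, S) \<Rightarrow> pr \<eta> (R, S, restrict i S) (restrict i R)))"
        using perfect_factorsD(1)[OF factors] by (intro ln_prod) (auto dest: posRS)
      then show ?thesis unfolding theta_dist_def factor_prod_def using i by (simp add: split_beta)
    qed
    have pos: "0 < theta_dist \<eta> i" if "i \<in> cells L V" for i using theta_dist_pos[OF \<eta> that] .
    have c1: "0 < fact N / (\<Prod>i\<in>cells L V. fact (n i) :: real)" by (intro divide_pos_pos prod_pos) auto
    have c2: "0 < (\<Prod>i\<in>cells L V. theta_dist \<eta> i ^ n i)" using pos by (intro prod_pos) auto
    have "ln (multinomial_prob V L N (theta_dist \<eta>) n) = K + ln (\<Prod>i\<in>cells L V. theta_dist \<eta> i ^ n i)"
      unfolding multinomial_prob_def K_def by (rule ln_mult_pos[OF c1 c2])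
    also have "ln (\<Prod>i\<in>cells L V. theta_dist \<eta> i ^ n i) = (\<Sum>i\<in>cells L V. ln (theta_dist \<eta> i ^ n i))"
      by (rule ln_prod[OF fin]) (auto dest: pos)
    also have "\<dots> = (\<Sum>i\<in>cells L V. real (n i) * ln (theta_dist \<eta> i))"
      by (intro sum.cong refl) (simp add: ln_realpow pos)
    finally show ?thesis unfolding cut_dist_eq[OF \<eta>] by (simp add: logp)
  qed
  have d: "(l has_field_derivative (\<Sum>i\<in>cells L V. real (n i) * cell_score \<theta> ?c (restrict i S) (restrict i R))) (at (\<theta> ?c))"
    unfolding l_def
    by (rule derivative_eq_intros DERIV_cmult DERIV_sum log_theta_dist_derivative[OF \<theta> c] refl | assumption | simp)+
  \<comment> \<open>The formula \<open>l\<close> and the log-likelihood are identified only near the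
    point, because off \<open>\<Theta>\<close> the value of \<open>cut_dist\<close> is arbitrary.
    Agreement nearby suffices for the derivative.\<close>
  have ev: "\<forall>\<^sub>F t in nhds (\<theta> ?c).
      l t = ln (lik N (\<theta>(?c := t)) n)"
    using eventually_update_Theta[OF \<theta> c]
  proof (rule eventually_mono)
    fix t assume "\<theta>(?c := t) \<in> \<Theta>"
    from eq[OF this] show "l t = ln (lik N (\<theta>(?c := t)) n)"
      unfolding l_def by (rule sym)
  qed
  show ?thesis by (rule iffD1[OF DERIV_cong_ev[OF refl ev refl] d])
qed

definition info_entry ::
  "nat \<Rightarrow> ('v, 'a) param \<Rightarrow> ('v, 'a) group \<times> ('v \<Rightarrow> 'a) \<Rightarrow> ('v, 'a) group \<times> ('v \<Rightarrow> 'a) \<Rightarrow> real" where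
  "info_entry N \<theta> c c' = of_bool (fst c = fst c') * (real N * sep_prob \<theta> (fst c) *
     (of_bool (c = c') / \<theta> c + 1 / pr \<theta> (fst c) (last_cell (fst c))))"

text \<open>The covariance matrix of a single multinomial draw, divided by the factor that
  multiplies the information. It is the rank-one update formula for inverses applied to
  \<open>info_entry\<close>.\<close>

definition inv_entry ::
  "nat \<Rightarrow> ('v, 'a) param \<Rightarrow> ('v, 'a) group \<times> ('v \<Rightarrow> 'a) \<Rightarrow> ('v, 'a) group \<times> ('v \<Rightarrow> 'a) \<Rightarrow> real" where
  "inv_entry N \<theta> c c' = of_bool (fst c = fst c') * ((of_bool (c = c') * \<theta> c - \<theta> c * \<theta> c') /
     (real N * sep_prob \<theta> (fst c)))"

lemma count_tables_eq: "counts N = tables (cells L V) N"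
  unfolding count_tables_def tables_def ..

lemma fisher_info_eq:
  assumes \<theta>: "\<theta> \<in> \<Theta>"
  shows "fisher_info (lik N) (counts N)
    (concat groups) \<theta> = entry_mat (concat groups) (info_entry N \<theta>)"
proof -
  let ?f = "lik N"
  have fin: "finite (cells L V)" by (rule finite_cells[OF levels order_refl])
  have "fisher_info ?f (counts N) (concat groups) \<theta> =
    entry_mat (concat groups) (\<lambda>c c'. \<Sum>n\<in>counts N. ?f \<theta> n * score ?f c \<theta> n * score ?f c' \<theta> n)"
    unfolding fisher_info_def entry_mat_def ..
  also have "\<dots> = entry_mat (concat groups) (info_entry N \<theta>)"
  proof (rule entry_mat_cong)
    fix c c' assume c: "c \<in> coord_set" "c' \<in> coord_set"
    obtain R S s r where cc: "c = ((R, S, s), r)" by (metis surj_pair)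
    obtain R' S' s' r' where cc': "c' = ((R', S', s'), r')" by (metis surj_pair)
    note c1 = c(1)[unfolded cc] and c2 = c(2)[unfolded cc']
    let ?u = "\<lambda>i. cell_score \<theta> ((R, S, s), r) (restrict i S) (restrict i R)"
    let ?v = "\<lambda>i. cell_score \<theta> ((R', S', s'), r') (restrict i S') (restrict i R')"
    have sc: "score ?f c \<theta> n = (\<Sum>i\<in>cells L V. real (n i) * ?u i)" "score ?f c' \<theta> n = (\<Sum>i\<in>cells L V. real (n i) * ?v i)" for n
      unfolding score_def cc cc' by (rule DERIV_imp_deriv, rule theta_dist_score[OF \<theta>], rule c1 c2)+
    have "(\<Sum>n\<in>counts N. ?f \<theta> n * score ?f c \<theta> n * score ?f c' \<theta> n) =
      real N * (\<Sum>i\<in>cells L V. theta_dist \<theta> i * (?u i * ?v i)) +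
      real N * (real N - 1) * ((\<Sum>i\<in>cells L V. theta_dist \<theta> i * ?u i) * (\<Sum>i\<in>cells L V. theta_dist \<theta> i * ?v i))"
      unfolding sc cut_dist_eq[OF \<theta>] count_tables_eq
      unfolding multinomial_prob_def mult_prob_def[symmetric]
      by (rule multinomial_covariance[OF fin sum_theta_dist[OF \<theta>]])
    also have "\<dots> = real N * (of_bool ((R, S, s) = (R', S', s')) * sep_prob \<theta> (R, S, s) *
      (of_bool (r = r') / pr \<theta> (R, S, s) r + 1 / pr \<theta> (R, S, s) (last_cell (R, S, s))))"
      unfolding sum_score_product[OF \<theta> c1 c2] sum_score[OF \<theta> c1] by simp
    also have "\<dots> = info_entry N \<theta> c c'"
      unfolding info_entry_def cc cc' using full_prob_coord[OF coordD(2)[OF c1]] by (cases "(R, S, s) = (R', S', s')") simp_all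
    finally show "(\<Sum>n\<in>counts N. ?f \<theta> n * score ?f c \<theta> n * score ?f c' \<theta> n) = info_entry N \<theta> c c'" .
  qed
  finally show ?thesis .
qed

lemma sep_prob_pos:
  assumes "\<theta> \<in> \<Theta>" "g \<in> set gl"
  shows "0 < sep_prob \<theta> g"
proof -
  obtain R S s where g: "g = (R, S, s)" by (cases g)
  have "0 < marginal V L (factor_prod F (pr \<theta>)) S s"
    by (rule marginal_pos[OF levels])
      (use factor_prod_pos[OF factors cond_family_full_prob[OF assms(1)]] verts groupD[of R S s] assms(2) g in auto)
  then show ?thesis unfolding sep_prob_def g marginal_eq_sum[OF levels] by simp
qed

lemma length_ordered_groups: "length groups = length gl"
  by (simp add: ordered_groups_def)

lemma nth_ordered_groups: "j < length gl \<Longrightarrow> groups ! j = map (Pair (gl ! j)) (fc (gl ! j))"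
  by (simp add: ordered_groups_def)

lemma distinct_coords: "distinct (concat groups)"
proof -
  have "distinct (concat (ordered_groups gs fc))" if "distinct gs" "\<And>g. g \<in> set gs \<Longrightarrow> distinct (fc g)" for gs
    using that by (induction gs) (auto simp: ordered_groups_def distinct_map inj_on_def)
  then show ?thesis using distinct_gl last_cell(3) by blast
qed

lemma block_inverse_info:
  assumes \<theta>: "\<theta> \<in> \<Theta>" and N: "N \<ge> 1"
  shows "block_inverse groups (info_entry N \<theta>) (inv_entry N \<theta>)"
proof
  show "distinct (concat groups)" by (rule distinct_coords)
next
  fix i j c c'
  assume ij: "i < length groups" "j < length groups" "i \<noteq> j"
    and c: "c \<in> set (groups ! i)" "c' \<in> set (groups ! j)"
  have "fst c = gl ! i" "fst c' = gl ! j" using ij c by (auto simp: nth_ordered_groups length_ordered_groups)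
  moreover have "gl ! i \<noteq> gl ! j" using ij distinct_gl by (simp add: length_ordered_groups nth_eq_iff_index_eq)
  ultimately show "info_entry N \<theta> c c' = 0 \<and> inv_entry N \<theta> c c' = 0" by (simp add: info_entry_def inv_entry_def)
next
  fix j c c'
  assume j: "j < length groups"
    and c: "c \<in> set (groups ! j)" "c' \<in> set (groups ! j)"
  define g where "g = gl ! j"
  have g: "g \<in> set gl" using j by (simp add: g_def length_ordered_groups)
  have setg: "set (groups ! j) = Pair g ` set (fc g)"
    using j by (simp add: nth_ordered_groups length_ordered_groups g_def)
  obtain r r' where r: "c = (g, r)" "r \<in> set (fc g)" "c' = (g, r')" "r' \<in> set (fc g)" using c unfolding setg by auto
  define q where "q \<rho> = \<theta> (g, \<rho>)" for \<rho>
  define l where "l = pr \<theta> g (last_cell g)"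
  define k where "k = real N * sep_prob \<theta> g"
  have k: "k \<noteq> 0" using N sep_prob_pos[OF \<theta> g] by (simp add: k_def)
  have l: "0 < l" unfolding l_def using full_prob_pos[OF \<theta> g] last_cell(1)[OF g] by blast
  have q: "0 < q \<rho>" if "\<rho> \<in> set (fc g)" for \<rho> using \<theta> g that unfolding cut_space_def q_def by auto
  have suml: "(\<Sum>\<rho>\<in>set (fc g). q \<rho>) = 1 - l" unfolding l_def q_def full_prob_last[OF g] by simp
  have comp: "(\<Sum>\<rho>\<in>set (fc g). (k * (of_bool (a = \<rho>) / q a + 1 / l)) * ((of_bool (\<rho> = b) * q \<rho> - q \<rho> * q b) / k)) = of_bool (a = b)"
    if a: "a \<in> set (fc g)" and b: "b \<in> set (fc g)" for a b
  proof -
    have "(\<Sum>\<rho>\<in>set (fc g). (k * (of_bool (a = \<rho>) / q a + 1 / l)) * ((of_bool (\<rho> = b) * q \<rho> - q \<rho> * q b) / k)) =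
      (\<Sum>\<rho>\<in>set (fc g). (if \<rho> = a then of_bool (a = b) - q b else 0) + (if \<rho> = b then q b / l else 0) - q b / l * q \<rho>)"
      using k l q[OF a] by (intro sum.cong refl) (auto simp: field_simps)
    also have "\<dots> = of_bool (a = b) - q b + q b / l - q b / l * (1 - l)"
      unfolding sum_subtractf sum.distrib sum_distrib_left[symmetric] suml using a b by simp
    also have "\<dots> = of_bool (a = b)" using l by (simp add: field_simps)
    finally show ?thesis .
  qed
  have "(\<Sum>e\<in>Pair g ` set (fc g). info_entry N \<theta> c e * inv_entry N \<theta> e c') =
      (\<Sum>\<rho>\<in>set (fc g). (k * (of_bool (r = \<rho>) / q r + 1 / l)) * ((of_bool (\<rho> = r') * q \<rho> - q \<rho> * q r') / k))"
    by (subst sum.reindex) (auto simp: inj_on_def r info_entry_def inv_entry_def k_def l_def q_def intro!: sum.cong)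
  \<comment> \<open>Both blocks are symmetric, so the product in the other order is the same
    computation with \<open>r\<close> and \<open>r'\<close> exchanged.\<close>
  moreover have "(\<Sum>e\<in>Pair g ` set (fc g). inv_entry N \<theta> c e * info_entry N \<theta> e c') =
      (\<Sum>\<rho>\<in>set (fc g). (k * (of_bool (r' = \<rho>) / q r' + 1 / l)) * ((of_bool (\<rho> = r) * q \<rho> - q \<rho> * q r) / k))"
    by (subst sum.reindex) (auto simp: inj_on_def r info_entry_def inv_entry_def k_def l_def q_def intro!: sum.cong)
  ultimately show "(\<Sum>e\<in>set (groups ! j). info_entry N \<theta> c e * inv_entry N \<theta> e c') = of_bool (c = c') \<and>
      (\<Sum>e\<in>set (groups ! j). inv_entry N \<theta> c e * info_entry N \<theta> e c') = of_bool (c = c')"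
    unfolding setg using comp[OF r(2,4)] comp[OF r(4,2)] by (auto simp: r)
qed

lemma det_h_block:
  assumes \<theta>: "\<theta> \<in> \<Theta>" and N: "N \<ge> 1" and j: "j < length gl"
  defines "f \<equiv> lik N" and "gs \<equiv> groups"
  shows "invertible_mat (fisher_info f (counts N) (concat gs) \<theta>)"
    "invertible_mat (Sigma_block f (counts N) gs j \<theta>)"
    "Determinant.det (h_block f (counts N) gs j \<theta>) =
      (real N * sep_prob \<theta> (gl ! j)) ^ length (fc (gl ! j)) * (\<Prod>r\<in>gcells (gl ! j). 1 / pr \<theta> (gl ! j) r)"
proof -
  interpret block_inverse gs "info_entry N \<theta>" "inv_entry N \<theta>"
    unfolding gs_def by (rule block_inverse_info[OF \<theta> N])
  have j': "j < length gs" using j by (simp add: gs_def length_ordered_groups)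
  have fi: "fisher_info f (counts N) (concat gs) \<theta> = entry_mat (concat gs) (info_entry N \<theta>)"
    unfolding f_def gs_def by (rule fisher_info_eq[OF \<theta>])
  show "invertible_mat (fisher_info f (counts N) (concat gs) \<theta>)"
    unfolding fi using entry_mat_inverses(3)[of "length gs"] by simp
  show "invertible_mat (Sigma_block f (counts N) gs j \<theta>)"
    unfolding h_block_eq(1)[OF fi j'] using entry_mat_inverses(4)[of "Suc j"] j' by simp
  define g where "g = gl ! j"
  have g: "g \<in> set gl" using j by (simp add: g_def)
  have gsj: "gs ! j = map (Pair g) (fc g)" using j by (simp add: gs_def nth_ordered_groups g_def)
  have d: "distinct (map (Pair g) (fc g))" using last_cell(3)[OF g] by (simp add: distinct_map inj_on_def)
  have "h_block f (counts N) gs j \<theta> = entry_mat (map (Pair g) (fc g))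
      (\<lambda>c c'. (real N * sep_prob \<theta> g) * (of_bool (c = c') / \<theta> c + 1 / pr \<theta> g (last_cell g)))"
    unfolding h_block_eq(2)[OF fi j'] gsj by (rule entry_mat_cong) (auto simp: info_entry_def)
  then have "Determinant.det (h_block f (counts N) gs j \<theta>) =
    (real N * sep_prob \<theta> g) ^ length (map (Pair g) (fc g)) *
      ((\<Prod>c\<in>set (map (Pair g) (fc g)). 1 / \<theta> c) * (1 / pr \<theta> g (last_cell g)))"
  proof (simp only:, intro det_multinomial_block d)
    show "0 < real N * sep_prob \<theta> g" using N sep_prob_pos[OF \<theta> g] by simp
    show "0 < \<theta> c" if "c \<in> set (map (Pair g) (fc g))" for c using \<theta> g that unfolding cut_space_def by auto
    show "0 < pr \<theta> g (last_cell g)" using full_prob_pos[OF \<theta> g] last_cell(1)[OF g] by blast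
    show "pr \<theta> g (last_cell g) + (\<Sum>c\<in>set (map (Pair g) (fc g)). \<theta> c) = 1"
      unfolding full_prob_last[OF g] by (simp add: sum.reindex inj_on_def)
  qed
  also have "(\<Prod>c\<in>set (map (Pair g) (fc g)). 1 / \<theta> c) * (1 / pr \<theta> g (last_cell g)) = (\<Prod>r\<in>gcells g. 1 / pr \<theta> g r)"
    unfolding prod_gcells[OF g] by (simp add: prod.reindex inj_on_def full_prob_coord)
  finally show "Determinant.det (h_block f (counts N) gs j \<theta>) =
      (real N * sep_prob \<theta> (gl ! j)) ^ length (fc (gl ! j)) * (\<Prod>r\<in>gcells (gl ! j). 1 / pr \<theta> (gl ! j) r)"
    by (simp add: g_def)
qed

end

section \<open>Reference priors of independent simplices\<close>

lemma simplex_powr_restrict: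
  "(\<And>c. c \<in> K \<Longrightarrow> x c = y c) \<Longrightarrow> simplex_powr a K x = simplex_powr a K y"
  "(\<And>c. c \<in> K \<Longrightarrow> x c = y c) \<Longrightarrow> x \<in> simplex_on K \<longleftrightarrow> y \<in> simplex_on K"
  by (auto simp: simplex_powr_def simplex_on_def cong: sum.cong prod.cong)

lemma measurable_merge_component:
  "(\<lambda>y. merge A B (\<eta>, y) c) \<in> borel_measurable (lborel_on B)"
  by (cases "c \<in> A"; cases "c \<in> B") (simp_all add: merge_def)

text \<open>This is \<open>ln y \<le> y - 1\<close> for \<open>y = x powr (-1/4)\<close>. The
  exponent is the gap between \<open>-1/2\<close> and \<open>-3/4\<close>.\<close>

lemma neg_ln_le_powr:
  assumes "0 < (x::real)"
  shows "- ln x \<le> 4 * x powr (-1/4)"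
proof -
  have "ln (x powr (-1/4)) \<le> x powr (-1/4) - 1" using assms by (intro ln_le_minus_one) simp
  then show ?thesis using assms by (simp add: ln_powr)
qed

context factor_model
begin

definition gcoords :: "('v, 'a) group \<Rightarrow> (('v, 'a) group \<times> ('v \<Rightarrow> 'a)) set" where
  "gcoords g = Pair g ` set (fc g)"

definition coords_of :: "('v, 'a) group set \<Rightarrow> (('v, 'a) group \<times> ('v \<Rightarrow> 'a)) set" where
  "coords_of G = (\<Union>g\<in>G. gcoords g)"

text \<open>The constraints of some groups only. Constraints never couple different groups, so
  membership in \<open>\<Theta>\<close> can be split along any partition of the groups.\<close>

definition valid :: "('v, 'a) group set \<Rightarrow> ('v, 'a) param \<Rightarrow> bool" where
  "valid G \<eta> \<longleftrightarrow> (\<forall>g\<in>G. \<eta> \<in> simplex_on (gcoords g))"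

lemma finite_gcoords: "finite (gcoords g)"
  by (simp add: gcoords_def)

lemma gcoords_disjoint: "g \<noteq> g' \<Longrightarrow> gcoords g \<inter> gcoords g' = {}"
  by (auto simp: gcoords_def)

lemma coords_of_disjoint: "G \<inter> G' = {} \<Longrightarrow> coords_of G \<inter> coords_of G' = {}"
  by (auto simp: coords_of_def gcoords_def)

lemma gcoords_subset: "g \<in> G \<Longrightarrow> gcoords g \<subseteq> coords_of G"
  by (auto simp: coords_of_def)

lemma set_concat_groups: "set (concat (ordered_groups gs fc)) = coords_of (set gs)"
  by (auto simp: ordered_groups_def coords_of_def gcoords_def)

lemma sum_gcoords: "(\<Sum>c\<in>gcoords g. u c) = (\<Sum>r\<in>set (fc g). u (g, r))"
  unfolding gcoords_def by (subst sum.reindex) (auto simp: inj_on_def)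

lemma prod_gcoords: "(\<Prod>c\<in>gcoords g. u c) = (\<Prod>r\<in>set (fc g). u (g, r))"
  unfolding gcoords_def by (subst prod.reindex) (auto simp: inj_on_def)

lemma mem_simplex_gcoords:
  "\<eta> \<in> simplex_on (gcoords g) \<longleftrightarrow> (\<forall>r\<in>set (fc g). 0 < \<eta> (g, r)) \<and> (\<Sum>r\<in>set (fc g). \<eta> (g, r)) < 1"
  unfolding simplex_on_def by (auto simp: sum_gcoords) (auto simp: gcoords_def)

lemma Theta_iff: "\<theta> \<in> \<Theta> \<longleftrightarrow> \<theta> \<in> extensional coord_set \<and> valid (set gl) \<theta>"
  unfolding cut_space_def valid_def mem_simplex_gcoords by blast

lemma full_prob_valid:
  assumes "\<eta> \<in> simplex_on (gcoords g)" "g \<in> set gl" "r \<in> gcells g"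
  shows "0 < pr \<eta> g r" "pr \<eta> g r \<le> 1"
proof -
  have pos: "0 < \<eta> (g, r')" if "r' \<in> set (fc g)" for r' using assms(1) that by (simp add: mem_simplex_gcoords)
  have le: "\<eta> (g, r') \<le> (\<Sum>r\<in>set (fc g). \<eta> (g, r))" if "r' \<in> set (fc g)" for r'
    using pos that by (intro member_le_sum) (auto intro: less_imp_le)
  have nn: "0 \<le> (\<Sum>r\<in>set (fc g). \<eta> (g, r))" using pos by (intro sum_nonneg) (auto intro: less_imp_le)
  have lt: "(\<Sum>r\<in>set (fc g). \<eta> (g, r)) < 1" using assms(1) by (simp add: mem_simplex_gcoords)
  consider "r = last_cell g" | "r \<in> set (fc g)" using assms(3) gcells_eq[OF assms(2)] by auto
  then show "0 < pr \<eta> g r" "pr \<eta> g r \<le> 1"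
    by (cases; use pos[of r] le[of r] nn lt in \<open>simp add: full_prob_last[OF assms(2)] full_prob_coord\<close>)+
qed

lemma full_prob_local: "(\<And>c. c \<in> gcoords g \<Longrightarrow> \<eta> c = \<eta>' c) \<Longrightarrow> pr \<eta> g r = pr \<eta>' g r"
  unfolding full_prob_def gcoords_def by (auto intro!: sum.cong)

lemma simplex_powr_gcoords:
  "g \<in> set gl \<Longrightarrow> simplex_powr a (gcoords g) \<eta> = (\<Prod>r\<in>gcells g. pr \<eta> g r powr a)"
  unfolding simplex_powr_def prod_gcells by (simp add: sum_gcoords prod_gcoords full_prob_last full_prob_coord)

text \<open>The multivariate beta function with all arguments \<open>1/2\<close>. It may stay an
  integral, since only its finiteness and positivity matter.\<close>

definition norm_const :: "('v, 'a) group \<Rightarrow> real" where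
  "norm_const g = (LINT y:simplex_on (gcoords g)|lborel_on (gcoords g). simplex_powr (-1/2) (gcoords g) y)"

lemma norm_const_pos: "0 < norm_const g"
  unfolding norm_const_def by (rule simplex_powr_integral(2)[OF finite_gcoords])

text \<open>The product of the normalized Dirichlet densities of the groups in \<open>G\<close>;
  this is what \<open>ref_tail\<close> will turn out to be on the parameter space.\<close>

definition prior_density :: "('v, 'a) group set \<Rightarrow> ('v, 'a) param \<Rightarrow> real" where
  "prior_density G y = (\<Prod>g\<in>G. simplex_powr (-1/2) (gcoords g) y / norm_const g)"

lemma prior_density_local:
  "(\<And>c. c \<in> coords_of G \<Longrightarrow> x c = y c) \<Longrightarrow> prior_density G x = prior_density G y"
  unfolding prior_density_def
  by (intro prod.cong refl arg_cong2[where f="(/)"] simplex_powr_restrict(1)) (blast dest: subsetD[OF gcoords_subset])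

lemma valid_local: "(\<And>c. c \<in> coords_of G \<Longrightarrow> x c = y c) \<Longrightarrow> valid G x \<longleftrightarrow> valid G y"
  unfolding valid_def by (intro ball_cong refl simplex_powr_restrict(2)) (blast dest: subsetD[OF gcoords_subset])

lemma indicator_valid: "finite G \<Longrightarrow> indicator {y. valid G y} y = (\<Prod>g\<in>G. indicator (simplex_on (gcoords g)) y :: real)"
  by (induction G rule: finite_induct) (auto simp: valid_def indicator_def)

text \<open>Constraint and density both factor over the groups, so Tonelli reduces everything to
  single simplices. The exponent is left free because it is needed twice: \<open>-1/2\<close> for
  the prior and \<open>-3/4\<close> for the dominating function.\<close>

lemma block_integral:
  assumes G: "finite G" and a: "\<And>g. g \<in> G \<Longrightarrow> 0 \<le> k g"
  shows "(\<lambda>y. indicator {y. valid G y} y * (\<Prod>g\<in>G. simplex_powr a (gcoords g) y * k g)) \<in> borel_measurable (lborel_on (coords_of G))"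
    "(\<integral>\<^sup>+y. ennreal (indicator {y. valid G y} y * (\<Prod>g\<in>G. simplex_powr a (gcoords g) y * k g)) \<partial>lborel_on (coords_of G)) =
      (\<Prod>g\<in>G. \<integral>\<^sup>+y. ennreal (indicator (simplex_on (gcoords g)) y * simplex_powr a (gcoords g) y * k g) \<partial>lborel_on (gcoords g))"
proof -
  define \<psi> where "\<psi> g y = indicator (simplex_on (gcoords g)) y * simplex_powr a (gcoords g) y * k g" for g y
  have nn: "0 \<le> \<psi> g y" if "g \<in> G" for g y
    unfolding \<psi>_def simplex_powr_def using a[OF that] by (intro mult_nonneg_nonneg prod_nonneg) auto
  have eq: "indicator {y. valid G y} y * (\<Prod>g\<in>G. simplex_powr a (gcoords g) y * k g) = (\<Prod>g\<in>G. \<psi> g y)" for y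
    unfolding indicator_valid[OF G] \<psi>_def prod.distrib by (simp add: mult.assoc)
  have meas: "\<psi> g \<in> borel_measurable (lborel_on (gcoords g))" for g
    unfolding \<psi>_def using measurable_simplex_powr[OF finite_gcoords, of a g] measurable_indicator_simplex_on[OF finite_gcoords, of g]
    by measurable
  have loc: "\<psi> g (restrict x (gcoords g)) = \<psi> g x" for g x
    unfolding \<psi>_def
    using simplex_powr_restrict[of "gcoords g" "restrict x (gcoords g)" x] by (simp add: indicator_def)
  have eq': "(\<Prod>g\<in>G. ennreal (\<psi> g y)) = ennreal (\<Prod>g\<in>G. \<psi> g y)" for y
    by (rule prod_ennreal) (rule nn)
  have em: "(\<lambda>y. ennreal (\<psi> g y)) \<in> borel_measurable (lborel_on (gcoords g))" for g using meas[of g] by simp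
  have "(\<lambda>y. \<Prod>g\<in>G. ennreal (\<psi> g y)) \<in> borel_measurable (lborel_on (\<Union>g\<in>G. gcoords g))"
    by (rule nn_integral_PiM_blocks(1)[OF G]) (simp_all add: finite_gcoords gcoords_disjoint em loc)
  then have bm: "(\<lambda>y. ennreal (\<Prod>g\<in>G. \<psi> g y)) \<in> borel_measurable (lborel_on (coords_of G))"
    unfolding eq' coords_of_def .
  have "(\<integral>\<^sup>+y. (\<Prod>g\<in>G. ennreal (\<psi> g y)) \<partial>lborel_on (\<Union>g\<in>G. gcoords g)) =
      (\<Prod>g\<in>G. \<integral>\<^sup>+y. ennreal (\<psi> g y) \<partial>lborel_on (gcoords g))"
    by (rule nn_integral_PiM_blocks(2)[OF G]) (simp_all add: finite_gcoords gcoords_disjoint em loc)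
  then have bi: "(\<integral>\<^sup>+y. ennreal (\<Prod>g\<in>G. \<psi> g y) \<partial>lborel_on (coords_of G)) =
      (\<Prod>g\<in>G. \<integral>\<^sup>+y. ennreal (\<psi> g y) \<partial>lborel_on (gcoords g))"
    unfolding eq' coords_of_def .
  \<comment> \<open>The block lemma speaks of extended nonnegative values; as all factors are
    nonnegative, \<open>enn2real\<close> brings back the real function.\<close>
  have "(\<lambda>y. enn2real (ennreal (\<Prod>g\<in>G. \<psi> g y))) \<in> borel_measurable (lborel_on (coords_of G))"
    using bm by measurable
  then show "(\<lambda>y. indicator {y. valid G y} y * (\<Prod>g\<in>G. simplex_powr a (gcoords g) y * k g)) \<in> borel_measurable (lborel_on (coords_of G))"
    unfolding eq by (simp add: prod_nonneg nn)
  show "(\<integral>\<^sup>+y. ennreal (indicator {y. valid G y} y * (\<Prod>g\<in>G. simplex_powr a (gcoords g) y * k g)) \<partial>lborel_on (coords_of G)) =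
      (\<Prod>g\<in>G. \<integral>\<^sup>+y. ennreal (indicator (simplex_on (gcoords g)) y * simplex_powr a (gcoords g) y * k g) \<partial>lborel_on (gcoords g))"
    unfolding eq using bi unfolding \<psi>_def .
qed

lemma prior_density_integral:
  assumes G: "finite G"
  shows "set_integrable (lborel_on (coords_of G)) {y. valid G y} (prior_density G)"
    "(LINT y:{y. valid G y}|lborel_on (coords_of G). prior_density G y) = 1"
proof -
  have k: "0 \<le> 1 / norm_const g" for g using norm_const_pos[of g] by simp
  have eq: "indicator {y. valid G y} y * prior_density G y =
      indicator {y. valid G y} y * (\<Prod>g\<in>G. simplex_powr (-1/2) (gcoords g) y * (1 / norm_const g))" for y
    unfolding prior_density_def by simp
  have one: "(\<integral>\<^sup>+y. ennreal (indicator (simplex_on (gcoords g)) y * simplex_powr (-1/2) (gcoords g) y * (1 / norm_const g)) \<partial>lborel_on (gcoords g)) = 1"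
    for g
  proof -
    let ?h = "\<lambda>y. indicator (simplex_on (gcoords g)) y * simplex_powr (-1/2) (gcoords g) y"
    have int: "integrable (lborel_on (gcoords g)) ?h"
      using simplex_powr_integral(1)[OF finite_gcoords, of g] by (simp add: set_integrable_def)
    have nn: "0 \<le> ?h y" for y by (auto simp: simplex_powr_def intro!: mult_nonneg_nonneg prod_nonneg)
    have "(\<integral>\<^sup>+y. ennreal (?h y * (1 / norm_const g)) \<partial>lborel_on (gcoords g)) =
        ennreal (integral\<^sup>L (lborel_on (gcoords g)) (\<lambda>y. ?h y * (1 / norm_const g)))"
      using int nn k by (intro nn_integral_eq_integral) (auto simp del: times_divide_eq_right)
    also have "integral\<^sup>L (lborel_on (gcoords g)) (\<lambda>y. ?h y * (1 / norm_const g)) = norm_const g * (1 / norm_const g)"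
      by (subst integral_mult_left_zero) (simp add: norm_const_def set_lebesgue_integral_def)
    finally show ?thesis using norm_const_pos[of g] by simp
  qed
  have nni: "(\<integral>\<^sup>+y. ennreal (indicator {y. valid G y} y * prior_density G y) \<partial>lborel_on (coords_of G)) = 1"
    unfolding eq block_integral(2)[where k="\<lambda>g. 1 / norm_const g", OF G k] one by simp
  have nn: "0 \<le> indicator {y. valid G y} y * prior_density G y" for y
    unfolding prior_density_def simplex_powr_def using less_imp_le[OF norm_const_pos]
    by (intro mult_nonneg_nonneg prod_nonneg divide_nonneg_nonneg) auto
  have meas: "(\<lambda>y. indicator {y. valid G y} y * prior_density G y) \<in> borel_measurable (lborel_on (coords_of G))"
    unfolding eq by (rule block_integral(1)[OF G k])
  show "set_integrable (lborel_on (coords_of G)) {y. valid G y} (prior_density G)"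
    unfolding set_integrable_def real_scaleR_def
    by (rule integrableI_nonneg[OF meas]) (simp_all add: nn nni)
  show "(LINT y:{y. valid G y}|lborel_on (coords_of G). prior_density G y) = 1"
    unfolding set_lebesgue_integral_def real_scaleR_def
    by (subst integral_eq_nn_integral[OF meas]) (simp_all add: nn nni)
qed

lemma dominating_integrable:
  assumes G: "finite G" "G \<subseteq> set gl"
  shows "integrable (lborel_on (coords_of G)) (\<lambda>y. indicator {y. valid G y} y * (\<Prod>g\<in>G. simplex_powr (-3/4) (gcoords g) y))"
proof (rule integrableI_nonneg)
  note b = block_integral[OF G(1), of "\<lambda>_. 1" "-3/4", simplified]
  show "(\<lambda>y. indicator {y. valid G y} y * (\<Prod>g\<in>G. simplex_powr (-3/4) (gcoords g) y)) \<in> borel_measurable (lborel_on (coords_of G))"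
    using b(1) by simp
  show "AE y in lborel_on (coords_of G). 0 \<le> indicator {y. valid G y} y * (\<Prod>g\<in>G. simplex_powr (-3/4) (gcoords g) y)"
    by (auto simp: simplex_powr_def intro!: mult_nonneg_nonneg prod_nonneg)
  have "(\<Prod>g\<in>G. \<integral>\<^sup>+y. ennreal (indicator (simplex_on (gcoords g)) y * simplex_powr (-3/4) (gcoords g) y) \<partial>lborel_on (gcoords g)) < \<infinity>"
    using G(1)
    by (induction G rule: finite_induct)
      (use nn_integral_simplex_powr[OF finite_gcoords] in \<open>auto simp: ennreal_mult_less_top\<close>)
  then show "(\<integral>\<^sup>+y. ennreal (indicator {y. valid G y} y * (\<Prod>g\<in>G. simplex_powr (-3/4) (gcoords g) y)) \<partial>lborel_on (coords_of G)) < \<infinity>"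
    using b(2) by simp
qed

text \<open>It serves two purposes: for the group being processed it is the part of the log
  determinant that depends on the group, and over all groups it bounds the logarithm of every
  \<open>sep_prob\<close>.\<close>

definition log_mass :: "('v, 'a) group set \<Rightarrow> ('v, 'a) param \<Rightarrow> real" where
  "log_mass G y = (\<Sum>g\<in>G. \<Sum>r\<in>gcells g. - ln (pr y g r))"

lemma log_mass_nonneg: "G \<subseteq> set gl \<Longrightarrow> valid G y \<Longrightarrow> 0 \<le> log_mass G y"
  unfolding log_mass_def valid_def
  by (intro sum_nonneg) (auto simp: full_prob_valid ln_le_zero_iff subset_iff)

text \<open>Each \<open>- ln\<close> is at most four times one factor of \<open>Q\<close>, hence at
  most \<open>4 * Q\<close> because all factors of \<open>Q\<close> are at least one. Multiplying by
  \<open>Q\<close> then adds \<open>-1/4\<close> to every exponent.\<close>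

lemma log_mass_bound:
  assumes G: "finite G" "G \<subseteq> set gl" and y: "valid G y"
  shows "(1 + log_mass G y) * (\<Prod>g\<in>G. simplex_powr (-1/2) (gcoords g) y) \<le>
    (1 + 4 * (\<Sum>g\<in>G. real (card (gcells g)))) * (\<Prod>g\<in>G. simplex_powr (-3/4) (gcoords g) y)"
proof -
  define Q where "Q = (\<Prod>g\<in>G. simplex_powr (-1/4) (gcoords g) y)"
  have p: "0 < pr y g r" "pr y g r \<le> 1" if "g \<in> G" "r \<in> gcells g" for g r
    using full_prob_valid[of y g r] y that G(2) unfolding valid_def by auto
  have ge1: "1 \<le> pr y g r powr (-1/4)" if "g \<in> G" "r \<in> gcells g" for g r
    using p[OF that] powr_mono'[of "-1/4" 0 "pr y g r"] by simp
  have Qeq: "Q = (\<Prod>g\<in>G. \<Prod>r\<in>gcells g. pr y g r powr (-1/4))"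
    unfolding Q_def using G(2) by (intro prod.cong refl simplex_powr_gcoords) auto
  have Q1: "1 \<le> Q" unfolding Qeq by (intro prod_ge_1 ge1)
  have le: "pr y g r powr (-1/4) \<le> Q" if g: "g \<in> G" and r: "r \<in> gcells g" for g r
  proof -
    have fin: "finite (gcells g)" using finite_gcells[of g] g G(2) by blast
    have "pr y g r powr (-1/4) \<le> pr y g r powr (-1/4) * (\<Prod>r\<in>gcells g - {r}. pr y g r powr (-1/4))"
      using prod_ge_1[of "gcells g - {r}" "\<lambda>r. pr y g r powr (-1/4)"] ge1[OF g] p[OF g r] by simp
    also have "\<dots> = (\<Prod>r\<in>gcells g. pr y g r powr (-1/4))" using fin r by (rule prod.remove[symmetric])
    also have "\<dots> \<le> (\<Prod>r\<in>gcells g. pr y g r powr (-1/4)) * (\<Prod>g\<in>G - {g}. \<Prod>r\<in>gcells g. pr y g r powr (-1/4))"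
    proof -
      have a: "1 \<le> (\<Prod>r\<in>gcells g'. pr y g' r powr (-1/4))" if "g' \<in> G" for g'
        by (intro prod_ge_1 ge1 that)
      have "1 \<le> (\<Prod>g\<in>G - {g}. \<Prod>r\<in>gcells g. pr y g r powr (-1/4))" by (intro prod_ge_1 a) auto
      from mult_left_mono[OF this, of "\<Prod>r\<in>gcells g. pr y g r powr (-1/4)"] show ?thesis using a[OF g] by simp
    qed
    also have "\<dots> = Q" unfolding Qeq using G(1) g by (rule prod.remove[symmetric])
    finally show ?thesis .
  qed
  have "log_mass G y \<le> (\<Sum>g\<in>G. \<Sum>r\<in>gcells g. 4 * Q)"
    unfolding log_mass_def
  proof (intro sum_mono)
    fix g r assume gr: "g \<in> G" "r \<in> gcells g"
    show "- ln (pr y g r) \<le> 4 * Q" using neg_ln_le_powr[OF p(1)[OF gr]] le[OF gr] by simp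
  qed
  also have "\<dots> = 4 * (\<Sum>g\<in>G. real (card (gcells g))) * Q" by (simp add: sum_distrib_left sum_distrib_right ac_simps)
  finally have "1 + log_mass G y \<le> (1 + 4 * (\<Sum>g\<in>G. real (card (gcells g)))) * Q"
    using Q1 by (simp add: distrib_right)
  then have "(1 + log_mass G y) * (\<Prod>g\<in>G. simplex_powr (-1/2) (gcoords g) y) \<le>
      (1 + 4 * (\<Sum>g\<in>G. real (card (gcells g)))) * Q * (\<Prod>g\<in>G. simplex_powr (-1/2) (gcoords g) y)"
    by (rule mult_right_mono) (auto simp: simplex_powr_def intro!: prod_nonneg mult_nonneg_nonneg)
  also have "\<dots> = (1 + 4 * (\<Sum>g\<in>G. real (card (gcells g)))) * (Q * (\<Prod>g\<in>G. simplex_powr (-1/2) (gcoords g) y))"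
    by (rule mult.assoc)
  also have "Q * (\<Prod>g\<in>G. simplex_powr (-1/2) (gcoords g) y) = (\<Prod>g\<in>G. simplex_powr (-3/4) (gcoords g) y)"
    unfolding Q_def prod.distrib[symmetric]
  proof (intro prod.cong refl)
    fix g assume "g \<in> G"
    then have "g \<in> set gl" using G(2) by auto
    then show "simplex_powr (-1/4) (gcoords g) y * simplex_powr (-1/2) (gcoords g) y = simplex_powr (-3/4) (gcoords g) y"
      unfolding simplex_powr_gcoords[OF \<open>g \<in> set gl\<close>] prod.distrib[symmetric] by (simp add: powr_add[symmetric])
  qed
  finally show ?thesis .
qed

text \<open>The conditioning cell is at least as likely as any full cell extending it, and the
  probability of a full cell is a product in which every factor selects one entry of one
  group.\<close>

lemma sep_prob_bound:
  assumes \<theta>: "\<theta> \<in> \<Theta>" and g: "g \<in> set gl"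
  shows "\<bar>ln (sep_prob \<theta> g)\<bar> \<le> log_mass (set gl) \<theta>"
proof -
  obtain R S s where gg: "g = (R, S, s)" by (cases g)
  note s = groupD(2,4)[OF g[unfolded gg]]
  have fin: "finite (cells L V)" by (rule finite_cells[OF levels order_refl])
  have pos: "0 < factor_prod F (pr \<theta>) x" if "x \<in> cells L V" for x
    using factor_prod_pos[OF factors cond_family_full_prob[OF \<theta>] that] verts by simp
  have "sep_prob \<theta> g \<le> (\<Sum>x\<in>cells L V. factor_prod F (pr \<theta>) x)"
    unfolding sep_prob_def using pos by (intro sum_mono) (auto intro: less_imp_le)
  then have le1: "sep_prob \<theta> g \<le> 1" using sum_factor_prod[OF factors cond_family_full_prob[OF \<theta>]] verts by simp
  obtain z where z: "z \<in> cells L V" using cells_nonempty[OF levels order_refl] by auto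
  \<comment> \<open>Any cell extending \<open>s\<close> will do.\<close>
  define x where "x = merge S (V - S) (s, z)"
  have "merge S (V - S) (s, restrict z (V - S)) \<in> cells L (S \<union> (V - S))"
    using s z by (intro merge_cells restrict_cells[of z V L]) auto
  moreover have "S \<union> (V - S) = V" using s(2) by auto
  ultimately have x: "x \<in> cells L V" unfolding x_def merge_restrict by (simp only:)
  have xs: "restrict x S = s" unfolding x_def using s(1) by (simp add: restrict_merge_left restrict_cells_eq)
  have "factor_prod F (pr \<theta>) x * of_bool (restrict x S = s) \<le> sep_prob \<theta> g"
    unfolding sep_prob_def gg fst_conv snd_conv
    by (rule member_le_sum[of x "cells L V" "\<lambda>x. factor_prod F (pr \<theta>) x * of_bool (restrict x S = s)"])
      (use fin x pos in \<open>auto intro: less_imp_le\<close>)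
  then have "ln (factor_prod F (pr \<theta>) x) \<le> ln (sep_prob \<theta> g)"
    using pos[OF x] xs by (subst ln_le_cancel_iff) auto
  then have "- ln (sep_prob \<theta> g) \<le> - ln (factor_prod F (pr \<theta>) x)" by simp
  also have "\<dots> \<le> log_mass (set gl) \<theta>"
  proof -
    \<comment> \<open>\<open>h\<close> sends a factor to the group and entry that \<open>x\<close>
      selects in it. It is injective, so the sum over factors is part of the sum of nonnegative
      terms that makes up \<open>log_mass\<close>.\<close>
    define h where "h = (\<lambda>(R, S). ((R, S, restrict x S), restrict x R))"
    have hmem: "h f \<in> Sigma (set gl) gcells" if "f \<in> F" for f
    proof -
      obtain R S where f: "f = (R, S)" by (cases f)
      have sub: "R \<subseteq> V" "S \<subseteq> V" using that perfect_factorsD(3)[OF factors] verts unfolding f by force+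
      show ?thesis unfolding h_def f
        using that[unfolded f] group_of_factor restrict_cells[OF x sub(1)] restrict_cells[OF x sub(2)] by (auto simp: gcells_def)
    qed
    have inj: "inj_on h F" by (auto simp: inj_on_def h_def)
    have finF: "finite F" by (rule perfect_factorsD(1)[OF factors])
    have hp: "0 < pr \<theta> (fst (h f)) (snd (h f))" if "f \<in> F" for f
      using hmem[OF that] full_prob_pos[OF \<theta>] by (metis SigmaE fst_conv snd_conv)
    have fp: "factor_prod F (pr \<theta>) x = (\<Prod>f\<in>F. pr \<theta> (fst (h f)) (snd (h f)))"
      unfolding factor_prod_def h_def by (intro prod.cong refl) auto
    have "- ln (factor_prod F (pr \<theta>) x) = (\<Sum>f\<in>F. - ln (pr \<theta> (fst (h f)) (snd (h f))))"
      unfolding fp by (subst ln_prod[OF finF]) (auto dest: hp simp: sum_negf)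
    also have "\<dots> = (\<Sum>z\<in>h ` F. - ln (pr \<theta> (fst z) (snd z)))"
      using inj by (simp add: sum.reindex)
    also have "\<dots> \<le> (\<Sum>z\<in>Sigma (set gl) gcells. - ln (pr \<theta> (fst z) (snd z)))"
    proof (rule sum_mono2)
      show "finite (Sigma (set gl) gcells)" using finite_gcells by auto
      show "0 \<le> - ln (pr \<theta> (fst z) (snd z))" if "z \<in> Sigma (set gl) gcells - h ` F" for z
        using that full_prob_pos[OF \<theta>] full_prob_le_1[OF \<theta>] by (auto simp: ln_le_zero_iff)
    qed (rule image_subsetI, rule hmem)
    also have "\<dots> = log_mass (set gl) \<theta>"
      unfolding log_mass_def using finite_gcells by (subst sum.Sigma) (auto simp: split_beta)
    finally show ?thesis .
  qed
  finally show ?thesis using le1 sep_prob_pos[OF \<theta> g] by (simp add: abs_of_nonpos ln_le_zero_iff)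
qed

text \<open>Changing the coordinates of \<open>g\<close> affects only the factor
  \<open>(R, S)\<close>, which does not enter the law of its own separator.\<close>

lemma sep_prob_local:
  assumes "\<theta> \<in> \<Theta>" "\<theta>' \<in> \<Theta>" and g: "g \<in> set gl" and eq: "\<And>c. c \<notin> gcoords g \<Longrightarrow> \<theta> c = \<theta>' c"
  shows "sep_prob \<theta> g = sep_prob \<theta>' g"
proof -
  obtain R S s where gg: "g = (R, S, s)" by (cases g)
  have "(\<Sum>x\<in>cells L (verts F). factor_prod F (pr \<theta>) x * of_bool (restrict x S = s)) =
    (\<Sum>x\<in>cells L (verts F). factor_prod F (pr \<theta>') x * of_bool (restrict x S = s))"
  proof (rule expectation_separator_cong[OF factors cond_family_full_prob[OF assms(1)] cond_family_full_prob[OF assms(2)]])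
    show "(R, S) \<in> F" by (rule groupD(1)[OF g[unfolded gg]])
    fix R' S' s' r assume "(R', S') \<noteq> (R, S)"
    then have "(R', S', s') \<noteq> g" by (auto simp: gg)
    from gcoords_disjoint[OF this] show "pr \<theta> (R', S', s') r = pr \<theta>' (R', S', s') r"
      by (intro full_prob_local eq) auto
  qed
  then show ?thesis unfolding sep_prob_def gg verts by simp
qed

lemma measurable_sep_prob:
  "(\<lambda>y. sep_prob (merge A B (\<eta>, y)) g) \<in> borel_measurable (lborel_on B)"
proof -
  have "(\<lambda>y. pr (merge A B (\<eta>, y)) g' r) \<in> borel_measurable (lborel_on B)" for g' r
    unfolding full_prob_def
    by (cases "r \<in> set (fc g')") (auto intro!: borel_measurable_diff borel_measurable_sum measurable_merge_component)
  then show ?thesis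
    unfolding sep_prob_def factor_prod_def split_beta
    by (intro borel_measurable_sum borel_measurable_times borel_measurable_prod borel_measurable_const)
qed

abbreviation "before j \<equiv> set (take j gl)"
abbreviation "upto_group j \<equiv> set (take (Suc j) gl)"
abbreviation "after j \<equiv> set (drop (Suc j) gl)"

text \<open>The same combination as \<open>with_after\<close>, described by groups instead of lists
  of coordinates.\<close>

definition extend :: "nat \<Rightarrow> ('v, 'a) param \<Rightarrow> ('v, 'a) param \<Rightarrow>
    (('v, 'a) group \<times> ('v \<Rightarrow> 'a)) \<Rightarrow> real" where
  "extend j \<eta> y = merge (coords_of (upto_group j)) (coords_of (after j)) (\<eta>, y)"

lemma coords_take: "set (concat (take k groups)) = coords_of (set (take k gl))"
  using set_concat_groups[of "take k gl"] by (simp add: ordered_groups_def take_map)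

lemma coords_drop: "set (concat (drop k groups)) = coords_of (set (drop k gl))"
  using set_concat_groups[of "drop k gl"] by (simp add: ordered_groups_def drop_map)

lemma coords_nth: "j < length gl \<Longrightarrow> set (groups ! j) = gcoords (gl ! j)"
  by (simp add: nth_ordered_groups gcoords_def)

lemma upto_after: "upto_group j \<union> after j = set gl" "upto_group j \<inter> after j = {}"
proof -
  show "upto_group j \<union> after j = set gl"
    using set_append[of "take (Suc j) gl" "drop (Suc j) gl"] unfolding append_take_drop_id by (rule sym)
  show "upto_group j \<inter> after j = {}"
    using distinct_gl distinct_append[of "take (Suc j) gl" "drop (Suc j) gl"] unfolding append_take_drop_id by blast
qed

lemma upto_insert: "j < length gl \<Longrightarrow> upto_group j = insert (gl ! j) (before j)"
  by (simp add: take_Suc_conv_app_nth)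

lemma nth_notin_before: "j < length gl \<Longrightarrow> gl ! j \<notin> before j"
  using distinct_gl by (metis distinct_take nth_append_length take_Suc_conv_app_nth distinct.simps(2)
      distinct_append disjoint_iff list.set_intros(1))

lemma coords_of_Un: "coords_of (G \<union> G') = coords_of G \<union> coords_of G'"
  by (simp add: coords_of_def)

lemma valid_Un: "valid (G \<union> G') \<eta> \<longleftrightarrow> valid G \<eta> \<and> valid G' \<eta>"
  by (auto simp: valid_def)

lemma valid_subset: "G \<subseteq> G' \<Longrightarrow> valid G' \<eta> \<Longrightarrow> valid G \<eta>"
  unfolding valid_def by blast

lemma Theta_valid: "\<theta> \<in> \<Theta> \<Longrightarrow> G \<subseteq> set gl \<Longrightarrow> valid G \<theta>"
  using Theta_iff valid_subset by blast

lemma extend_upto: "c \<in> coords_of (upto_group j) \<Longrightarrow> extend j \<eta> y c = \<eta> c"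
  by (simp add: extend_def merge_def)

lemma extend_after: "c \<in> coords_of (after j) \<Longrightarrow> extend j \<eta> y c = y c"
  using coords_of_disjoint[OF upto_after(2)[of j]] by (auto simp: extend_def merge_def)

lemma extend_mem: "extend j \<eta> y \<in> \<Theta> \<longleftrightarrow> valid (upto_group j) \<eta> \<and> valid (after j) y"
proof -
  have "extend j \<eta> y \<in> extensional coord_set"
    unfolding set_concat_groups extend_def upto_after(1)[of j, symmetric] coords_of_Un by (rule extensional_merge)
  then have "extend j \<eta> y \<in> \<Theta> \<longleftrightarrow> valid (upto_group j \<union> after j) (extend j \<eta> y)"
    unfolding Theta_iff upto_after(1) by blast
  also have "\<dots> \<longleftrightarrow> valid (upto_group j) \<eta> \<and> valid (after j) y"
    unfolding valid_Un using valid_local[of "upto_group j" "extend j \<eta> y" \<eta>] valid_local[of "after j" "extend j \<eta> y" y]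
    by (simp add: extend_upto extend_after)
  finally show ?thesis .
qed

text \<open>Because constraints act within single groups, the values allowed for group
  \<open>j\<close> form its full simplex, whatever the earlier groups are.\<close>

lemma group_range_eq:
  assumes j: "j < length gl" and \<theta>: "\<theta> \<in> \<Theta>"
  shows "merge (coords_of (before j)) (gcoords (gl ! j)) (\<theta>, y) \<in> (\<lambda>\<eta>. restrict \<eta> (coords_of (upto_group j))) ` \<Theta> \<longleftrightarrow>
    y \<in> simplex_on (gcoords (gl ! j))"
    "y \<in> simplex_on (gcoords (gl ! j)) \<Longrightarrow> valid (upto_group j) (merge (coords_of (before j)) (gcoords (gl ! j)) (\<theta>, y))"
proof -
  let ?m = "merge (coords_of (before j)) (gcoords (gl ! j)) (\<theta>, y)"
  have disj: "coords_of (before j) \<inter> gcoords (gl ! j) = {}"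
    using coords_of_disjoint[of "before j" "{gl ! j}"] nth_notin_before[OF j] by (simp add: coords_of_def)
  have up: "coords_of (upto_group j) = coords_of (before j) \<union> gcoords (gl ! j)"
    unfolding upto_insert[OF j] by (auto simp: coords_of_def)
  have m1: "?m c = \<theta> c" if "c \<in> coords_of (before j)" for c using that by (simp add: merge_def)
  have m2: "?m c = y c" if "c \<in> gcoords (gl ! j)" for c using that disj by (auto simp: merge_def)
  have b: "valid (before j) \<theta>" "valid (after j) \<theta>" "valid (upto_group j) \<theta>"
    by (intro Theta_valid[OF \<theta>] set_take_subset set_drop_subset)+
  have v: "valid (upto_group j) ?m \<longleftrightarrow> y \<in> simplex_on (gcoords (gl ! j))"
  proof -
    have "valid (upto_group j) ?m \<longleftrightarrow> ?m \<in> simplex_on (gcoords (gl ! j)) \<and> valid (before j) ?m"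
      unfolding upto_insert[OF j] by (simp add: valid_def)
    also have "\<dots> \<longleftrightarrow> y \<in> simplex_on (gcoords (gl ! j)) \<and> valid (before j) \<theta>"
      using simplex_powr_restrict(2)[of "gcoords (gl ! j)" ?m y] valid_local[of "before j" ?m \<theta>] m1 m2 by auto
    finally show ?thesis using b by simp
  qed
  then show "y \<in> simplex_on (gcoords (gl ! j)) \<Longrightarrow> valid (upto_group j) ?m" by simp
  show "?m \<in> (\<lambda>\<eta>. restrict \<eta> (coords_of (upto_group j))) ` \<Theta> \<longleftrightarrow> y \<in> simplex_on (gcoords (gl ! j))"
  proof
    assume "?m \<in> (\<lambda>\<eta>. restrict \<eta> (coords_of (upto_group j))) ` \<Theta>"
    then obtain \<eta> where \<eta>: "\<eta> \<in> \<Theta>" "?m = restrict \<eta> (coords_of (upto_group j))" by blast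
    have "valid (upto_group j) \<eta>" by (intro Theta_valid[OF \<eta>(1)] set_take_subset)
    then have "valid (upto_group j) ?m" unfolding \<eta>(2) by (subst valid_local[of _ _ \<eta>]) auto
    then show "y \<in> simplex_on (gcoords (gl ! j))" unfolding v .
  next
    assume "y \<in> simplex_on (gcoords (gl ! j))"
    \<comment> \<open>The partial parameter is completed by the later coordinates of
      \<open>\<theta>\<close> itself, which gives the required member of
      \<open>\<Theta>\<close>.\<close>
    then have e1: "extend j ?m \<theta> \<in> \<Theta>" unfolding extend_mem v using b by simp
    have e2: "?m = restrict (extend j ?m \<theta>) (coords_of (upto_group j))"
    proof
      fix c
      show "?m c = restrict (extend j ?m \<theta>) (coords_of (upto_group j)) c"
      proof (cases "c \<in> coords_of (upto_group j)")
        case True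
        then show ?thesis by (simp add: extend_upto)
      next
        case False
        then show ?thesis unfolding up by (simp add: merge_def)
      qed
    qed
    have "restrict (extend j ?m \<theta>) (coords_of (upto_group j)) \<in> (\<lambda>\<eta>. restrict \<eta> (coords_of (upto_group j))) ` \<Theta>"
      by (rule imageI[OF e1])
    then show "?m \<in> (\<lambda>\<eta>. restrict \<eta> (coords_of (upto_group j))) ` \<Theta>" unfolding e2[symmetric] .
  qed
qed

text \<open>The average, over the later groups, of the part of the log determinant that comes from
  the scalar factor of the information block.\<close>

definition mean_log :: "nat \<Rightarrow> nat \<Rightarrow> ('v, 'a) param \<Rightarrow> real" where
  "mean_log N j \<eta> = (LINT y:{y. valid (after j) y}|lborel_on (coords_of (after j)).
     real (length (fc (gl ! j))) * ln (real N * sep_prob (extend j \<eta> y) (gl ! j)) * prior_density (after j) y)"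

lemma log_mass_local: "(\<And>c. c \<in> coords_of G \<Longrightarrow> x c = y c) \<Longrightarrow> log_mass G x = log_mass G y"
  unfolding log_mass_def
proof (intro sum.cong refl)
  fix g r assume *: "\<And>c. c \<in> coords_of G \<Longrightarrow> x c = y c" "g \<in> G"
  have "pr x g r = pr y g r" using * gcoords_subset by (intro full_prob_local) blast
  then show "- ln (pr x g r) = - ln (pr y g r)" by simp
qed

text \<open>The logarithm is bounded by a constant, depending on the fixed groups, plus the
  \<open>log_mass\<close> of the later groups; times the prior density this is dominated by powers
  with exponent \<open>-3/4\<close>.\<close>

lemma mean_log_integrable:
  assumes j: "j < length gl" and N: "N \<ge> 1" and \<eta>: "valid (upto_group j) \<eta>"
  shows "set_integrable (lborel_on (coords_of (after j))) {y. valid (after j) y}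
    (\<lambda>y. real (length (fc (gl ! j))) * ln (real N * sep_prob (extend j \<eta> y) (gl ! j)) * prior_density (after j) y)"
proof -
  let ?A = "after j"
  let ?M = "lborel_on (coords_of ?A)"
  let ?l = "\<lambda>y. real (length (fc (gl ! j))) * ln (real N * sep_prob (extend j \<eta> y) (gl ! j))"
  \<comment> \<open>The summand one makes \<open>c0 \<ge> 1\<close>, so that
    \<open>c0 + log_mass\<close> is at most \<open>c0 * (1 + log_mass)\<close>, the shape
    \<open>log_mass_bound\<close> expects.\<close>
  define c0 where "c0 = 1 + ln (real N) + log_mass (upto_group j) \<eta>"
  define Z where "Z = (\<Prod>g\<in>?A. 1 / norm_const g)"
  define C where "C = real (length (fc (gl ! j))) * c0 * Z * (1 + 4 * (\<Sum>g\<in>?A. real (card (gcells g))))"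
  have A: "finite ?A" "?A \<subseteq> set gl" and U: "upto_group j \<subseteq> set gl" by (simp_all only: set_drop_subset set_take_subset finite_set)
  have g: "gl ! j \<in> set gl" using j by simp
  have Z: "0 \<le> Z" unfolding Z_def using less_imp_le[OF norm_const_pos] by (intro prod_nonneg) auto
  have dens: "prior_density ?A y = (\<Prod>g\<in>?A. simplex_powr (-1/2) (gcoords g) y) * Z" for y
    unfolding prior_density_def Z_def prod.distrib[symmetric] by simp
  have c0: "0 \<le> c0" "1 \<le> c0" unfolding c0_def using log_mass_nonneg[OF U \<eta>] N by simp_all
  have bound: "\<bar>?l y * prior_density ?A y\<bar> \<le> C * (\<Prod>g\<in>?A. simplex_powr (-3/4) (gcoords g) y)" if y: "valid ?A y" for y
  proof -
    have mem: "extend j \<eta> y \<in> \<Theta>" using \<eta> y by (simp add: extend_mem)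
    have sp: "0 < sep_prob (extend j \<eta> y) (gl ! j)" using sep_prob_pos[OF mem g] .
    have split: "log_mass (set gl) (extend j \<eta> y) = log_mass (upto_group j) \<eta> + log_mass ?A y"
    proof -
      have "log_mass (set gl) (extend j \<eta> y) = log_mass (upto_group j) (extend j \<eta> y) + log_mass ?A (extend j \<eta> y)"
        unfolding log_mass_def upto_after(1)[of j, symmetric] by (rule sum.union_disjoint) (simp_all add: upto_after(2))
      then show ?thesis using log_mass_local[of "upto_group j" "extend j \<eta> y" \<eta>] log_mass_local[of ?A "extend j \<eta> y" y]
        by (simp add: extend_upto extend_after)
    qed
    have lm: "0 \<le> log_mass ?A y" by (rule log_mass_nonneg[OF A(2) y])
    have "\<bar>ln (real N * sep_prob (extend j \<eta> y) (gl ! j))\<bar> \<le> ln (real N) + \<bar>ln (sep_prob (extend j \<eta> y) (gl ! j))\<bar>"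
    proof -
      have "ln (real N * sep_prob (extend j \<eta> y) (gl ! j)) = ln (real N) + ln (sep_prob (extend j \<eta> y) (gl ! j))"
        using N sp by (intro ln_mult_pos) simp_all
      moreover have "0 \<le> ln (real N)" using N by simp
      ultimately show ?thesis by linarith
    qed
    also have "\<dots> \<le> ln (real N) + (log_mass (upto_group j) \<eta> + log_mass ?A y)"
      using sep_prob_bound[OF mem g] unfolding split by simp
    also have "\<dots> \<le> c0 + log_mass ?A y" by (simp add: c0_def)
    also have "\<dots> \<le> c0 + c0 * log_mass ?A y" using mult_right_mono[OF c0(2) lm] by simp
    finally have ln: "\<bar>ln (real N * sep_prob (extend j \<eta> y) (gl ! j))\<bar> \<le> c0 * (1 + log_mass ?A y)"
      by (simp add: distrib_left)
    have P: "0 \<le> (\<Prod>g\<in>?A. simplex_powr (-1/2) (gcoords g) y)"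
      by (auto simp: simplex_powr_def intro!: prod_nonneg mult_nonneg_nonneg)
    have "\<bar>?l y * prior_density ?A y\<bar> =
        real (length (fc (gl ! j))) * \<bar>ln (real N * sep_prob (extend j \<eta> y) (gl ! j))\<bar> * ((\<Prod>g\<in>?A. simplex_powr (-1/2) (gcoords g) y) * Z)"
      unfolding dens abs_mult using P Z by (simp add: abs_mult)
    also have "\<dots> \<le> real (length (fc (gl ! j))) * (c0 * (1 + log_mass ?A y)) * ((\<Prod>g\<in>?A. simplex_powr (-1/2) (gcoords g) y) * Z)"
      using ln P Z by (intro mult_right_mono mult_left_mono mult_nonneg_nonneg) auto
    also have "\<dots> = (real (length (fc (gl ! j))) * c0 * Z) * ((1 + log_mass ?A y) * (\<Prod>g\<in>?A. simplex_powr (-1/2) (gcoords g) y))"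
      by (simp only: ac_simps)
    also have "\<dots> \<le> (real (length (fc (gl ! j))) * c0 * Z) * ((1 + 4 * (\<Sum>g\<in>?A. real (card (gcells g)))) * (\<Prod>g\<in>?A. simplex_powr (-3/4) (gcoords g) y))"
      using log_mass_bound[OF A y] c0 Z by (intro mult_left_mono mult_nonneg_nonneg) auto
    finally show ?thesis unfolding C_def by (simp only: mult.assoc)
  qed
  have meas: "(\<lambda>y. indicator {y. valid ?A y} y * (?l y * prior_density ?A y)) \<in> borel_measurable ?M"
  proof -
    have a: "(\<lambda>y. indicator {y. valid ?A y} y * prior_density ?A y) \<in> borel_measurable ?M"
      using prior_density_integral(1)[OF A(1)] unfolding set_integrable_def by (simp add: borel_measurable_integrable)
    have [measurable]: "(\<lambda>y. sep_prob (extend j \<eta> y) (gl ! j)) \<in> borel_measurable ?M"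
      unfolding extend_def by (rule measurable_sep_prob)
    have b: "?l \<in> borel_measurable ?M" by measurable
    have "(\<lambda>y. ?l y * (indicator {y. valid ?A y} y * prior_density ?A y)) \<in> borel_measurable ?M"
      by (rule borel_measurable_times[OF b a])
    then show ?thesis by (simp add: ac_simps)
  qed
  show ?thesis
    unfolding set_integrable_def real_scaleR_def
  proof (rule Bochner_Integration.integrable_bound[OF integrable_mult_right[OF dominating_integrable[OF A], of C] meas], rule AE_I2)
    fix y
    show "norm (indicator {y. valid ?A y} y * (?l y * prior_density ?A y)) \<le>
        norm (C * (indicator {y. valid ?A y} y * (\<Prod>g\<in>?A. simplex_powr (-3/4) (gcoords g) y)))"
      using bound[of y] by (cases "valid ?A y") auto
  qed
qed

text \<open>Agreement is asked only on the groups before \<open>j\<close>: the value is constant in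
  group \<open>j\<close> itself, so it cancels between the kernel and its normalizing
  integral.\<close>

lemma mean_log_local:
  assumes "j < length gl" "valid (upto_group j) \<eta>" "valid (upto_group j) \<eta>'"
    and eq: "\<And>c. c \<in> coords_of (before j) \<Longrightarrow> \<eta> c = \<eta>' c"
  shows "mean_log N j \<eta> = mean_log N j \<eta>'"
proof -
  have "sep_prob (extend j \<eta> y) (gl ! j) = sep_prob (extend j \<eta>' y) (gl ! j)" if "valid (after j) y" for y
  proof (rule sep_prob_local)
    show "extend j \<eta> y \<in> \<Theta>" "extend j \<eta>' y \<in> \<Theta>" using assms that by (simp_all add: extend_mem)
    show "gl ! j \<in> set gl" using assms(1) by simp
    fix c assume c: "c \<notin> gcoords (gl ! j)"
    have "coords_of (upto_group j) = gcoords (gl ! j) \<union> coords_of (before j)"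
      unfolding upto_insert[OF assms(1)] by (simp add: coords_of_def)
    then show "extend j \<eta> y c = extend j \<eta>' y c"
      unfolding extend_def using eq[of c] c by (auto simp: merge_def)
  qed
  then show ?thesis unfolding mean_log_def set_lebesgue_integral_def
    by (intro Bochner_Integration.integral_cong refl) (auto simp: indicator_def)
qed

lemma with_after_eq:
  "merge (set (concat (take (Suc j) groups))) (set (concat (drop (Suc j) groups))) (\<eta>, y) = extend j \<eta> y"
  unfolding coords_take coords_drop extend_def ..

text \<open>One step of the backward recursion. The log determinant is the scalar part plus
  \<open>log_mass {g}\<close>; the latter is constant in the later groups, whose density has mass
  one, and half of it exponentiates to the Dirichlet kernel with exponent
  \<open>-1/2\<close>.\<close>

lemma prior_step:
  fixes N j :: nat and w :: "('v, 'a) param \<Rightarrow> real"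
  defines "f \<equiv> lik N" and "X \<equiv> counts N"
    and "gs \<equiv> groups"
  assumes j: "j < length gl" and N: "N \<ge> 1" and w: "\<forall>\<theta>\<in>\<Theta>. w \<theta> = prior_density (after j) \<theta>"
  shows "valid (upto_group j) \<eta> \<Longrightarrow> set_integrable (lborel_on (coords_after gs j)) (after_range gs \<Theta> j \<eta>)
      (\<lambda>y. log_det_integrand f X gs j w (with_after gs j \<eta> y))" (is "_ \<Longrightarrow> ?int \<eta>")
    and "valid (upto_group j) \<eta> \<Longrightarrow> ref_kernel f X gs \<Theta> j w \<eta> =
      exp (mean_log N j \<eta> / 2) * simplex_powr (-1/2) (gcoords (gl ! j)) \<eta>" (is "_ \<Longrightarrow> ?ker \<eta>")
    and "\<theta> \<in> \<Theta> \<Longrightarrow> set_integrable (lborel_on (set (gs ! j))) (group_range gs \<Theta> j \<theta>)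
      (\<lambda>y. ref_kernel f X gs \<Theta> j w (with_group gs j \<theta> y))"
    and "\<theta> \<in> \<Theta> \<Longrightarrow> ref_normalizer f X gs \<Theta> j w \<theta> = exp (mean_log N j \<theta> / 2) * norm_const (gl ! j)"
proof -
  define g where "g = gl ! j"
  define M where "M = lborel_on (coords_of (after j))"
  have g: "g \<in> set gl" using j by (simp add: g_def)
  have gU: "g \<in> upto_group j" using upto_insert[OF j] by (simp add: g_def)
  have finA: "finite (after j)" by simp
  let ?l = "\<lambda>\<eta> y. real (length (fc (gl ! j))) * ln (real N * sep_prob (extend j \<eta> y) (gl ! j)) * prior_density (after j) y"
  have integrand: "log_det_integrand f X gs j w (extend j \<eta> y) = ?l \<eta> y + log_mass {g} \<eta> * prior_density (after j) y"
    if \<eta>: "valid (upto_group j) \<eta>" and y: "valid (after j) y" for \<eta> y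
  proof -
    let ?e = "extend j \<eta> y"
    have mem: "?e \<in> \<Theta>" using \<eta> y by (simp add: extend_mem)
    have pos: "0 < pr ?e g r" if "r \<in> gcells g" for r using full_prob_pos[OF mem g that] .
    have s: "0 < real N * sep_prob ?e g" using N sep_prob_pos[OF mem g] by simp
    have "log_mass {g} ?e = log_mass {g} \<eta>"
      using gcoords_subset[OF gU] by (intro log_mass_local extend_upto) (auto simp: coords_of_def)
    moreover have "ln (\<Prod>r\<in>gcells g. 1 / pr ?e g r) = log_mass {g} ?e"
    proof -
      have "ln (\<Prod>r\<in>gcells g. 1 / pr ?e g r) = (\<Sum>r\<in>gcells g. ln (1 / pr ?e g r))"
        by (rule ln_prod[OF finite_gcells[OF g]]) (auto dest: pos)
      also have "\<dots> = (\<Sum>r\<in>gcells g. - ln (pr ?e g r))"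
        by (intro sum.cong refl) (simp add: ln_div pos)
      finally show ?thesis by (simp add: log_mass_def)
    qed
    moreover have "ln ((real N * sep_prob ?e g) ^ length (fc g) * (\<Prod>r\<in>gcells g. 1 / pr ?e g r)) =
        real (length (fc g)) * ln (real N * sep_prob ?e g) + ln (\<Prod>r\<in>gcells g. 1 / pr ?e g r)"
    proof -
      have "0 < (real N * sep_prob ?e g) ^ length (fc g)" using s by (rule zero_less_power)
      moreover have "0 < (\<Prod>r\<in>gcells g. 1 / pr ?e g r)" using pos by (intro prod_pos) auto
      ultimately have "ln ((real N * sep_prob ?e g) ^ length (fc g) * (\<Prod>r\<in>gcells g. 1 / pr ?e g r)) =
          ln ((real N * sep_prob ?e g) ^ length (fc g)) + ln (\<Prod>r\<in>gcells g. 1 / pr ?e g r)" by (rule ln_mult_pos)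
      then show ?thesis using ln_realpow[of "real N * sep_prob ?e g" "length (fc g)"] by simp
    qed
    moreover have "w ?e = prior_density (after j) y"
      unfolding bspec[OF w mem] by (rule prior_density_local) (rule extend_after)
    ultimately show ?thesis
      unfolding log_det_integrand_def f_def X_def gs_def det_h_block(3)[OF mem N j] g_def by (simp add: distrib_right)
  qed
  have after_range: "after_range gs \<Theta> j \<eta> = {y. valid (after j) y}" if "valid (upto_group j) \<eta>" for \<eta>
    unfolding gs_def with_after_eq using that by (simp add: extend_mem)
  \<comment> \<open>The determinant and \<open>w\<close> are known only for parameters in
    \<open>\<Theta>\<close>, so integrands are compared after multiplication by the
    indicator.\<close>
  have ind: "indicator {y. valid (after j) y} y *\<^sub>R log_det_integrand f X gs j w (extend j \<eta> y) =
      indicator {y. valid (after j) y} y *\<^sub>R (?l \<eta> y + log_mass {g} \<eta> * prior_density (after j) y)"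
    if "valid (upto_group j) \<eta>" for \<eta> y
    using integrand[OF that, of y] by (cases "valid (after j) y") simp_all
  have ints: "set_integrable M {y. valid (after j) y} (?l \<eta>)"
    "set_integrable M {y. valid (after j) y} (\<lambda>y. log_mass {g} \<eta> * prior_density (after j) y)" if "valid (upto_group j) \<eta>" for \<eta>
    unfolding M_def
    by (rule mean_log_integrable[OF j N that], rule set_integrable_mult_right, rule prior_density_integral(1)[OF finA])
  have wa: "with_after gs j \<eta> y = extend j \<eta> y" for \<eta> y unfolding gs_def by (rule with_after_eq)
  have M_eq: "lborel_on (coords_after gs j) = M" unfolding M_def gs_def coords_drop ..
  show int: "?int \<eta>" if \<eta>: "valid (upto_group j) \<eta>" for \<eta>
    unfolding M_eq after_range[OF \<eta>]
    unfolding wa set_integrable_def ind[OF \<eta>]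
    using set_integral_add(1)[OF ints[OF \<eta>]] unfolding set_integrable_def .
  have ker: "?ker \<eta>" if \<eta>: "valid (upto_group j) \<eta>" for \<eta>
  proof -
    have "(LINT y:after_range gs \<Theta> j \<eta>|lborel_on (coords_after gs j). log_det_integrand f X gs j w (with_after gs j \<eta> y)) =
        (LINT y:{y. valid (after j) y}|M. ?l \<eta> y + log_mass {g} \<eta> * prior_density (after j) y)"
      unfolding M_eq after_range[OF \<eta>]
      unfolding wa set_lebesgue_integral_def ind[OF \<eta>] ..
    also have "\<dots> = mean_log N j \<eta> + (LINT y:{y. valid (after j) y}|M. log_mass {g} \<eta> * prior_density (after j) y)"
      unfolding set_integral_add(2)[OF ints[OF \<eta>]] unfolding mean_log_def M_def by (rule refl)
    also have "(LINT y:{y. valid (after j) y}|M. log_mass {g} \<eta> * prior_density (after j) y) = log_mass {g} \<eta>"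
      using prior_density_integral(2)[OF finA] unfolding M_def by (simp add: set_integral_mult_right)
    finally have k: "ref_kernel f X gs \<Theta> j w \<eta> = exp (mean_log N j \<eta> / 2) * exp (log_mass {g} \<eta> / 2)"
      unfolding ref_kernel_def by (simp add: exp_add[symmetric] add_divide_distrib)
    have "\<eta> \<in> simplex_on (gcoords g)" using \<eta> gU by (simp add: valid_def)
    note p = full_prob_valid(1)[OF this g]
    have "exp (log_mass {g} \<eta> / 2) = exp (\<Sum>r\<in>gcells g. - ln (pr \<eta> g r) / 2)"
      by (simp add: log_mass_def sum_divide_distrib)
    also have "\<dots> = (\<Prod>r\<in>gcells g. exp (- ln (pr \<eta> g r) / 2))" by (rule exp_sum[OF finite_gcells[OF g]])
    also have "\<dots> = (\<Prod>r\<in>gcells g. pr \<eta> g r powr (-1/2))"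
    proof (intro prod.cong refl)
      fix r assume "r \<in> gcells g"
      then show "exp (- ln (pr \<eta> g r) / 2) = pr \<eta> g r powr (-1/2)" using p[of r] by (simp add: powr_def)
    qed
    finally have e: "exp (log_mass {g} \<eta> / 2) = (\<Prod>r\<in>gcells g. pr \<eta> g r powr (-1/2))" .
    show ?thesis unfolding k e unfolding g_def[symmetric] simplex_powr_gcoords[OF g] by (rule refl)
  qed
  then show "valid (upto_group j) \<eta> \<Longrightarrow> ?ker \<eta>" .
  have groups: "ref_kernel f X gs \<Theta> j w (with_group gs j \<theta> y) = exp (mean_log N j \<theta> / 2) * simplex_powr (-1/2) (gcoords g) y"
    if \<theta>: "\<theta> \<in> \<Theta>" and y: "y \<in> simplex_on (gcoords g)" for \<theta> y
  proof -
    have m: "with_group gs j \<theta> y = merge (coords_of (before j)) (gcoords g) (\<theta>, y)"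
      unfolding gs_def coords_take coords_nth[OF j] g_def ..
    let ?m = "merge (coords_of (before j)) (gcoords g) (\<theta>, y)"
    have v: "valid (upto_group j) ?m" using group_range_eq(2)[OF j \<theta>] y by (simp add: g_def)
    \<comment> \<open>\<open>?m\<close> differs from \<open>\<theta>\<close> on earlier groups
      nowhere, so the scalar part is a constant throughout the integration over group
      \<open>j\<close>.\<close>
    have "mean_log N j ?m = mean_log N j \<theta>"
      by (rule mean_log_local[OF j v Theta_valid[OF \<theta> set_take_subset]]) (simp add: merge_def)
    moreover have "simplex_powr (-1/2) (gcoords g) ?m = simplex_powr (-1/2) (gcoords g) y"
    proof (rule simplex_powr_restrict(1))
      have "{g} \<inter> before j = {}" using nth_notin_before[OF j] by (simp add: g_def)
      from coords_of_disjoint[OF this] show "?m c = y c" if "c \<in> gcoords g" for c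
        using that by (auto simp: merge_def coords_of_def)
    qed
    ultimately show ?thesis unfolding m ker[OF v] by (simp add: g_def)
  qed
  have range: "group_range gs \<Theta> j \<theta> = simplex_on (gcoords g)" if "\<theta> \<in> \<Theta>" for \<theta>
    unfolding gs_def coords_take coords_nth[OF j] group_range_eq(1)[OF j that] g_def by simp
  have indg: "indicator (simplex_on (gcoords g)) y *\<^sub>R ref_kernel f X gs \<Theta> j w (with_group gs j \<theta> y) =
      indicator (simplex_on (gcoords g)) y *\<^sub>R (exp (mean_log N j \<theta> / 2) * simplex_powr (-1/2) (gcoords g) y)" if "\<theta> \<in> \<Theta>" for \<theta> y
    using groups[OF that, of y] by (cases "y \<in> simplex_on (gcoords g)") simp_all
  have set_gs: "set (gs ! j) = gcoords g" unfolding gs_def coords_nth[OF j] g_def ..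
  show "set_integrable (lborel_on (set (gs ! j))) (group_range gs \<Theta> j \<theta>)
      (\<lambda>y. ref_kernel f X gs \<Theta> j w (with_group gs j \<theta> y))" if \<theta>: "\<theta> \<in> \<Theta>"
    unfolding range[OF \<theta>] set_integrable_def indg[OF \<theta>]
    unfolding set_gs set_integrable_def[symmetric]
    by (rule set_integrable_mult_right, rule simplex_powr_integral(1)[OF finite_gcoords])
  show "ref_normalizer f X gs \<Theta> j w \<theta> = exp (mean_log N j \<theta> / 2) * norm_const (gl ! j)" if \<theta>: "\<theta> \<in> \<Theta>"
    unfolding ref_normalizer_def range[OF \<theta>] set_lebesgue_integral_def indg[OF \<theta>]
    unfolding set_gs set_lebesgue_integral_def[symmetric] set_integral_mult_right norm_const_def g_def ..
qed

lemma ref_tail_eq: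
  assumes N: "N \<ge> 1" and "k \<le> length gl" "\<theta> \<in> \<Theta>"
  shows "ref_tail (lik N) (counts N) groups \<Theta> k \<theta> =
    prior_density (set (drop (length gl - k) gl)) \<theta>"
  using assms(2,3)
proof (induction k arbitrary: \<theta>)
  case 0
  then show ?case by (simp add: prior_density_def)
next
  case (Suc k)
  let ?f = "lik N"
  let ?w = "ref_tail ?f (counts N) groups \<Theta> k"
  define j where "j = length gl - Suc k"
  \<comment> \<open>With this index the groups strictly after \<open>j\<close> are exactly the last
    \<open>k\<close>, those covered by the induction hypothesis.\<close>
  have j: "j < length gl" "Suc j = length gl - k" using Suc.prems by (auto simp: j_def)
  have w: "\<forall>\<eta>\<in>\<Theta>. ?w \<eta> = prior_density (after j) \<eta>"
    unfolding j(2) using Suc.prems by (intro ballI Suc.IH) auto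
  note step = prior_step[where w="?w", OF j(1) N w]
  have v: "valid (upto_group j) \<theta>" by (intro Theta_valid Suc.prems set_take_subset)
  have cond: "ref_conditional ?f (counts N) groups \<Theta> j ?w \<theta> =
      simplex_powr (-1/2) (gcoords (gl ! j)) \<theta> / norm_const (gl ! j)"
    unfolding ref_conditional_def step(2)[OF v] step(4)[OF Suc.prems(2)] by simp
  have d: "set (drop j gl) = insert (gl ! j) (after j)" using Cons_nth_drop_Suc[OF j(1)] by (metis list.simps(15))
  have "gl ! j \<notin> after j" using upto_after(2)[of j] upto_insert[OF j(1)] by auto
  then have "prior_density (set (drop j gl)) \<theta> = simplex_powr (-1/2) (gcoords (gl ! j)) \<theta> / norm_const (gl ! j) * prior_density (after j) \<theta>"
    unfolding d prior_density_def by simp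
  then show ?case
    using cond bspec[OF w Suc.prems(2)] by (simp add: length_ordered_groups j_def[symmetric])
qed

lemma prior_exists:
  assumes N: "N \<ge> 1"
  shows "reference_prior_exists (lik N) (counts N) groups \<Theta>"
  unfolding reference_prior_exists_def
proof (intro ballI conjI allI impI)
  let ?f = "lik N"
  fix \<theta> assume \<theta>: "\<theta> \<in> \<Theta>"
  fix n :: "('v \<Rightarrow> 'a) \<Rightarrow> nat"
  show "0 < ?f \<theta> n"
    unfolding multinomial_prob_def cut_dist_eq[OF \<theta>]
    by (intro mult_pos_pos divide_pos_pos prod_pos zero_less_power ballI theta_dist_pos[OF \<theta>]) auto
  fix c assume c: "c \<in> coord_set"
  obtain R S s r where cc: "c = ((R, S, s), r)" by (metis surj_pair)
  show "(\<lambda>t. ln (?f (\<theta>(c := t)) n)) differentiable at (\<theta> c)"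
    unfolding cc real_differentiable_def by (rule exI, rule theta_dist_score[OF \<theta> c[unfolded cc]])
next
  fix \<theta> assume \<theta>: "\<theta> \<in> \<Theta>"
  show "invertible_mat (fisher_info (lik N) (counts N) (concat groups) \<theta>)"
    unfolding fisher_info_eq[OF \<theta>]
    using block_inverse.entry_mat_inverses(3)[OF block_inverse_info[OF \<theta> N], of "length groups"] by simp
next
  let ?f = "lik N"
  fix \<theta> j assume \<theta>: "\<theta> \<in> \<Theta>" and "j < length groups"
  then have j: "j < length gl" by (simp add: length_ordered_groups)
  have w: "\<forall>\<eta>\<in>\<Theta>. ref_tail ?f (counts N) groups \<Theta> (length groups - Suc j) \<eta> =
      prior_density (after j) \<eta>"
  proof
    fix \<eta> assume "\<eta> \<in> \<Theta>"
    moreover have "length gl - (length gl - Suc j) = Suc j" using j by simp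
    ultimately show "ref_tail ?f (counts N) groups \<Theta> (length groups - Suc j) \<eta> =
        prior_density (after j) \<eta>"
      using ref_tail_eq[OF N, of "length gl - Suc j" \<eta>] by (simp add: length_ordered_groups)
  qed
  have v: "valid (upto_group j) \<theta>" by (intro Theta_valid \<theta> set_take_subset)
  have g: "gl ! j \<in> set gl" using j by simp
  note step = prior_step[where w="ref_tail ?f (counts N) groups \<Theta> (length groups - Suc j)", OF j N w]
  have "0 < Determinant.det (h_block ?f (counts N) groups j \<theta>)"
    unfolding det_h_block(3)[OF \<theta> N j]
    using N sep_prob_pos[OF \<theta> g] full_prob_pos[OF \<theta> g] by (intro mult_pos_pos zero_less_power prod_pos) auto
  moreover have "0 < ref_normalizer ?f (counts N) groups \<Theta> j
      (ref_tail ?f (counts N) groups \<Theta> (length groups - Suc j)) \<theta>"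
    unfolding step(4)[OF \<theta>] using norm_const_pos[of "gl ! j"] by simp
  ultimately show "let w = ref_tail ?f (counts N) groups \<Theta> (length groups - Suc j) in
        invertible_mat (Sigma_block ?f (counts N) groups j \<theta>) \<and>
        0 < Determinant.det (h_block ?f (counts N) groups j \<theta>) \<and>
        set_integrable (lborel_on (coords_after groups j)) (after_range groups \<Theta> j \<theta>)
          (\<lambda>y. log_det_integrand ?f (counts N) groups j w (with_after groups j \<theta> y)) \<and>
        set_integrable (lborel_on (set (groups ! j))) (group_range groups \<Theta> j \<theta>)
          (\<lambda>y. ref_kernel ?f (counts N) groups \<Theta> j w (with_group groups j \<theta> y)) \<and>
        0 < ref_normalizer ?f (counts N) groups \<Theta> j w \<theta>"
    unfolding Let_def by (intro conjI det_h_block(2)[OF \<theta> N j] step(1)[OF v] step(3)[OF \<theta>])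
qed

lemma reference_prior_eq:
  assumes "N \<ge> 1" "\<theta> \<in> \<Theta>"
  shows "reference_prior (lik N) (counts N) groups \<Theta> \<theta> =
    (\<Prod>g\<in>set gl. 1 / norm_const g) *
      (\<Prod>(R, S)\<in>F. \<Prod>s\<in>cells L S. \<Prod>r\<in>cells L R. conditional V L (cut_dist V E L gl fc \<theta>) R S s r powr (-1/2))"
proof -
  have finF: "finite F" by (rule perfect_factorsD(1)[OF factors])
  have finS: "finite (cells L S)" if "(R, S) \<in> F" for R S
    using perfect_factorsD(3)[OF factors that] verts by (intro finite_cells[OF levels]) simp
  \<comment> \<open>Groups become dependent pairs of a factor and a conditioning cell, so the
    product over groups can be iterated.\<close>
  have gl: "set gl = (\<lambda>((R, S), s). (R, S, s)) ` Sigma F (\<lambda>(R, S). cells L S)"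
    unfolding set_gl by force
  have "reference_prior (lik N) (counts N) groups \<Theta> \<theta> =
      prior_density (set gl) \<theta>"
    unfolding reference_prior_def length_ordered_groups using ref_tail_eq[OF assms(1) order_refl assms(2)] by simp
  also have "\<dots> = (\<Prod>g\<in>set gl. 1 / norm_const g) * (\<Prod>g\<in>set gl. \<Prod>r\<in>gcells g. pr \<theta> g r powr (-1/2))"
    unfolding prior_density_def prod.distrib[symmetric] by (intro prod.cong refl) (simp add: simplex_powr_gcoords)
  also have "(\<Prod>g\<in>set gl. \<Prod>r\<in>gcells g. pr \<theta> g r powr (-1/2)) =
      (\<Prod>z\<in>Sigma F (\<lambda>(R, S). cells L S). case z of ((R, S), s) \<Rightarrow> \<Prod>r\<in>cells L R. pr \<theta> (R, S, s) r powr (-1/2))"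
    unfolding gl by (subst prod.reindex) (auto simp: inj_on_def gcells_def intro!: prod.cong)
  also have "\<dots> = (\<Prod>f\<in>F. \<Prod>s\<in>(case f of (R, S) \<Rightarrow> cells L S). case (f, s) of ((R, S), s) \<Rightarrow> \<Prod>r\<in>cells L R. pr \<theta> (R, S, s) r powr (-1/2))"
    using finF finS by (subst prod.Sigma) (auto simp: split_beta)
  also have "\<dots> = (\<Prod>(R, S)\<in>F. \<Prod>s\<in>cells L S. \<Prod>r\<in>cells L R. conditional V L (cut_dist V E L gl fc \<theta>) R S s r powr (-1/2))"
  proof (intro prod.cong refl)
    fix f assume f: "f \<in> F"
    obtain R S where RS: "f = (R, S)" by (cases f)
    show "(\<Prod>s\<in>(case f of (R, S) \<Rightarrow> cells L S). case (f, s) of ((R, S), s) \<Rightarrow> \<Prod>r\<in>cells L R. pr \<theta> (R, S, s) r powr (-1/2)) =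
        (case f of (R, S) \<Rightarrow> \<Prod>s\<in>cells L S. \<Prod>r\<in>cells L R. conditional V L (cut_dist V E L gl fc \<theta>) R S s r powr (-1/2))"
      unfolding RS prod.case cut_dist_eq[OF assms(2)]
      by (intro prod.cong refl) (simp add: conditional_theta_dist[OF assms(2) group_of_factor[OF f[unfolded RS]]])
  qed
  finally show ?thesis .
qed

end

section \<open>The product over cliques\<close>

lemma residuals_disjoint:
  assumes "l < length Cs" "l < l'"
  shows "residual Cs l \<inter> residual Cs l' = {}"
proof -
  have "residual Cs l \<subseteq> \<Union>(set (take l' Cs))"
    using assms unfolding mem_Union_take subset_iff by (auto simp: residual_def)
  then show ?thesis using residual_disjoint[of Cs l'] by blast
qed

text \<open>The pieces may overlap as long as common elements contribute one. Pairs from different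
  parts of the graph can coincide only with an empty residual, and such a pair contributes
  one.\<close>

lemma prod_UN_neutral:
  assumes "finite I" "\<And>i. i \<in> I \<Longrightarrow> finite (A i)"
    and "\<And>i j x. i \<in> I \<Longrightarrow> j \<in> I \<Longrightarrow> i \<noteq> j \<Longrightarrow> x \<in> A i \<Longrightarrow> x \<in> A j \<Longrightarrow> h x = 1"
  shows "prod h (\<Union>i\<in>I. A i) = (\<Prod>i\<in>I. prod h (A i))"
  using assms
proof (induction I rule: finite_induct)
  case (insert i I)
  have "prod h (A i \<union> (\<Union>i\<in>I. A i)) = prod h (A i) * prod h (\<Union>i\<in>I. A i)"
  proof (rule prod.union_inter_neutral)
    show "\<forall>x\<in>A i \<inter> (\<Union>i\<in>I. A i). h x = 1"
    proof
      fix x assume "x \<in> A i \<inter> (\<Union>i\<in>I. A i)"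
      then obtain k where "k \<in> I" "x \<in> A k" "x \<in> A i" by blast
      then show "h x = 1" using insert.prems(2)[of i k x] insert.hyps(2) by blast
    qed
  qed (use insert.hyps(1) insert.prems(1) in auto)
  moreover have "prod h (\<Union>i\<in>I. A i) = (\<Prod>i\<in>I. prod h (A i))"
  proof (rule insert.IH)
    show "finite (A k)" if "k \<in> I" for k using insert.prems(1) that by simp
    show "h x = 1" if "k \<in> I" "m \<in> I" "k \<noteq> m" "x \<in> A k" "x \<in> A m" for k m x
      by (rule insert.prems(2)[OF _ _ that(3,4,5)]) (use that in auto)
  qed
  ultimately show ?case using insert.hyps by simp
qed simp

text \<open>Passing from the set of pairs to positions in the clique order is harmless: residuals at
  different positions are disjoint, so equal pairs have an empty residual and value one.\<close>

lemma prod_marginal_factors: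
  fixes h :: "'v set \<times> 'v set \<Rightarrow> real"
  assumes h: "\<And>S. ({}, S) \<in> marginal_factors Cs \<Longrightarrow> h ({}, S) = 1" and Cs: "Cs \<noteq> []"
  shows "prod h (marginal_factors Cs) = h (Cs ! 0, {}) * (\<Prod>l = 1..<length Cs. h (residual Cs l, separator Cs l))"
proof -
  let ?k = "\<lambda>l. (residual Cs l, separator Cs l)"
  have F: "marginal_factors Cs = ?k ` {..<length Cs}" unfolding marginal_factors_def by auto
  have I: "{..<length Cs} = insert 0 {1..<length Cs}" using Cs by auto
  have "prod h (?k ` {..<length Cs}) = prod (h \<circ> ?k) {..<length Cs}"
  proof (rule prod.reindex_nontrivial)
    fix l l' assume l: "l \<in> {..<length Cs}" "l' \<in> {..<length Cs}" "l \<noteq> l'" "?k l = ?k l'"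
    have "residual Cs l \<inter> residual Cs l' = {}"
      using residuals_disjoint[of l Cs l'] residuals_disjoint[of l' Cs l] l(1-3) by (cases "l < l'") auto
    then have e: "residual Cs l = {}" using l(4) by simp
    have "?k l \<in> marginal_factors Cs" unfolding F using l(1) by (rule imageI)
    then show "h (?k l) = 1" using h unfolding e by simp
  qed simp
  also have "\<dots> = h (?k 0) * (\<Prod>l = 1..<length Cs. h (?k l))" unfolding I by simp
  also have "?k 0 = (Cs ! 0, {})" by (simp add: residual_def separator_def)
  finally show ?thesis unfolding F .
qed

lemma prod_component_factors:
  fixes h :: "'v set \<times> 'v set \<Rightarrow> real"
  assumes h: "\<And>S. ({}, S) \<in> component_factors V E B Cs \<Longrightarrow> h ({}, S) = 1" and Cs: "Cs \<noteq> []"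
  shows "prod h (component_factors V E B Cs) =
    h (Cs ! 0 - boundary V E B, boundary V E B) * (\<Prod>j = 1..<length Cs. h (residual Cs j, separator Cs j))"
proof -
  let ?k = "\<lambda>l. if l = 0 then (Cs ! 0 - boundary V E B, boundary V E B) else (residual Cs l, separator Cs l)"
  have F: "component_factors V E B Cs = ?k ` {..<length Cs}"
  proof -
    have "{..<length Cs} = insert 0 {0<..<length Cs}" using Cs by auto
    then have "?k ` {..<length Cs} = insert (?k 0) (?k ` {0<..<length Cs})" by (simp only: image_insert)
    also have "?k ` {0<..<length Cs} = (\<lambda>l. (residual Cs l, separator Cs l)) ` {0<..<length Cs}"
      by (intro image_cong refl) auto
    finally show ?thesis unfolding component_factors_def by auto
  qed
  have sub: "fst (?k l) \<subseteq> residual Cs l" for l by (auto simp: residual_def separator_def)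
  have I: "{..<length Cs} = insert 0 {1..<length Cs}" using Cs by auto
  have "prod h (?k ` {..<length Cs}) = prod (h \<circ> ?k) {..<length Cs}"
  proof (rule prod.reindex_nontrivial)
    fix l l' assume l: "l \<in> {..<length Cs}" "l' \<in> {..<length Cs}" "l \<noteq> l'" "?k l = ?k l'"
    have "residual Cs l \<inter> residual Cs l' = {}"
      using residuals_disjoint[of l Cs l'] residuals_disjoint[of l' Cs l] l(1-3) by (cases "l < l'") auto
    then have e: "fst (?k l) = {}" using sub[of l] sub[of l'] unfolding l(4)[symmetric] by blast
    define S where "S = snd (?k l)"
    have S: "?k l = ({}, S)" by (rule prod_eqI) (simp_all only: e S_def fst_conv snd_conv)
    have "?k l \<in> component_factors V E B Cs" unfolding F using l(1) by (rule imageI)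
    then show "h (?k l) = 1" unfolding S by (rule h)
  qed simp
  also have "\<dots> = h (?k 0) * (\<Prod>l = 1..<length Cs. h (?k l))" unfolding I by simp
  also have "?k 0 = (Cs ! 0 - boundary V E B, boundary V E B)" by simp
  also have "(\<Prod>l = 1..<length Cs. h (?k l)) = (\<Prod>l = 1..<length Cs. h (residual Cs l, separator Cs l))"
    by (intro prod.cong refl) simp
  finally show ?thesis unfolding F .
qed

lemma conditional_empty_residual:
  assumes "levels_ok L V" "\<And>x. x \<in> cells L V \<Longrightarrow> 0 < p x" "S \<subseteq> V" "s \<in> cells L S"
  shows "conditional V L p {} S s r = 1"
proof -
  have "merge {} S (r, s) = s" using assms(4) by (auto simp: merge_def fun_eq_iff PiE_iff extensional_def)
  then show ?thesis using marginal_pos[where p=p, OF assms] by (simp add: conditional_def)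
qed

lemma conditional_empty_separator:
  assumes "levels_ok L V" "(\<Sum>x\<in>cells L V. p x) = 1" "r \<in> cells L R"
  shows "conditional V L p R {} (\<lambda>_. undefined) r = marginal V L p R r"
proof -
  have "merge R {} (r, \<lambda>_. undefined) = r" using assms(3) by (auto simp: merge_def fun_eq_iff PiE_iff extensional_def)
  moreover have "marginal V L p {} (\<lambda>_. undefined) = 1" 
  proof -
    have "{j \<in> cells L V. restrict j {} = (\<lambda>_. undefined)} = cells L V" by (auto simp: restrict_def)
    then show ?thesis unfolding marginal_def using assms(2) by simp
  qed
  ultimately show ?thesis by (simp add: conditional_def)
qed

theorem theorem4p1:
  fixes V A :: "'v set" and E :: "'v set set" and L :: "'v \<Rightarrow> 'a set" and N :: nat
    and CA :: "'v set list" and CB :: "'v set \<Rightarrow> 'v set list"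
    and gl :: "('v, 'a) group list" and fc :: "('v, 'a) group \<Rightarrow> ('v \<Rightarrow> 'a) list"
  assumes "simple_graph V E" and "decomposable E V"
    and "\<And>\<gamma>. \<gamma> \<in> V \<Longrightarrow> finite (L \<gamma>) \<and> L \<gamma> \<noteq> {}"
    and "N \<ge> 1"
    and "is_cut V E A"
    and "perfect_clique_order E A CA"
    and "\<And>B. B \<in> graph_components E (V - A) \<Longrightarrow>
           perfect_clique_order E (B \<union> boundary V E B) (CB B) \<and> boundary V E B \<subseteq> CB B ! 0"
    and "distinct gl" and "set gl = cut_groups V E L A CA CB"
    and "\<And>g. g \<in> set gl \<Longrightarrow> all_but_one L g (fc g)"
  shows "let \<Theta> = cut_space gl fc;
             gs = ordered_groups gl fc;
             X = count_tables V L N;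
             f = (\<lambda>\<theta>. multinomial_prob V L N (cut_dist V E L gl fc \<theta>))
         in bij_betw (cut_param V L gl fc) (positive_markov_family V E L) \<Theta> \<and>
            reference_prior_exists f X gs \<Theta> \<and>
            (\<exists>c>0. \<forall>\<theta>\<in>\<Theta>. let p = cut_dist V E L gl fc \<theta> in
               reference_prior f X gs \<Theta> \<theta> = c *
                 ((\<Prod>i\<in>cells L (CA ! 0). marginal V L p (CA ! 0) i powr (-1/2)) *
                  (\<Prod>l = 1..<length CA. \<Prod>s\<in>cells L (separator CA l).
                     \<Prod>r\<in>cells L (residual CA l).
                       conditional V L p (residual CA l) (separator CA l) s r powr (-1/2)) *
                  (\<Prod>B\<in>graph_components E (V - A).
                     (\<Prod>s\<in>cells L (boundary V E B). \<Prod>r\<in>cells L (CB B ! 0 - boundary V E B).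
                        conditional V L p (CB B ! 0 - boundary V E B) (boundary V E B) s r
                          powr (-1/2)) *
                     (\<Prod>j = 1..<length (CB B). \<Prod>s\<in>cells L (separator (CB B) j).
                        \<Prod>r\<in>cells L (residual (CB B) j).
                          conditional V L p (residual (CB B) j) (separator (CB B) j) s r
                            powr (-1/2)))))"
proof -
  define F where "F = marginal_factors CA \<union> (\<Union>B\<in>graph_components E (V - A). component_factors V E B (CB B))"
  have finV: "finite V" using assms(1) by (simp add: simple_graph_def)
  have AV: "A \<subseteq> V" using assms(5) by (simp add: is_cut_def)
  have finA: "finite A" using AV finV by (rule finite_subset)
  have lv: "levels_ok L V" using finV assms(3) by (simp add: levels_ok_def)
  have pf: "perfect_factors E F" "verts F = V"
    unfolding F_def by (rule perfect_factors_cut[OF finV AV assms(6)], erule assms(7))+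
  interpret factor_model V E L F gl fc
    by unfold_locales (use pf lv assms(8,9,10) in \<open>auto simp: cut_groups_def F_def\<close>)
  let ?comps = "graph_components E (V - A)"
  \<comment> \<open>The residuals of a component stay inside the component, and those of the cut
    inside \<open>A\<close>. Hence pairs shared by two of these pieces have an empty
    residual.\<close>
  have comp_sub: "R \<subseteq> B" if B: "B \<in> ?comps" and RS: "(R, S) \<in> component_factors V E B (CB B)" for B R S
  proof -
    have sub: "CB B ! j \<subseteq> B \<union> boundary V E B" if "j < length (CB B)" for j
      using perfect_order_facts(4)[OF conjunct1[OF assms(7)[OF B]] _ that] finite_subset[OF _ finV]
        component_facts(1)[OF B] by (auto simp: boundary_def)
    have bd: "boundary V E B \<subseteq> CB B ! 0" using assms(7)[OF B] by simp
    have ne: "CB B \<noteq> []"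
      using perfect_order_facts(1)[OF conjunct1[OF assms(7)[OF B]]] finite_subset[OF _ finV]
        component_facts(1)[OF B] by (auto simp: boundary_def)
    consider "R = CB B ! 0 - boundary V E B" | j where "R = residual (CB B) j" "0 < j" "j < length (CB B)"
      using RS unfolding component_factors_def by auto
    then show ?thesis
    proof cases
      case 1
      then show ?thesis using sub[of 0] ne by auto
    next
      case 2
      have "CB B ! 0 \<subseteq> \<Union>(set (take j (CB B)))" using 2 unfolding subset_iff mem_Union_take by auto
      then show ?thesis using sub[OF 2(3)] bd residual_disjoint[of "CB B" j] unfolding 2(1) residual_def by blast
    qed
  qed
  have marg_sub: "R \<subseteq> A" if RS: "(R, S) \<in> marginal_factors CA" for R S
    using RS perfect_factors_marginal(2)[OF assms(6) finA] by force
  have CA: "CA \<noteq> []" by (rule perfect_order_facts(1)[OF assms(6) finA])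
  have CB: "CB B \<noteq> []" if B: "B \<in> ?comps" for B
    using perfect_order_facts(1)[OF conjunct1[OF assms(7)[OF B]]] finite_subset[OF _ finV]
      component_facts(1)[OF B] by (auto simp: boundary_def)
  have formula: "(\<Prod>(R, S)\<in>F. \<Prod>s\<in>cells L S. \<Prod>r\<in>cells L R. conditional V L p R S s r powr (-1/2)) =
      (\<Prod>i\<in>cells L (CA ! 0). marginal V L p (CA ! 0) i powr (-1/2)) *
      (\<Prod>l = 1..<length CA. \<Prod>s\<in>cells L (separator CA l). \<Prod>r\<in>cells L (residual CA l).
         conditional V L p (residual CA l) (separator CA l) s r powr (-1/2)) *
      (\<Prod>B\<in>?comps.
         (\<Prod>s\<in>cells L (boundary V E B). \<Prod>r\<in>cells L (CB B ! 0 - boundary V E B).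
            conditional V L p (CB B ! 0 - boundary V E B) (boundary V E B) s r powr (-1/2)) *
         (\<Prod>j = 1..<length (CB B). \<Prod>s\<in>cells L (separator (CB B) j). \<Prod>r\<in>cells L (residual (CB B) j).
            conditional V L p (residual (CB B) j) (separator (CB B) j) s r powr (-1/2)))"
    if pos: "\<And>x. x \<in> cells L V \<Longrightarrow> 0 < p x" and sum1: "(\<Sum>x\<in>cells L V. p x) = 1" for p
  proof -
    define h where "h = (\<lambda>(R, S). \<Prod>s\<in>cells L S. \<Prod>r\<in>cells L R. conditional V L p R S s r powr (-1/2))"
    have h0: "h ({}, S) = 1" if "({}, S) \<in> F" for S
    proof -
      have "S \<subseteq> V" using perfect_factorsD(3)[OF pf(1) that] unfolding pf(2) .
      then show ?thesis unfolding h_def prod.case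
        by (intro prod.neutral ballI) (simp add: conditional_empty_residual[OF lv pos])
    qed
    have finF: "finite F" by (rule perfect_factorsD(1)[OF pf(1)])
    have finM: "finite (marginal_factors CA)" using finF unfolding F_def by simp
    have finC: "finite (component_factors V E B (CB B))" if "B \<in> ?comps" for B
      using finF that unfolding F_def by (auto intro: finite_subset)
    have finB: "finite ?comps" using finV by (intro finite_graph_components) simp
    have "prod h F = prod h (marginal_factors CA) * prod h (\<Union>B\<in>?comps. component_factors V E B (CB B))"
      unfolding F_def
    proof (rule prod.union_inter_neutral[OF finM])
      show "finite (\<Union>B\<in>?comps. component_factors V E B (CB B))" using finB finC by blast
      show "\<forall>x\<in>marginal_factors CA \<inter> (\<Union>B\<in>?comps. component_factors V E B (CB B)). h x = 1"
      proof
        fix x assume x: "x \<in> marginal_factors CA \<inter> (\<Union>B\<in>?comps. component_factors V E B (CB B))"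
        obtain R S where RS: "x = (R, S)" by (cases x)
        obtain B where B: "B \<in> ?comps" "(R, S) \<in> component_factors V E B (CB B)" "(R, S) \<in> marginal_factors CA"
          using x RS by blast
        have "R = {}" using comp_sub[OF B(1,2)] marg_sub[OF B(3)] component_facts(1)[OF B(1)] by blast
        then show "h x = 1" using h0[of S] B(3) unfolding RS F_def by blast
      qed
    qed
    also have "prod h (\<Union>B\<in>?comps. component_factors V E B (CB B)) = (\<Prod>B\<in>?comps. prod h (component_factors V E B (CB B)))"
    proof (rule prod_UN_neutral[OF finB finC])
      fix B B' x assume B: "B \<in> ?comps" "B' \<in> ?comps" "B \<noteq> B'"
        and x: "x \<in> component_factors V E B (CB B)" "x \<in> component_factors V E B' (CB B')"
      obtain R S where RS: "x = (R, S)" by (cases x)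
      have "R = {}" using comp_sub[OF B(1)] comp_sub[OF B(2)] component_facts(3)[OF B] x unfolding RS by blast
      then show "h x = 1" using h0[of S] B(1) x(1) unfolding RS F_def by blast
    qed
    also have "(\<Prod>B\<in>?comps. prod h (component_factors V E B (CB B))) =
        (\<Prod>B\<in>?comps. h (CB B ! 0 - boundary V E B, boundary V E B) *
          (\<Prod>j = 1..<length (CB B). h (residual (CB B) j, separator (CB B) j)))"
    proof (intro prod.cong refl)
      fix B assume B: "B \<in> ?comps"
      show "prod h (component_factors V E B (CB B)) = h (CB B ! 0 - boundary V E B, boundary V E B) *
          (\<Prod>j = 1..<length (CB B). h (residual (CB B) j, separator (CB B) j))"
      proof (rule prod_component_factors[OF _ CB[OF B]])
        show "h ({}, S) = 1" if "({}, S) \<in> component_factors V E B (CB B)" for S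
          using that B by (intro h0) (auto simp: F_def)
      qed
    qed
    also have "prod h (marginal_factors CA) = h (CA ! 0, {}) * (\<Prod>l = 1..<length CA. h (residual CA l, separator CA l))"
    proof (rule prod_marginal_factors[OF _ CA])
      show "h ({}, S) = 1" if "({}, S) \<in> marginal_factors CA" for S using that by (intro h0) (auto simp: F_def)
    qed
    also have "h (CA ! 0, {}) = (\<Prod>i\<in>cells L (CA ! 0). marginal V L p (CA ! 0) i powr (-1/2))"
      unfolding h_def prod.case PiE_empty_domain by (simp add: conditional_empty_separator[OF lv sum1])
    finally show ?thesis unfolding h_def prod.case .
  qed
  \<comment> \<open>The constant of proportionality collects the reciprocal Dirichlet normalizers,
    which do not depend on the parameter.\<close>
  have c: "0 < (\<Prod>g\<in>set gl. 1 / norm_const g)" using norm_const_pos by (intro prod_pos) simp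
  show ?thesis
    unfolding Let_def
  proof (intro conjI exI[of _ "\<Prod>g\<in>set gl. 1 / norm_const g"] ballI bij_cut_param prior_exists[OF assms(4)] c)
  qed (subst reference_prior_eq[OF assms(4)], assumption, subst formula,
      simp_all add: cut_dist_eq theta_dist_pos sum_theta_dist)
qed

end
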